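(* Consider a partially observed Markov decision process with state space $\mathsf{X}$, action space $\mathsf{A}$, observation space $\mathsf{Y}$, transition probability $p(\cdot|x,a)$, observation channel $r(\cdot|x)$ and one-stage cost $\tilde c:\mathsf{X}\times\mathsf{A}\to[0,\infty)$, and suppose that: (a) $\tilde c$ is continuous and bounded; (b) the stochastic kernel $p(\cdot|x,a)$ is weakly continuous in $(x,a)\in\mathsf{X}\times\mathsf{A}$; (c) the stochastic kernel $r(\cdot|x)$ is continuous in total variation, i.e. if $x_k\to x$ then $r(\cdot|x_k)\to r(\cdot|x)$ in total variation; (d) $\mathsf{A}$ is compact. Let $\mathsf{Z}=\mathcal{P}(\mathsf{X})$, let $\eta$ and $c$ be the transition probability and the one-stage cost of the associated belief-MDP, and let $\Lambda_n$ ($n\ge1$) be the fixed finite $1/n$-nets in $\mathsf{A}$. Then $$\lim_{n\to\infty}|J_n^*(z)-J^*(z)|=0\quad\text{for all } z\in\mathsf{Z},$$ where $J_n^*$ is the discounted value function of the belief-MDP with components $\{\mathsf{Z},\Lambda_n,\eta,c\}$ and $J^*$ is the discounted value function of the belief-MDP with components $\{\mathsf{Z},\mathsf{A},\eta,c\}$.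
   Context: $\mathsf{X},\mathsf{A},\mathsf{Y}$ are Borel spaces (Borel subsets of complete separable metric spaces); $d_{\mathsf{A}}$ is the metric on $\mathsf{A}$; $\beta\in(0,1)$ is a discount factor. $p$ is a stochastic kernel on $\mathsf{X}$ given $\mathsf{X}\times\mathsf{A}$ and $r$ is a stochastic kernel on $\mathsf{Y}$ given $\mathsf{X}$. $\mathcal{P}(\mathsf{X})$ is the set of probability measures on $\mathsf{X}$ with the topology of weak convergence and its Borel $\sigma$-algebra. Belief-MDP. The belief-MDP has state space $\mathsf{Z}=\mathcal{P}(\mathsf{X})$, the state at time $t$ being the posterior distribution of the hidden state $x_t$ given the observations $y_0,\dots,y_t$ and actions $a_0,\dots,a_{t-1}$. Its transition probability is $$\eta(D|z,a)=\int_{\mathsf{Y}}1_{\{F(z,a,y)\in D\}}\,H(dy|z,a),\qquad D\subset\mathcal{P}(\mathsf{X})\text{ Borel},$$ where $H(\cdot|z,a)=\Pr\{y_{t+1}\in\cdot\,|z_t=z,a_t=a\}$ and $F(z,a,y)=\Pr\{x_{t+1}\in\cdot\,|z_t=z,a_t=a,y_{t+1}=y\}\in\mathcal{P}(\mathsf{X})$. Explicitly, with $R(B\times C|z,a)=\int_{\mathsf{X}}\int_B r(C|x')\,p(dx'|x,a)\,z(dx)$, one has $H(C|z,a)=R(\mathsf{X}\times C|z,a)$, and $F$ is a (jointly measurable) regular conditional distribution satisfying $R(B\times C|z,a)=\int_C F(z,a,y)(B)\,H(dy|z,a)$ for all Borel $B\subset\mathsf{X}$, $C\subset\mathsf{Y}$.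 Its one-stage cost is $c(z,a)=\int_{\mathsf{X}}\tilde c(x,a)\,z(dx)$. Nets. For each $n\ge1$ a finite set $\Lambda_n=\{a_{n,1},\dots,a_{n,k_n}\}\subset\mathsf{A}$ is fixed with $\min_i d_{\mathsf{A}}(a,a_{n,i})<1/n$ for all $a\in\mathsf{A}$. Discounted value function. For a Markov decision process with components $\{\mathsf{Z},\mathsf{B},\eta,c\}$ (state space, action space $\mathsf{B}\in\{\mathsf{A},\Lambda_n\}$, transition probability, cost; all actions admissible in all states), a policy is a sequence $\varphi=\{\varphi_t\}_{t\ge0}$ of stochastic kernels $\varphi_t$ on $\mathsf{B}$ given $(\mathsf{Z}\times\mathsf{B})^t\times\mathsf{Z}$. With $E_z^\varphi$ the expectation under which $z_0=z$, $a_t\sim\varphi_t(\cdot|z_0,a_0,\dots,z_t)$, $z_{t+1}\sim\eta(\cdot|z_t,a_t)$, the discounted value function at $z$ is $\inf_\varphi E_z^\varphi\big[\sum_{t=0}^\infty\beta^t c(z_t,a_t)\big]$, the infimum being over all policies. *)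

theory Defs
  imports "HOL-Probability.Probability"
begin

text \<open>
  A Borel space is a Borel set \<open>X\<close> of a type of class \<open>polish_space\<close>, with the \<open>\<sigma>\<close>-algebra
  \<open>restrict_space borel X\<close>. A stochastic kernel on \<open>M\<close> given \<open>N\<close> is an element of
  \<open>N \<rightarrow>\<^sub>M prob_algebra M\<close>.
\<close>

abbreviation borel_on :: "'a::topological_space set \<Rightarrow> 'a measure" where
  "borel_on X \<equiv> restrict_space borel X"

definition prob_measures :: "'a::topological_space set \<Rightarrow> 'a measure set" where
  "prob_measures X = {\<mu>. sets \<mu> = sets (borel_on X) \<and> prob_space \<mu>}"

text \<open>The topology of weak convergence: the coarsest one making \<open>\<mu> \<mapsto> \<integral> f d\<mu>\<close> continuous for every
  bounded continuous \<open>f\<close> on \<open>X\<close>.\<close>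

definition weak_topology :: "'a::topological_space set \<Rightarrow> 'a measure topology" where
  "weak_topology X = topology_generated_by
     {{\<mu> \<in> prob_measures X. (\<integral>x. f x \<partial>\<mu>) \<in> U} | (f :: 'a \<Rightarrow> real) U.
        continuous_on X f \<and> bounded (f ` X) \<and> open U}"

lemma topspace_weak_topology: "topspace (weak_topology X) = prob_measures X"
  unfolding weak_topology_def topology_generated_by_topspace
proof (rule antisym)
  show "prob_measures X \<subseteq> \<Union> {{\<mu> \<in> prob_measures X. (\<integral>x. f x \<partial>\<mu>) \<in> U} | (f :: 'a \<Rightarrow> real) U.
        continuous_on X f \<and> bounded (f ` X) \<and> open U}"
    by (rule Union_upper, rule CollectI, rule exI[of _ "\<lambda>_. 0"], rule exI[of _ UNIV])
       (auto simp: bounded_iff)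
qed auto

definition belief_space :: "'a::topological_space set \<Rightarrow> 'a measure measure" where
  "belief_space X = sigma (prob_measures X) {U. openin (weak_topology X) U}"

definition weakly_continuous_kernel ::
    "'x::topological_space set \<Rightarrow> 'a::topological_space set \<Rightarrow> ('x \<Rightarrow> 'a \<Rightarrow> 'x measure) \<Rightarrow> bool" where
  "weakly_continuous_kernel X A p \<longleftrightarrow>
     continuous_map (top_of_set (X \<times> A)) (weak_topology X) (\<lambda>(x, a). p x a)"

definition tv_dist :: "'y measure \<Rightarrow> 'y measure \<Rightarrow> real" where
  "tv_dist \<mu> \<nu> = (SUP C \<in> sets \<mu>. \<bar>measure \<mu> C - measure \<nu> C\<bar>)"

definition tv_continuous_kernel ::
    "'x::topological_space set \<Rightarrow> ('x \<Rightarrow> 'y measure) \<Rightarrow> bool" where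
  "tv_continuous_kernel X r \<longleftrightarrow>
     (\<forall>u. \<forall>x \<in> X. (\<forall>k. u k \<in> X) \<longrightarrow> u \<longlonglongrightarrow> x \<longrightarrow> (\<lambda>k. tv_dist (r (u k)) (r x)) \<longlonglongrightarrow> 0)"


section \<open>Markov decision processes\<close>

text \<open>The time-\<open>t\<close> history \<open>(z\<^sub>0, a\<^sub>0, \<dots>, z\<^sub>t)\<close> is the pair of \<open>i \<mapsto> (z\<^sub>i, a\<^sub>i)\<close> on \<open>{0..<t}\<close> and
  \<open>z\<^sub>t\<close>.\<close>

type_synonym ('s, 'b) policy = "nat \<Rightarrow> (nat \<Rightarrow> 's \<times> 'b) \<times> 's \<Rightarrow> 'b measure"

definition policies :: "'s measure \<Rightarrow> 'b measure \<Rightarrow> ('s, 'b) policy set" where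
  "policies Z B = {\<phi>. \<forall>t. \<phi> t \<in>
     (\<Pi>\<^sub>M i\<in>{0..<t}. Z \<Otimes>\<^sub>M B) \<Otimes>\<^sub>M Z \<rightarrow>\<^sub>M prob_algebra B}"

text \<open>The conditional law of \<open>(z\<^sub>t, a\<^sub>t)\<close> given \<open>\<omega> = (z\<^sub>i, a\<^sub>i)\<^sub>i\<^sub><\<^sub>t\<close>, started at \<open>z\<close>.\<close>

definition mdp_step :: "'s measure \<Rightarrow> 'b measure \<Rightarrow> ('s \<Rightarrow> 'b \<Rightarrow> 's measure) \<Rightarrow>
    ('s, 'b) policy \<Rightarrow> 's \<Rightarrow> nat \<Rightarrow> (nat \<Rightarrow> 's \<times> 'b) \<Rightarrow> ('s \<times> 'b) measure" where
  "mdp_step Z B \<eta> \<phi> z t \<omega> =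
     (case t of 0 \<Rightarrow> return Z z | Suc s \<Rightarrow> \<eta> (fst (\<omega> s)) (snd (\<omega> s))) \<bind>
     (\<lambda>z'. \<phi> t (\<omega>, z') \<bind> (\<lambda>a. return (Z \<Otimes>\<^sub>M B) (z', a)))"

text \<open>The law of \<open>(z\<^sub>t, a\<^sub>t)\<^sub>t\<close>, by the Ionescu-Tulcea theorem.\<close>

definition mdp_law :: "'s measure \<Rightarrow> 'b measure \<Rightarrow> ('s \<Rightarrow> 'b \<Rightarrow> 's measure) \<Rightarrow>
    ('s, 'b) policy \<Rightarrow> 's \<Rightarrow> (nat \<Rightarrow> 's \<times> 'b) measure" where
  "mdp_law Z B \<eta> \<phi> z = projective_family.lim UNIV
     (Ionescu_Tulcea.CI (mdp_step Z B \<eta> \<phi> z) (\<lambda>_. Z \<Otimes>\<^sub>M B)) (\<lambda>_. Z \<Otimes>\<^sub>M B)"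

lemma Ionescu_Tulcea_mdp_step:
  assumes \<phi>: "\<phi> \<in> policies Z B" and z: "z \<in> space Z"
    and \<eta>: "(\<lambda>(z, a). \<eta> z a) \<in> Z \<Otimes>\<^sub>M B \<rightarrow>\<^sub>M prob_algebra Z"
  shows "Ionescu_Tulcea (mdp_step Z B \<eta> \<phi> z) (\<lambda>_. Z \<Otimes>\<^sub>M B)"
proof -
  have step: "mdp_step Z B \<eta> \<phi> z t \<in> (\<Pi>\<^sub>M i\<in>{0..<t}. Z \<Otimes>\<^sub>M B) \<rightarrow>\<^sub>M prob_algebra (Z \<Otimes>\<^sub>M B)" for t
  proof -
    have [measurable]: "\<phi> t \<in> (\<Pi>\<^sub>M i\<in>{0..<t}. Z \<Otimes>\<^sub>M B) \<Otimes>\<^sub>M Z \<rightarrow>\<^sub>M prob_algebra B"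
      using \<phi> by (auto simp: policies_def)
    have [measurable]: "(\<lambda>\<omega>. case t of 0 \<Rightarrow> return Z z | Suc s \<Rightarrow> \<eta> (fst (\<omega> s)) (snd (\<omega> s)))
        \<in> (\<Pi>\<^sub>M i\<in>{0..<t}. Z \<Otimes>\<^sub>M B) \<rightarrow>\<^sub>M prob_algebra Z"
    proof (cases t)
      case 0
      then show ?thesis
        using z by (auto simp: space_prob_algebra prob_space_return)
    next
      case (Suc s)
      have "(\<lambda>\<omega>. \<omega> s) \<in> (\<Pi>\<^sub>M i\<in>{0..<t}. Z \<Otimes>\<^sub>M B) \<rightarrow>\<^sub>M Z \<Otimes>\<^sub>M B"
        by (rule measurable_component_singleton) (simp add: Suc)
      from measurable_compose[OF this \<eta>] show ?thesis
        by (simp add: Suc case_prod_unfold)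
    qed
    show ?thesis
      unfolding mdp_step_def by measurable
  qed
  show ?thesis
    by (rule Ionescu_Tulcea.intro, rule measurable_prob_algebraD[OF step])
       (use measurable_space[OF step] in \<open>simp add: space_prob_algebra\<close>)
qed

text \<open>The integral, the series and the infimum are the real-valued ones; they have their intended
  meaning for a bounded measurable cost \<open>c\<close>.\<close>

definition discounted_value :: "'s measure \<Rightarrow> 'b measure \<Rightarrow> ('s \<Rightarrow> 'b \<Rightarrow> 's measure) \<Rightarrow>
    ('s \<Rightarrow> 'b \<Rightarrow> real) \<Rightarrow> real \<Rightarrow> 's \<Rightarrow> real" where
  "discounted_value Z B \<eta> c \<beta> z =
     (INF \<phi> \<in> policies Z B. \<integral>\<omega>. (\<Sum>t. \<beta> ^ t * c (fst (\<omega> t)) (snd (\<omega> t))) \<partial>mdp_law Z B \<eta> \<phi> z)"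


section \<open>The belief-MDP\<close>

text \<open>The law of \<open>(x\<^sub>t\<^sub>+\<^sub>1, y\<^sub>t\<^sub>+\<^sub>1)\<close> given \<open>z\<^sub>t = z\<close>, \<open>a\<^sub>t = a\<close>; its value on rectangles is computed in
  the lemma below.\<close>

definition joint_law :: "'x::topological_space set \<Rightarrow> 'y::topological_space set \<Rightarrow>
    ('x \<Rightarrow> 'a \<Rightarrow> 'x measure) \<Rightarrow> ('x \<Rightarrow> 'y measure) \<Rightarrow> 'x measure \<Rightarrow> 'a \<Rightarrow> ('x \<times> 'y) measure" where
  "joint_law X Y p r z a =
     z \<bind> (\<lambda>x. p x a \<bind> (\<lambda>x'. r x' \<bind> (\<lambda>y. return (borel_on X \<Otimes>\<^sub>M borel_on Y) (x', y))))"

lemma emeasure_joint_law: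
  assumes p: "(\<lambda>(x, a). p x a) \<in> borel_on X \<Otimes>\<^sub>M borel_on A \<rightarrow>\<^sub>M prob_algebra (borel_on X)"
    and r[measurable]: "r \<in> borel_on X \<rightarrow>\<^sub>M prob_algebra (borel_on Y)"
    and z: "z \<in> prob_measures X" and a: "a \<in> A"
    and B[measurable]: "B \<in> sets (borel_on X)" and C[measurable]: "C \<in> sets (borel_on Y)"
  shows "emeasure (joint_law X Y p r z a) (B \<times> C) =
    (\<integral>\<^sup>+x. (\<integral>\<^sup>+x'\<in>B. emeasure (r x') C \<partial>p x a) \<partial>z)"
proof -
  let ?X = "borel_on X" and ?Y = "borel_on Y"
  have a': "a \<in> space (borel_on A)"
    using a by (simp add: space_restrict_space)
  have pa[measurable]: "(\<lambda>x. p x a) \<in> ?X \<rightarrow>\<^sub>M prob_algebra ?X"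
    using measurable_compose[OF measurable_Pair2'[OF a'] p] by simp
  have z': "z \<in> space (prob_algebra ?X)"
    using z by (simp add: space_prob_algebra prob_measures_def)
  have spz: "space z = space ?X"
    using z by (intro sets_eq_imp_space_eq) (simp add: prob_measures_def)
  have g: "(\<lambda>x'. r x' \<bind> (\<lambda>y. return (?X \<Otimes>\<^sub>M ?Y) (x', y))) \<in> ?X \<rightarrow>\<^sub>M prob_algebra (?X \<Otimes>\<^sub>M ?Y)"
    by measurable
  have f: "(\<lambda>x. p x a \<bind> (\<lambda>x'. r x' \<bind> (\<lambda>y. return (?X \<Otimes>\<^sub>M ?Y) (x', y))))
      \<in> ?X \<rightarrow>\<^sub>M prob_algebra (?X \<Otimes>\<^sub>M ?Y)"
    by (rule measurable_bind_prob_space[OF pa g])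
  have BC: "B \<times> C \<in> sets (?X \<Otimes>\<^sub>M ?Y)"
    by measurable
  have "emeasure (r x' \<bind> (\<lambda>y. return (?X \<Otimes>\<^sub>M ?Y) (x', y))) (B \<times> C) =
      emeasure (r x') C * indicator B x'" if x': "x' \<in> space ?X" for x'
  proof -
    have rx: "r x' \<in> space (prob_algebra ?Y)"
      using measurable_space[OF r x'] .
    then have [measurable_cong, simp]: "sets (r x') = sets ?Y"
      by (simp add: space_prob_algebra)
    have "emeasure (r x' \<bind> (\<lambda>y. return (?X \<Otimes>\<^sub>M ?Y) (x', y))) (B \<times> C) =
        (\<integral>\<^sup>+y. emeasure (return (?X \<Otimes>\<^sub>M ?Y) (x', y)) (B \<times> C) \<partial>r x')"
      using x' by (intro emeasure_bind_prob_algebra[OF rx _ BC]) measurable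
    also have "\<dots> = (\<integral>\<^sup>+y. indicator B x' * indicator C y \<partial>r x')"
      using BC by (intro nn_integral_cong) (auto split: split_indicator)
    also have "\<dots> = emeasure (r x') C * indicator B x'"
      by (simp add: nn_integral_cmult mult.commute)
    finally show ?thesis .
  qed
  note inner = this
  have "emeasure (joint_law X Y p r z a) (B \<times> C) =
      (\<integral>\<^sup>+x. emeasure (p x a \<bind> (\<lambda>x'. r x' \<bind> (\<lambda>y. return (?X \<Otimes>\<^sub>M ?Y) (x', y)))) (B \<times> C) \<partial>z)"
    unfolding joint_law_def by (rule emeasure_bind_prob_algebra[OF z' f BC])
  also have "\<dots> = (\<integral>\<^sup>+x. (\<integral>\<^sup>+x'\<in>B. emeasure (r x') C \<partial>p x a) \<partial>z)"
  proof (rule nn_integral_cong)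
    fix x assume "x \<in> space z"
    then have px: "p x a \<in> space (prob_algebra ?X)"
      using measurable_space[OF pa] by (simp add: spz)
    then have sp: "space (p x a) = space ?X"
      by (intro sets_eq_imp_space_eq) (simp add: space_prob_algebra)
    show "emeasure (p x a \<bind> (\<lambda>x'. r x' \<bind> (\<lambda>y. return (?X \<Otimes>\<^sub>M ?Y) (x', y)))) (B \<times> C) =
        (\<integral>\<^sup>+x'\<in>B. emeasure (r x') C \<partial>p x a)"
      by (subst emeasure_bind_prob_algebra[OF px g BC])
         (intro nn_integral_cong, simp add: sp inner)
  qed
  finally show ?thesis .
qed

definition obs_law :: "'x::topological_space set \<Rightarrow> 'y::topological_space set \<Rightarrow>
    ('x \<Rightarrow> 'a \<Rightarrow> 'x measure) \<Rightarrow> ('x \<Rightarrow> 'y measure) \<Rightarrow> 'x measure \<Rightarrow> 'a \<Rightarrow> 'y measure" where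
  "obs_law X Y p r z a = distr (joint_law X Y p r z a) (borel_on Y) snd"

definition is_belief_update :: "'x::topological_space set \<Rightarrow> 'a::topological_space set \<Rightarrow>
    'y::topological_space set \<Rightarrow> ('x \<Rightarrow> 'a \<Rightarrow> 'x measure) \<Rightarrow> ('x \<Rightarrow> 'y measure) \<Rightarrow>
    ('x measure \<Rightarrow> 'a \<Rightarrow> 'y \<Rightarrow> 'x measure) \<Rightarrow> bool" where
  "is_belief_update X A Y p r F \<longleftrightarrow>
     (\<lambda>(z, a, y). F z a y) \<in> belief_space X \<Otimes>\<^sub>M borel_on A \<Otimes>\<^sub>M borel_on Y \<rightarrow>\<^sub>M belief_space X \<and>
     (\<forall>z \<in> prob_measures X. \<forall>a \<in> A. \<forall>B \<in> sets (borel_on X). \<forall>C \<in> sets (borel_on Y).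
        emeasure (joint_law X Y p r z a) (B \<times> C) =
        (\<integral>\<^sup>+y\<in>C. emeasure (F z a y) B \<partial>obs_law X Y p r z a))"

definition belief_trans :: "'x::topological_space set \<Rightarrow> 'y::topological_space set \<Rightarrow>
    ('x \<Rightarrow> 'a \<Rightarrow> 'x measure) \<Rightarrow> ('x \<Rightarrow> 'y measure) \<Rightarrow> ('x measure \<Rightarrow> 'a \<Rightarrow> 'y \<Rightarrow> 'x measure) \<Rightarrow>
    'x measure \<Rightarrow> 'a \<Rightarrow> 'x measure measure" where
  "belief_trans X Y p r F z a = distr (obs_law X Y p r z a) (belief_space X) (F z a)"

definition belief_cost :: "('x \<Rightarrow> 'a \<Rightarrow> real) \<Rightarrow> 'x measure \<Rightarrow> 'a \<Rightarrow> real" where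
  "belief_cost c z a = (\<integral>x. c x a \<partial>z)"

text \<open>The value function of the belief-MDP when only actions in \<open>B\<close> are used.\<close>

definition belief_value :: "'x::topological_space set \<Rightarrow> 'y::topological_space set \<Rightarrow>
    ('x \<Rightarrow> 'a::topological_space \<Rightarrow> 'x measure) \<Rightarrow> ('x \<Rightarrow> 'y measure) \<Rightarrow>
    ('x measure \<Rightarrow> 'a \<Rightarrow> 'y \<Rightarrow> 'x measure) \<Rightarrow> ('x \<Rightarrow> 'a \<Rightarrow> real) \<Rightarrow> real \<Rightarrow> 'a set \<Rightarrow>
    'x measure \<Rightarrow> real" where
  "belief_value X Y p r F c \<beta> B =
     discounted_value (belief_space X) (borel_on B) (belief_trans X Y p r F) (belief_cost c) \<beta>"

end

theory Submission
  imports Defs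
begin

text \<open>
  The value function with finitely many actions is close to the full one because an optimal action
  can be replaced by a nearby one at small cost. This needs continuity of the functions in the
  optimality equation, and the difficulty is that the state space consists of probability measures
  on a non-compact space, so that the loss is small only pointwise in the belief and has to be
  controlled along the whole future trajectory.

  \<^bold>\<open>Continuity.\<close> Instead of the weak Feller property of the belief transition kernel, a quantitative
  variant is proved. A functional of beliefs is called tame if it is Lipschitz for a distance
  \<open>sup {\<bar>\<integral> f d\<mu> - \<integral> f d\<nu>\<bar>}\<close> where \<open>f\<close> ranges over the functions bounded by 1 with a given modulus of
  continuity. Weak convergence implies convergence in such a distance
  (\<open>weak_neighbourhood_test_dist\<close>). The transition kernel preserves tameness, uniformly in the action
  (\<open>tame_with_trans\<close>): prediction of the hidden state does so by weak continuity of \<open>p\<close> and compactness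
  of the action space (\<open>predict_modulus\<close>), and filtering by continuity of the channel in total
  variation (\<open>tame_filter\<close>). All iterates of value iteration are therefore tame.

  \<^bold>\<open>Approximation.\<close> Let \<open>u\<close> be an iterate so late that it solves the optimality equation up to
  \<open>\<epsilon>\<close>. Then \<open>u - \<epsilon> / (1 - \<beta>)\<close> is a lower bound for both value functions. The stationary policy
  that plays, in every belief, the best action of the net with respect to \<open>u\<close> is admissible for both
  problems; it loses in each step at most the oscillation of the right-hand side of the optimality
  equation over actions at distance less than the mesh of the net. The worst-case expectation of this loss after \<open>k\<close>
  steps is again tame and decreases to 0 as the net is refined: in each step the decrease is
  uniform in the action by Dini's theorem (\<open>regret_tendsto_0\<close>). Summation over \<open>k\<close> with the discount
  factors gives an upper bound for both value functions that tends to \<open>u + \<epsilon> / (1 - \<beta>)\<close>.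
\<close>

section \<open>Beliefs and the weak topology\<close>

lemma prob_measuresD:
  assumes "\<mu> \<in> prob_measures X"
  shows "prob_space \<mu>" "sets \<mu> = sets (borel_on X)" "space \<mu> = X"
proof -
  show "prob_space \<mu>" and s: "sets \<mu> = sets (borel_on X)"
    using assms by (auto simp: prob_measures_def)
  show "space \<mu> = X"
    using sets_eq_imp_space_eq[OF s] by (simp add: space_restrict_space)
qed

lemma space_prob_algebra_borel_on: "space (prob_algebra (borel_on X)) = prob_measures X"
  by (auto simp: space_prob_algebra prob_measures_def)

lemma openin_weak_topology_imp_subset: "openin (weak_topology X) U \<Longrightarrow> U \<subseteq> prob_measures X"
  using openin_subset[of "weak_topology X" U] by (simp add: topspace_weak_topology)

lemma space_belief_space [simp]: "space (belief_space X) = prob_measures X"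
  unfolding belief_space_def
  by (rule space_measure_of) (use openin_weak_topology_imp_subset in auto)

lemma openin_imp_sets_belief_space:
  "openin (weak_topology X) U \<Longrightarrow> U \<in> sets (belief_space X)"
  unfolding belief_space_def
  by (subst sets_measure_of) (use openin_weak_topology_imp_subset in auto)

lemma openin_weak_topology_basic:
  fixes f :: "'a::topological_space \<Rightarrow> real"
  assumes "continuous_on X f" "bounded (f ` X)" "open U"
  shows "openin (weak_topology X) {\<mu> \<in> prob_measures X. (\<integral>x. f x \<partial>\<mu>) \<in> U}"
  unfolding weak_topology_def
  by (rule topology_generated_by_Basis) (use assms in auto)

lemma (in prob_space) abs_integral_le_bound:
  fixes f :: "'a \<Rightarrow> real"
  assumes "\<And>x. x \<in> space M \<Longrightarrow> \<bar>f x\<bar> \<le> B"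
  shows "\<bar>\<integral>x. f x \<partial>M\<bar> \<le> B"
proof (cases "integrable M f")
  case True
  have "\<bar>\<integral>x. f x \<partial>M\<bar> \<le> (\<integral>x. \<bar>f x\<bar> \<partial>M)"
    by (rule integral_abs_bound)
  also have "\<dots> \<le> B"
    using True assms by (intro integral_le_const) auto
  finally show ?thesis .
next
  case False
  obtain x where "x \<in> space M" using not_empty by auto
  then have "0 \<le> B" using assms[of x] by linarith
  with False show ?thesis by (simp add: not_integrable_integral_eq)
qed

lemma (in finite_measure) integrable_bounded:
  fixes f :: "'a \<Rightarrow> real"
  assumes "f \<in> borel_measurable M" "\<And>x. x \<in> space M \<Longrightarrow> \<bar>f x\<bar> \<le> B"
  shows "integrable M f"
  using assms by (intro integrable_const_bound[where B=B]) auto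

section \<open>Test functions and the distance they induce\<close>

text \<open>The function \<open>d\<close> plays the role of a common modulus of continuity of a family \<open>F\<close> of functions on
  \<open>X\<close>, such as \<open>d x y = sup {\<bar>f x - f y\<bar> | f \<in> F}\<close>. Families with a
  common modulus are pointwise equicontinuous, at a speed that may depend on the point \<open>x\<close>.\<close>

definition modulus_on :: "'a::metric_space set \<Rightarrow> ('a \<Rightarrow> 'a \<Rightarrow> real) \<Rightarrow> bool" where
  "modulus_on X d \<longleftrightarrow> (\<forall>x\<in>X. \<forall>y\<in>X. 0 \<le> d x y) \<and> (\<forall>x\<in>X. (d x \<longlongrightarrow> 0) (at x within X))"

definition test_functions :: "'a set \<Rightarrow> ('a \<Rightarrow> 'a \<Rightarrow> real) \<Rightarrow> ('a \<Rightarrow> real) set" where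
  "test_functions X d = {f. (\<forall>x\<in>X. \<bar>f x\<bar> \<le> 1) \<and> (\<forall>x\<in>X. \<forall>y\<in>X. \<bar>f x - f y\<bar> \<le> d x y)}"

text \<open>A generalised bounded-Lipschitz distance: with \<open>d\<close> the metric it is the usual one.\<close>

definition test_dist :: "'a set \<Rightarrow> ('a \<Rightarrow> 'a \<Rightarrow> real) \<Rightarrow> 'a measure \<Rightarrow> 'a measure \<Rightarrow> real" where
  "test_dist X d \<mu> \<nu> = (SUP f\<in>test_functions X d. \<bar>(\<integral>x. f x \<partial>\<mu>) - (\<integral>x. f x \<partial>\<nu>)\<bar>)"

lemma modulus_on_nonneg: "modulus_on X d \<Longrightarrow> x \<in> X \<Longrightarrow> y \<in> X \<Longrightarrow> 0 \<le> d x y"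
  by (auto simp: modulus_on_def)

lemma modulus_on_add: "modulus_on X d \<Longrightarrow> modulus_on X d' \<Longrightarrow> modulus_on X (\<lambda>x y. d x y + d' x y)"
  unfolding modulus_on_def by (auto intro!: tendsto_add_zero)

lemma test_functionsD:
  assumes "f \<in> test_functions X d"
  shows "\<And>x. x \<in> X \<Longrightarrow> \<bar>f x\<bar> \<le> 1" "\<And>x y. x \<in> X \<Longrightarrow> y \<in> X \<Longrightarrow> \<bar>f x - f y\<bar> \<le> d x y"
  using assms by (auto simp: test_functions_def)

lemma const_in_test_functions:
  "modulus_on X d \<Longrightarrow> \<bar>c\<bar> \<le> 1 \<Longrightarrow> (\<lambda>_. c) \<in> test_functions X d"
  by (auto simp: test_functions_def modulus_on_nonneg)

lemma test_functions_continuous: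
  assumes d: "modulus_on X d" and f: "f \<in> test_functions X d"
  shows "continuous_on X f"
  unfolding continuous_on_def
proof
  fix x assume x: "x \<in> X"
  have "((\<lambda>y. f x - f y) \<longlongrightarrow> 0) (at x within X)"
  proof (rule Lim_null_comparison)
    show "(d x \<longlongrightarrow> 0) (at x within X)"
      using d x by (auto simp: modulus_on_def)
    show "\<forall>\<^sub>F y in at x within X. norm (f x - f y) \<le> d x y"
      using test_functionsD(2)[OF f x] by (auto simp: eventually_at_filter)
  qed
  from tendsto_diff[OF tendsto_const[of "f x"] this]
  show "(f \<longlongrightarrow> f x) (at x within X)" by simp
qed

lemma measurable_borel_on_continuous:
  "continuous_on X f \<Longrightarrow> f \<in> borel_measurable (borel_on X)"
  by (rule borel_measurable_continuous_on_restrict)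

lemma measurable_prob_measures:
  "\<mu> \<in> prob_measures X \<Longrightarrow> f \<in> borel_on X \<rightarrow>\<^sub>M N \<Longrightarrow> f \<in> \<mu> \<rightarrow>\<^sub>M N"
  using measurable_cong_sets[OF prob_measuresD(2) refl] by blast

lemma integrable_prob_measures:
  fixes f :: "'a::topological_space \<Rightarrow> real"
  assumes \<mu>: "\<mu> \<in> prob_measures X" and f: "f \<in> borel_measurable (borel_on X)"
    and B: "\<And>x. x \<in> X \<Longrightarrow> \<bar>f x\<bar> \<le> B"
  shows "integrable \<mu> f"
proof -
  interpret prob_space \<mu> using prob_measuresD(1)[OF \<mu>] .
  show ?thesis
    using B by (intro integrable_bounded[where B=B] measurable_prob_measures[OF \<mu> f])
      (auto simp: prob_measuresD(3)[OF \<mu>])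
qed

lemma abs_integral_le_prob_measures:
  fixes f :: "'a::topological_space \<Rightarrow> real"
  assumes \<mu>: "\<mu> \<in> prob_measures X" and B: "\<And>x. x \<in> X \<Longrightarrow> \<bar>f x\<bar> \<le> B"
  shows "\<bar>\<integral>x. f x \<partial>\<mu>\<bar> \<le> B"
  using prob_space.abs_integral_le_bound[OF prob_measuresD(1)[OF \<mu>], of f B] B
  by (auto simp: prob_measuresD(3)[OF \<mu>])

lemma test_functions_integrable:
  assumes "modulus_on X d" "f \<in> test_functions X d" "\<mu> \<in> prob_measures X"
  shows "integrable \<mu> f"
  by (rule integrable_prob_measures[OF assms(3) measurable_borel_on_continuous
        [OF test_functions_continuous[OF assms(1,2)]] test_functionsD(1)[OF assms(2)]])

lemma test_dist_diff_le_2: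
  assumes "f \<in> test_functions X d" "\<mu> \<in> prob_measures X" "\<nu> \<in> prob_measures X"
  shows "\<bar>(\<integral>x. f x \<partial>\<mu>) - (\<integral>x. f x \<partial>\<nu>)\<bar> \<le> 2"
  using abs_integral_le_prob_measures[of \<mu> X f 1] abs_integral_le_prob_measures[of \<nu> X f 1]
    assms test_functionsD(1)[OF assms(1)] by auto

lemma test_dist_upper:
  assumes "f \<in> test_functions X d" "\<mu> \<in> prob_measures X" "\<nu> \<in> prob_measures X"
  shows "\<bar>(\<integral>x. f x \<partial>\<mu>) - (\<integral>x. f x \<partial>\<nu>)\<bar> \<le> test_dist X d \<mu> \<nu>"
  unfolding test_dist_def using assms
  by (intro cSUP_upper bdd_aboveI2[where M=2]) (auto intro: test_dist_diff_le_2)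

lemma test_dist_least:
  assumes "modulus_on X d"
    and "\<And>f. f \<in> test_functions X d \<Longrightarrow> \<bar>(\<integral>x. f x \<partial>\<mu>) - (\<integral>x. f x \<partial>\<nu>)\<bar> \<le> e"
  shows "test_dist X d \<mu> \<nu> \<le> e"
  unfolding test_dist_def using const_in_test_functions[OF assms(1), of 0] assms(2)
  by (intro cSUP_least) auto

lemma test_dist_nonneg:
  assumes "modulus_on X d" "\<mu> \<in> prob_measures X" "\<nu> \<in> prob_measures X"
  shows "0 \<le> test_dist X d \<mu> \<nu>"
  using test_dist_upper[OF const_in_test_functions[OF assms(1), of 0] assms(2,3)] by simp

lemma test_dist_le_2:
  assumes "modulus_on X d" "\<mu> \<in> prob_measures X" "\<nu> \<in> prob_measures X"
  shows "test_dist X d \<mu> \<nu> \<le> 2"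
  using assms by (intro test_dist_least test_dist_diff_le_2)

lemma test_dist_commute: "test_dist X d \<mu> \<nu> = test_dist X d \<nu> \<mu>"
  unfolding test_dist_def by (simp add: abs_minus_commute)

lemma test_dist_triangle:
  assumes "modulus_on X d" "\<mu> \<in> prob_measures X" "\<nu> \<in> prob_measures X" "\<kappa> \<in> prob_measures X"
  shows "test_dist X d \<mu> \<kappa> \<le> test_dist X d \<mu> \<nu> + test_dist X d \<nu> \<kappa>"
proof (rule test_dist_least[OF assms(1)])
  fix f assume "f \<in> test_functions X d"
  from test_dist_upper[OF this assms(2,3)] test_dist_upper[OF this assms(3,4)]
  show "\<bar>(\<integral>x. f x \<partial>\<mu>) - (\<integral>x. f x \<partial>\<kappa>)\<bar> \<le> test_dist X d \<mu> \<nu> + test_dist X d \<nu> \<kappa>"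
    by linarith
qed

lemma test_dist_mono:
  assumes "modulus_on X d" "\<And>x y. x \<in> X \<Longrightarrow> y \<in> X \<Longrightarrow> d x y \<le> d' x y"
    and "\<mu> \<in> prob_measures X" "\<nu> \<in> prob_measures X"
  shows "test_dist X d \<mu> \<nu> \<le> test_dist X d' \<mu> \<nu>"
proof (rule test_dist_least[OF assms(1)])
  fix f assume "f \<in> test_functions X d"
  then have "f \<in> test_functions X d'"
    unfolding test_functions_def
    by (smt (verit, best) assms(2) mem_Collect_eq test_functionsD)
  then show "\<bar>(\<integral>x. f x \<partial>\<mu>) - (\<integral>x. f x \<partial>\<nu>)\<bar> \<le> test_dist X d' \<mu> \<nu>"
    using assms(3,4) by (rule test_dist_upper)
qed

lemma test_dist_scaled_upper:
  fixes f :: "'a::metric_space \<Rightarrow> real"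
  assumes d: "modulus_on X d" and K: "0 < K" and b: "\<And>x. x \<in> X \<Longrightarrow> \<bar>f x\<bar> \<le> K"
    and l: "\<And>x y. x \<in> X \<Longrightarrow> y \<in> X \<Longrightarrow> \<bar>f x - f y\<bar> \<le> K * d x y"
    and "\<mu> \<in> prob_measures X" "\<nu> \<in> prob_measures X"
  shows "\<bar>(\<integral>x. f x \<partial>\<mu>) - (\<integral>x. f x \<partial>\<nu>)\<bar> \<le> K * test_dist X d \<mu> \<nu>"
proof -
  have "(\<lambda>x. f x / K) \<in> test_functions X d"
    using K b l by (auto simp: test_functions_def field_simps simp flip: diff_divide_distrib)
  from test_dist_upper[OF this assms(5,6)] K show ?thesis
    by (simp add: field_simps flip: diff_divide_distrib)
qed

text \<open>Weak convergence is uniform over a bounded equicontinuous family (Ranga Rao): cover \<open>X\<close> by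
  countably many balls on which every test function varies by at most \<open>\<eta>\<close>; finitely many of them
  carry all of \<open>\<pi>\<close> up to \<open>\<eta>\<close>, and with a partition of unity on these, every test function is a
  combination of the same finitely many bumps up to an error that is small in \<open>\<pi>\<close>-mean. The bumps
  are then the finitely many functions to be tested.\<close>

lemma weak_neighbourhood_test_dist:
  fixes X :: "'a::{metric_space, second_countable_topology} set"
  assumes d: "modulus_on X d" and \<pi>: "\<pi> \<in> prob_measures X" and e: "0 < e"
  obtains G :: "('a \<Rightarrow> real) set" and \<delta> :: real where
    "finite G" "0 < \<delta>" "\<And>g. g \<in> G \<Longrightarrow> continuous_on X g \<and> bounded (g ` X)"
    "\<And>\<pi>'. \<pi>' \<in> prob_measures X \<Longrightarrow> (\<And>g. g \<in> G \<Longrightarrow> \<bar>(\<integral>x. g x \<partial>\<pi>') - (\<integral>x. g x \<partial>\<pi>)\<bar> < \<delta>) \<Longrightarrow>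
       test_dist X d \<pi>' \<pi> \<le> e"
proof -
  define \<eta> where "\<eta> = e / 6"
  have \<eta>: "0 < \<eta>" using e by (simp add: \<eta>_def)
  interpret \<pi>: prob_space \<pi> using prob_measuresD(1)[OF \<pi>] .
  have "X \<noteq> {}" using \<pi>.not_empty prob_measuresD(3)[OF \<pi>] by simp
  have "\<exists>\<rho>>0. \<forall>y\<in>X. dist x y < \<rho> \<longrightarrow> (\<forall>f\<in>test_functions X d. \<bar>f y - f x\<bar> \<le> \<eta>)" if x: "x \<in> X" for x
  proof -
    have "\<forall>\<^sub>F y in at x within X. d x y < \<eta>"
      using d x \<eta> by (intro order_tendstoD(2)[where a=\<eta> and y=0]) (auto simp: modulus_on_def)
    then obtain \<rho> where \<rho>: "\<rho> > 0" "\<And>y. y \<in> X \<Longrightarrow> y \<noteq> x \<Longrightarrow> dist y x < \<rho> \<Longrightarrow> d x y < \<eta>"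
      unfolding eventually_at by auto
    have "\<bar>f y - f x\<bar> \<le> \<eta>" if "y \<in> X" "dist x y < \<rho>" "f \<in> test_functions X d" for y f
      using \<rho>(2)[of y] test_functionsD(2)[OF that(3) x that(1)] that(1,2) \<eta>
      by (cases "y = x") (auto simp: dist_commute abs_minus_commute)
    with \<rho>(1) show ?thesis by blast
  qed
  then obtain \<rho> where \<rho>: "\<And>x. x \<in> X \<Longrightarrow> \<rho> x > 0"
    "\<And>x y f. x \<in> X \<Longrightarrow> y \<in> X \<Longrightarrow> dist x y < \<rho> x \<Longrightarrow> f \<in> test_functions X d \<Longrightarrow> \<bar>f y - f x\<bar> \<le> \<eta>"
    by metis
  obtain D where D: "countable D" "D \<subseteq> X" "(\<Union>x\<in>D. ball x (\<rho> x)) = (\<Union>x\<in>X. ball x (\<rho> x))"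
  proof -
    obtain F' where F': "F' \<subseteq> (\<lambda>x. ball x (\<rho> x)) ` X" "countable F'"
      "\<Union>F' = \<Union>((\<lambda>x. ball x (\<rho> x)) ` X)"
      by (rule Lindelof[of "(\<lambda>x. ball x (\<rho> x)) ` X"]) auto
    obtain D where "D \<subseteq> X" "countable D" "F' = (\<lambda>x. ball x (\<rho> x)) ` D"
      using F'(1,2) countable_subset_image[of F' "\<lambda>x. ball x (\<rho> x)" X] by auto
    with F'(3) that show ?thesis by auto
  qed
  have cover: "\<exists>x\<in>D. dist x y < \<rho> x" if "y \<in> X" for y
  proof -
    have "y \<in> (\<Union>x\<in>X. ball x (\<rho> x))" using that \<rho>(1)[OF that] by force
    then show ?thesis unfolding D(3)[symmetric] by auto
  qed
  have "D \<noteq> {}" using cover \<open>X \<noteq> {}\<close> by auto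
  define x where "x i = from_nat_into D i" for i
  have xX: "x i \<in> X" for i
    using from_nat_into[OF \<open>D \<noteq> {}\<close>] D(2) by (auto simp: x_def)
  define h where "h i y = max 0 (\<rho> (x i) - dist (x i) y)" for i y
  \<comment> \<open>Truncated partial sums: their increments \<open>g m i\<close> are supported in the \<open>i\<close>-th ball and sum
    to \<open>\<phi> m m\<close>, which tends to 1 everywhere, so that no normalisation of the bumps is needed.\<close>
  define \<phi> where "\<phi> m i y = min 1 (real m * (\<Sum>j<i. h j y))" for m i :: nat and y
  define g where "g m i y = \<phi> m (Suc i) y - \<phi> m i y" for m i :: nat and y
  have h0: "0 \<le> h i y" for i y by (simp add: h_def)
  have \<phi>01: "0 \<le> \<phi> m i y" "\<phi> m i y \<le> 1" for m i y
    unfolding \<phi>_def by (auto intro!: mult_nonneg_nonneg sum_nonneg h0)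
  have g0: "0 \<le> g m i y" for m i y
    unfolding g_def \<phi>_def using mult_nonneg_nonneg[OF _ h0[of i y], of "real m"]
    by (simp add: distrib_left min_def)
  have g1: "g m i y \<le> 1" for m i y
    using \<phi>01[of m i y] \<phi>01[of m "Suc i" y] by (simp add: g_def)
  have gh: "g m i y = 0" if "\<not> dist (x i) y < \<rho> (x i)" for m i y
    using that by (simp add: g_def \<phi>_def h_def)
  have sum_g: "(\<Sum>i<n. g m i y) = \<phi> m n y" for m n y
    by (induction n) (simp_all add: g_def, simp add: \<phi>_def)
  have cont_\<phi>: "continuous_on X (\<phi> m i)" for m i
    unfolding \<phi>_def h_def by (intro continuous_intros)
  have cont_g: "continuous_on X (g m i)" for m i
    unfolding g_def by (intro continuous_intros cont_\<phi>)
  note [measurable, simp] = measurable_borel_on_continuous[OF cont_\<phi>] measurable_borel_on_continuous[OF cont_g]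
  have "(\<lambda>m. \<integral>y. \<phi> m m y \<partial>\<pi>) \<longlonglongrightarrow> (\<integral>y. 1 \<partial>\<pi>)"
  proof (rule integral_dominated_convergence[where w="\<lambda>_. 1"])
    show "\<phi> i i \<in> borel_measurable \<pi>" for i
      by (rule measurable_prob_measures[OF \<pi> measurable_borel_on_continuous[OF cont_\<phi>]])
    show "AE y in \<pi>. (\<lambda>m. \<phi> m m y) \<longlonglongrightarrow> 1"
    proof (rule AE_I2)
      fix y assume "y \<in> space \<pi>"
      then have "y \<in> X" using prob_measuresD(3)[OF \<pi>] by simp
      from cover[OF this] obtain x0 where x0: "x0 \<in> D" "dist x0 y < \<rho> x0" by blast
      from from_nat_into_surj[OF D(1) x0(1)] x0(2) obtain i where i: "dist (x i) y < \<rho> (x i)"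
        unfolding x_def by auto
      then have hi: "0 < h i y" by (simp add: h_def)
      have "\<forall>\<^sub>F m in sequentially. \<phi> m m y = 1"
        using eventually_gt_at_top[of i] eventually_ge_at_top[of "nat \<lceil>1 / h i y\<rceil>"]
      proof eventually_elim
        case (elim m)
        have "1 / h i y \<le> real m" using elim(2) by linarith
        then have "1 \<le> real m * h i y" using hi by (simp add: field_simps)
        also have "\<dots> \<le> real m * (\<Sum>j<m. h j y)"
          using elim(1) by (intro mult_left_mono member_le_sum) (auto simp: h0)
        finally show ?case by (simp add: \<phi>_def)
      qed
      then show "(\<lambda>m. \<phi> m m y) \<longlonglongrightarrow> 1" by (rule tendsto_eventually)
    qed
    show "AE y in \<pi>. norm (\<phi> i i y) \<le> 1" for i
      using \<phi>01 by simp
  qed auto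
  then have "(\<lambda>m. \<integral>y. \<phi> m m y \<partial>\<pi>) \<longlonglongrightarrow> 1" by (simp add: \<pi>.prob_space)
  then have "\<forall>\<^sub>F m in sequentially. 1 - \<eta> < (\<integral>y. \<phi> m m y \<partial>\<pi>)"
    using \<eta> by (intro order_tendstoD(1)) auto
  then obtain m where m: "1 - \<eta> < (\<integral>y. \<phi> m m y \<partial>\<pi>)"
    using eventually_happens trivial_limit_sequentially by blast
  define \<delta> where "\<delta> = \<eta> / (real m + 1)"
  have \<delta>: "0 < \<delta>" "real m * \<delta> \<le> \<eta>" using \<eta> by (auto simp: \<delta>_def field_simps)
  have approx: "\<bar>(\<integral>y. f y \<partial>\<mu>) - (\<Sum>i<m. f (x i) * (\<integral>y. g m i y \<partial>\<mu>))\<bar> \<le> \<eta> + 1 - (\<integral>y. \<phi> m m y \<partial>\<mu>)"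
    and int_\<phi>: "(\<integral>y. \<phi> m m y \<partial>\<mu>) = (\<Sum>i<m. \<integral>y. g m i y \<partial>\<mu>)"
    if f: "f \<in> test_functions X d" and \<mu>: "\<mu> \<in> prob_measures X" for f \<mu>
  proof -
    interpret \<mu>: prob_space \<mu> using prob_measuresD(1)[OF \<mu>] .
    have [simp]: "integrable \<mu> f" by (rule test_functions_integrable[OF d f \<mu>])
    have [simp]: "integrable \<mu> (g m i)" for i
      using g0 g1 by (intro integrable_prob_measures[OF \<mu>, where B=1]) auto
    have [simp]: "integrable \<mu> (\<phi> m i)" for i
      using \<phi>01 by (intro integrable_prob_measures[OF \<mu>, where B=1]) auto
    show "(\<integral>y. \<phi> m m y \<partial>\<mu>) = (\<Sum>i<m. \<integral>y. g m i y \<partial>\<mu>)"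
      by (simp flip: sum_g)
    have "\<bar>f y - (\<Sum>i<m. f (x i) * g m i y)\<bar> \<le> \<eta> + 1 - \<phi> m m y" if y: "y \<in> X" for y
    proof -
      have "f y - (\<Sum>i<m. f (x i) * g m i y) = (\<Sum>i<m. (f y - f (x i)) * g m i y) + (1 - \<phi> m m y) * f y"
        by (simp add: left_diff_distrib sum_subtractf sum_distrib_left[symmetric] sum_g)
      also have "\<bar>\<dots>\<bar> \<le> (\<Sum>i<m. \<bar>(f y - f (x i)) * g m i y\<bar>) + \<bar>(1 - \<phi> m m y) * f y\<bar>"
        by (intro abs_triangle_ineq[THEN order_trans] add_mono sum_abs order_refl)
      also have "\<dots> \<le> (\<Sum>i<m. \<eta> * g m i y) + (1 - \<phi> m m y) * 1"
      proof (intro add_mono sum_mono)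
        show "\<bar>(f y - f (x i)) * g m i y\<bar> \<le> \<eta> * g m i y" for i
          using \<rho>(2)[OF xX y _ f, of i] gh[of i y m] g0[of m i y]
          by (cases "dist (x i) y < \<rho> (x i)") (auto simp: abs_mult intro!: mult_right_mono)
        show "\<bar>(1 - \<phi> m m y) * f y\<bar> \<le> (1 - \<phi> m m y) * 1"
          unfolding abs_mult using test_functionsD(1)[OF f y] \<phi>01[of m m y] by (intro mult_mono) auto
      qed
      also have "\<dots> \<le> \<eta> + 1 - \<phi> m m y"
        using \<phi>01[of m m y] \<eta> by (simp add: sum_distrib_left[symmetric] sum_g mult_left_le)
      finally show ?thesis .
    qed
    then have "\<bar>\<integral>y. f y - (\<Sum>i<m. f (x i) * g m i y) \<partial>\<mu>\<bar> \<le> (\<integral>y. \<eta> + 1 - \<phi> m m y \<partial>\<mu>)"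
      by (intro integral_abs_bound[THEN order_trans] integral_mono)
        (auto simp: prob_measuresD(3)[OF \<mu>])
    then show "\<bar>(\<integral>y. f y \<partial>\<mu>) - (\<Sum>i<m. f (x i) * (\<integral>y. g m i y \<partial>\<mu>))\<bar> \<le> \<eta> + 1 - (\<integral>y. \<phi> m m y \<partial>\<mu>)"
      by (simp add: \<mu>.prob_space)
  qed
  show thesis
  proof (rule that[of "g m ` {..<m}" \<delta>])
    show "continuous_on X k \<and> bounded (k ` X)" if k: "k \<in> g m ` {..<m}" for k
      using k cont_g g0 g1 by (auto simp: bounded_iff intro!: exI[of _ 1])
    fix \<pi>' assume \<pi>': "\<pi>' \<in> prob_measures X"
      and close: "\<And>k. k \<in> g m ` {..<m} \<Longrightarrow> \<bar>(\<integral>x. k x \<partial>\<pi>') - (\<integral>x. k x \<partial>\<pi>)\<bar> < \<delta>"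
    show "test_dist X d \<pi>' \<pi> \<le> e"
    proof (rule test_dist_least[OF d])
      fix f assume f: "f \<in> test_functions X d"
      have c1: "\<bar>(\<Sum>i<m. a i * (\<integral>y. g m i y \<partial>\<pi>')) - (\<Sum>i<m. a i * (\<integral>y. g m i y \<partial>\<pi>))\<bar> \<le> \<eta>"
        if a: "\<And>i. \<bar>a i\<bar> \<le> 1" for a :: "nat \<Rightarrow> real"
      proof -
        have "\<bar>(\<Sum>i<m. a i * (\<integral>y. g m i y \<partial>\<pi>')) - (\<Sum>i<m. a i * (\<integral>y. g m i y \<partial>\<pi>))\<bar>
          = \<bar>\<Sum>i<m. a i * ((\<integral>y. g m i y \<partial>\<pi>') - (\<integral>y. g m i y \<partial>\<pi>))\<bar>"
          by (simp add: sum_subtractf right_diff_distrib)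
        also have "\<dots> \<le> (\<Sum>i<m. \<bar>a i * ((\<integral>y. g m i y \<partial>\<pi>') - (\<integral>y. g m i y \<partial>\<pi>))\<bar>)"
          by (rule sum_abs)
        also have "\<dots> \<le> (\<Sum>i<m. 1 * \<delta>)"
          unfolding abs_mult using a close by (intro sum_mono mult_mono) (auto intro: less_imp_le)
        finally show ?thesis using \<delta> by simp
      qed
      have "\<bar>(\<integral>y. \<phi> m m y \<partial>\<pi>') - (\<integral>y. \<phi> m m y \<partial>\<pi>)\<bar> \<le> \<eta>"
        using c1[of "\<lambda>_. 1"] int_\<phi>[OF f \<pi>] int_\<phi>[OF f \<pi>'] by simp
      moreover have "\<bar>(\<Sum>i<m. f (x i) * (\<integral>y. g m i y \<partial>\<pi>')) - (\<Sum>i<m. f (x i) * (\<integral>y. g m i y \<partial>\<pi>))\<bar> \<le> \<eta>"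
        using test_functionsD(1)[OF f xX] by (intro c1)
      ultimately show "\<bar>(\<integral>x. f x \<partial>\<pi>') - (\<integral>x. f x \<partial>\<pi>)\<bar> \<le> e"
        using approx[OF f \<pi>] approx[OF f \<pi>'] m unfolding \<eta>_def by linarith
    qed
  qed (use \<delta> in auto)
qed

lemma test_dist_tendsto_0:
  fixes X :: "'a::{metric_space, second_countable_topology} set"
  assumes d: "modulus_on X d" and \<mu>: "\<mu> \<in> prob_measures X"
    and \<nu>: "\<forall>\<^sub>F i in F. \<nu> i \<in> prob_measures X"
    and lim: "\<And>g :: 'a \<Rightarrow> real. continuous_on X g \<Longrightarrow> bounded (g ` X) \<Longrightarrow>
       ((\<lambda>i. \<integral>x. g x \<partial>\<nu> i) \<longlongrightarrow> (\<integral>x. g x \<partial>\<mu>)) F"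
  shows "((\<lambda>i. test_dist X d (\<nu> i) \<mu>) \<longlongrightarrow> 0) F"
proof (rule tendstoI)
  fix e :: real assume "0 < e"
  then have "0 < e / 2" by simp
  then obtain G :: "('a \<Rightarrow> real) set" and \<delta> :: real where G: "finite G" "0 < \<delta>"
    "\<And>g. g \<in> G \<Longrightarrow> continuous_on X g \<and> bounded (g ` X)"
    "\<And>\<pi>'. \<pi>' \<in> prob_measures X \<Longrightarrow> (\<And>g. g \<in> G \<Longrightarrow> \<bar>(\<integral>x. g x \<partial>\<pi>') - (\<integral>x. g x \<partial>\<mu>)\<bar> < \<delta>) \<Longrightarrow>
       test_dist X d \<pi>' \<mu> \<le> e / 2"
    using weak_neighbourhood_test_dist[OF d \<mu>] by metis
  have "\<forall>\<^sub>F i in F. \<forall>g\<in>G. \<bar>(\<integral>x. g x \<partial>\<nu> i) - (\<integral>x. g x \<partial>\<mu>)\<bar> < \<delta>"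
    using tendstoD[OF lim \<open>0 < \<delta>\<close>] G(3) by (intro eventually_ball_finite G(1)) (auto simp: dist_real_def)
  with \<nu> show "\<forall>\<^sub>F i in F. dist (test_dist X d (\<nu> i) \<mu>) 0 < e"
  proof eventually_elim
    case (elim i)
    with G(4)[of "\<nu> i"] test_dist_nonneg[OF d elim(1) \<mu>] \<open>0 < e\<close> show ?case by auto
  qed
qed

section \<open>Tame functionals of a belief\<close>

text \<open>Lipschitz continuity with respect to some test distance. It implies weak continuity, and in
  contrast to the latter it is a quantitative property that the belief transition kernel can be seen
  to preserve.\<close>

definition tame_with :: "'a::metric_space set \<Rightarrow> ('a \<Rightarrow> 'a \<Rightarrow> real) \<Rightarrow> real \<Rightarrow> ('a measure \<Rightarrow> real) \<Rightarrow> bool" where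
  "tame_with X d K v \<longleftrightarrow> (\<forall>z\<in>prob_measures X. \<bar>v z\<bar> \<le> K) \<and>
     (\<forall>z\<in>prob_measures X. \<forall>z'\<in>prob_measures X. \<bar>v z - v z'\<bar> \<le> K * test_dist X d z z')"

lemma tame_withD:
  assumes "tame_with X d K v"
  shows "\<And>z. z \<in> prob_measures X \<Longrightarrow> \<bar>v z\<bar> \<le> K"
    "\<And>z z'. z \<in> prob_measures X \<Longrightarrow> z' \<in> prob_measures X \<Longrightarrow> \<bar>v z - v z'\<bar> \<le> K * test_dist X d z z'"
  using assms by (auto simp: tame_with_def)

text \<open>The \<open>\<sigma>\<close>-algebra of the belief space is generated by the weakly open sets, and test distances
  are weakly continuous.\<close>

lemma tame_with_measurable:
  fixes X :: "'a::{metric_space, second_countable_topology} set"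
  assumes d: "modulus_on X d" and v: "tame_with X d K v"
  shows "v \<in> borel_measurable (belief_space X)"
proof (rule borel_measurableI_greater)
  fix t :: real
  have "openin (weak_topology X) {z \<in> prob_measures X. t < v z}"
  proof (subst openin_subopen, safe)
    fix z assume z: "z \<in> prob_measures X" "t < v z"
    define e where "e = (v z - t) / (2 * (\<bar>K\<bar> + 1))"
    have e: "0 < e" "K * e < v z - t"
    proof -
      show "0 < e" using z(2) by (simp add: e_def)
      then have "K * e \<le> (\<bar>K\<bar> + 1) * e" by (intro mult_right_mono) auto
      also have "\<dots> = (v z - t) / 2" by (simp add: e_def field_simps)
      also have "\<dots> < v z - t" using z(2) by simp
      finally show "K * e < v z - t" .
    qed
    obtain G :: "('a \<Rightarrow> real) set" and \<delta> :: real where G: "finite G" "0 < \<delta>"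
      "\<And>g. g \<in> G \<Longrightarrow> continuous_on X g \<and> bounded (g ` X)"
      "\<And>\<pi>'. \<pi>' \<in> prob_measures X \<Longrightarrow> (\<And>g. g \<in> G \<Longrightarrow> \<bar>(\<integral>x. g x \<partial>\<pi>') - (\<integral>x. g x \<partial>z)\<bar> < \<delta>) \<Longrightarrow>
         test_dist X d \<pi>' z \<le> e"
      using weak_neighbourhood_test_dist[OF d z(1) e(1)] by metis
    define U where "U g = {\<mu> \<in> prob_measures X. (\<integral>x. g x \<partial>\<mu>) \<in> ball (\<integral>x. g x \<partial>z) \<delta>}" for g :: "'a \<Rightarrow> real"
    define T where "T = topspace (weak_topology X) \<inter> (\<Inter>g\<in>G. U g)"
    have U: "openin (weak_topology X) (U g)" if "g \<in> G" for g
      unfolding U_def using openin_weak_topology_basic[OF _ _ open_ball] G(3)[OF that] by blast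
    have "openin (weak_topology X) T"
      unfolding T_def
    proof (cases "G = {}")
      case False
      then show "openin (weak_topology X) (topspace (weak_topology X) \<inter> (\<Inter>g\<in>G. U g))"
        using G(1) U by (intro openin_Int openin_topspace openin_Inter) auto
    qed auto
    moreover have "z \<in> T"
      using z G(2) by (auto simp: T_def U_def topspace_weak_topology)
    moreover have "T \<subseteq> {z \<in> prob_measures X. t < v z}"
    proof
      fix z' assume "z' \<in> T"
      then have z': "z' \<in> prob_measures X" "\<And>g. g \<in> G \<Longrightarrow> \<bar>(\<integral>x. g x \<partial>z') - (\<integral>x. g x \<partial>z)\<bar> < \<delta>"
        by (auto simp: T_def U_def topspace_weak_topology dist_real_def abs_minus_commute)
      have "0 \<le> K" using tame_withD(1)[OF v z(1)] by linarith
      have "\<bar>v z' - v z\<bar> \<le> K * test_dist X d z' z" using tame_withD(2)[OF v z'(1) z(1)] .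
      also have "\<dots> \<le> K * e" using G(4)[OF z'] \<open>0 \<le> K\<close> by (intro mult_left_mono)
      finally show "z' \<in> {z \<in> prob_measures X. t < v z}" using e z'(1) by auto
    qed
    ultimately show "\<exists>T. openin (weak_topology X) T \<and> z \<in> T \<and> T \<subseteq> {z \<in> prob_measures X. t < v z}"
      by blast
  qed
  then show "{z \<in> space (belief_space X). t < v z} \<in> sets (belief_space X)"
    by (simp add: openin_imp_sets_belief_space)
qed

lemma tame_with_nonneg:
  assumes "tame_with X d K v" "z \<in> prob_measures X"
  shows "0 \<le> K"
  using tame_withD(1)[OF assms] by linarith

lemma abs_SUP_diff_le:
  fixes f g :: "'i \<Rightarrow> real"
  assumes "I \<noteq> {}" "\<And>i. i \<in> I \<Longrightarrow> \<bar>f i\<bar> \<le> K" "\<And>i. i \<in> I \<Longrightarrow> \<bar>g i\<bar> \<le> K"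
    and "\<And>i. i \<in> I \<Longrightarrow> \<bar>f i - g i\<bar> \<le> e"
  shows "\<bar>(SUP i\<in>I. f i) - (SUP i\<in>I. g i)\<bar> \<le> e"
proof -
  have *: "(SUP i\<in>I. f i) \<le> (SUP i\<in>I. g i) + e"
    if "\<And>i. i \<in> I \<Longrightarrow> \<bar>f i\<bar> \<le> K" "\<And>i. i \<in> I \<Longrightarrow> \<bar>g i\<bar> \<le> K"
     "\<And>i. i \<in> I \<Longrightarrow> \<bar>f i - g i\<bar> \<le> e" for f g :: "'i \<Rightarrow> real"
  proof (rule cSUP_least[OF assms(1)])
    fix i assume i: "i \<in> I"
    have "g i \<le> (SUP i\<in>I. g i)"
      using i that(2) by (intro cSUP_upper bdd_aboveI2[where M=K]) (auto simp: abs_le_iff)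
    with that(3)[OF i] show "f i \<le> (SUP i\<in>I. g i) + e" by linarith
  qed
  from *[of f g] *[of g f] assms show ?thesis by (auto simp: abs_minus_commute abs_le_iff)
qed

lemma abs_SUP_le:
  fixes f :: "'i \<Rightarrow> real"
  assumes "I \<noteq> {}" "\<And>i. i \<in> I \<Longrightarrow> \<bar>f i\<bar> \<le> K"
  shows "\<bar>SUP i\<in>I. f i\<bar> \<le> K"
proof -
  obtain i where i: "i \<in> I" using assms by blast
  have "(SUP i\<in>I. f i) \<le> K" using assms by (intro cSUP_least) (auto simp: abs_le_iff)
  moreover have "f i \<le> (SUP i\<in>I. f i)"
    using i assms(2) by (intro cSUP_upper bdd_aboveI2[where M=K]) (auto simp: abs_le_iff)
  ultimately show ?thesis using assms(2)[OF i] by (auto simp: abs_le_iff)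
qed

lemma tame_with_SUP:
  assumes "I \<noteq> {}" "\<And>i. i \<in> I \<Longrightarrow> tame_with X d K (v i)"
  shows "tame_with X d K (\<lambda>z. SUP i\<in>I. v i z)"
  unfolding tame_with_def
  using assms(2) by (intro conjI ballI abs_SUP_le abs_SUP_diff_le[where K=K] assms(1))
     (auto dest: tame_withD)

lemma tame_with_uminus: "tame_with X d K v \<Longrightarrow> tame_with X d K (\<lambda>z. - v z)"
  unfolding tame_with_def by (auto simp: abs_minus_commute)

lemma tame_with_INF:
  assumes "I \<noteq> {}" "\<And>i. i \<in> I \<Longrightarrow> tame_with X d K (v i)"
  shows "tame_with X d K (\<lambda>z. INF i\<in>I. v i z)"
proof -
  have "tame_with X d K (\<lambda>z. - (SUP i\<in>I. - v i z))"
    by (intro tame_with_uminus tame_with_SUP assms)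
  then show ?thesis by (simp add: Inf_real_def image_image)
qed

lemma tame_with_abs_diff:
  assumes d: "modulus_on X d" and u: "tame_with X d K u" and v: "tame_with X d K v"
  shows "tame_with X d (2 * K) (\<lambda>z. \<bar>u z - v z\<bar>)"
  unfolding tame_with_def
proof (intro conjI ballI)
  fix z assume z: "z \<in> prob_measures X"
  show "\<bar>\<bar>u z - v z\<bar>\<bar> \<le> 2 * K" using tame_withD(1)[OF u z] tame_withD(1)[OF v z] by linarith
  fix z' assume z': "z' \<in> prob_measures X"
  show "\<bar>\<bar>u z - v z\<bar> - \<bar>u z' - v z'\<bar>\<bar> \<le> 2 * K * test_dist X d z z'"
    using tame_withD(2)[OF u z z'] tame_withD(2)[OF v z z'] by linarith
qed

section \<open>A countable dense family of test functions\<close>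

text \<open>Suprema over all test functions have to be taken under an integral and therefore have to be
  reduced to countable ones. Since the test functions are equicontinuous, pointwise convergence on a
  dense sequence of points is pointwise convergence, and there the values can be approximated by
  rational ones.\<close>

lemma test_functions_dense_sequence:
  fixes X :: "'a::{metric_space, second_countable_topology} set"
  assumes d: "modulus_on X d"
  obtains g :: "nat \<Rightarrow> 'a \<Rightarrow> real" where "\<And>i. g i \<in> test_functions X d"
    "\<And>f. f \<in> test_functions X d \<Longrightarrow> \<exists>s::nat \<Rightarrow> nat. \<forall>x\<in>X. (\<lambda>k. g (s k) x) \<longlonglongrightarrow> f x"
proof (cases "X = {}")
  case True
  with const_in_test_functions[OF d, of 0] show thesis by (intro that[of "\<lambda>_ _. 0"]) auto
next
  case False
  obtain D where D: "countable D" "D \<subseteq> X" "X \<subseteq> closure D" by (rule separable)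
  with False have "D \<noteq> {}" by auto
  define x where "x i = from_nat_into D i" for i
  have xX: "x i \<in> X" for i using from_nat_into[OF \<open>D \<noteq> {}\<close>] D(2) by (auto simp: x_def)
  define P where "P f l \<longleftrightarrow> (\<forall>i<length l. \<bar>f (x i) - of_rat (l ! i)\<bar> < 1 / real (length l))"
    for f and l :: "rat list"
  have "\<forall>l. \<exists>g\<in>test_functions X d. (\<exists>f\<in>test_functions X d. P f l) \<longrightarrow> P g l"
    using const_in_test_functions[OF d, of 0] by auto
  then obtain G where G: "\<And>l. G l \<in> test_functions X d"
    "\<And>l f. f \<in> test_functions X d \<Longrightarrow> P f l \<Longrightarrow> P (G l) l" by metis
  show thesis
  proof (rule that[of "\<lambda>n. G (from_nat n)"])
    show "G (from_nat i) \<in> test_functions X d" for i by (rule G(1))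
    fix f assume f: "f \<in> test_functions X d"
    have "\<exists>l. length l = Suc k \<and> P f l" for k
    proof -
      have "\<exists>q::rat. \<bar>f (x i) - of_rat q\<bar> < 1 / real (Suc k)" for i
      proof -
        obtain q :: rat where "f (x i) - 1 / real (Suc k) < of_rat q" "of_rat q < f (x i)"
          using of_rat_dense[of "f (x i) - 1 / real (Suc k)" "f (x i)"] by auto
        then show ?thesis by (intro exI[of _ q]) auto
      qed
      then obtain q where q: "\<And>i. \<bar>f (x i) - of_rat (q i :: rat)\<bar> < 1 / real (Suc k)" by metis
      show ?thesis
        by (intro exI[of _ "map q [0..<Suc k]"]) (use q in \<open>auto simp: P_def nth_append simp del: upt_Suc\<close>)
    qed
    then obtain l where l: "\<And>k. length (l k) = Suc k" "\<And>k. P f (l k)" by metis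
    have close: "\<bar>G (l k) (x i) - f (x i)\<bar> < 2 / real (Suc k)" if "i \<le> k" for i k
    proof -
      have "\<bar>f (x i) - of_rat (l k ! i)\<bar> < 1 / real (Suc k)" "\<bar>G (l k) (x i) - of_rat (l k ! i)\<bar> < 1 / real (Suc k)"
        using l(2)[of k] G(2)[OF f l(2)[of k]] that l(1)[of k] by (auto simp: P_def)
      moreover have "2 / real (Suc k) = 1 / real (Suc k) + 1 / real (Suc k)" by simp
      ultimately show ?thesis by linarith
    qed
    have "(\<lambda>k. G (l k) y) \<longlonglongrightarrow> f y" if y: "y \<in> X" for y
    proof (rule LIMSEQ_I)
      fix e :: real assume "0 < e"
      then have e: "0 < e / 4" by simp
      have "\<forall>\<^sub>F z in at y within X. d y z < e / 4"
        using d y e by (intro order_tendstoD(2)[where y=0]) (auto simp: modulus_on_def)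
      then obtain \<rho> where \<rho>: "\<rho> > 0" "\<And>z. z \<in> X \<Longrightarrow> z \<noteq> y \<Longrightarrow> dist z y < \<rho> \<Longrightarrow> d y z < e / 4"
        unfolding eventually_at by auto
      obtain z where z: "z \<in> D" "dist z y < \<rho>"
        using y D(3) \<rho>(1) by (meson closure_approachable subsetD)
      obtain i where i: "x i = z" using from_nat_into_surj[OF D(1) z(1)] by (auto simp: x_def)
      have near: "\<bar>h y - h (x i)\<bar> \<le> e / 4" if "h \<in> test_functions X d" for h
        using test_functionsD(2)[OF that y xX[of i]] \<rho>(2)[of z] z(2) xX[of i] i e by (cases "z = y") auto
      obtain N where N: "real N > 4 / e" using reals_Archimedean2 by blast
      show "\<exists>no. \<forall>n\<ge>no. norm (G (l n) y - f y) < e"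
      proof (intro exI[of _ "max N i"] allI impI)
        fix n assume n: "max N i \<le> n"
        have "4 / e < real (Suc n)" using N n by simp
        then have "2 / real (Suc n) < e / 2" using \<open>0 < e\<close> by (simp add: field_simps)
        moreover have "\<bar>G (l n) (x i) - f (x i)\<bar> < 2 / real (Suc n)" using close[of i n] n by simp
        ultimately show "norm (G (l n) y - f y) < e"
          using near[OF f] near[OF G(1), of "l n"] unfolding real_norm_def by linarith
      qed
    qed
    then show "\<exists>s::nat \<Rightarrow> nat. \<forall>x\<in>X. (\<lambda>k. G (from_nat (s k)) x) \<longlonglongrightarrow> f x"
      by (intro exI[of _ "\<lambda>k. to_nat (l k)"]) auto
  qed
qed

section \<open>Densities and total variation\<close>

lemma common_density:
  fixes \<mu> \<nu> :: "'a measure"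
  assumes \<mu>: "prob_space \<mu>" and \<nu>: "prob_space \<nu>" and s: "sets \<nu> = sets \<mu>"
  obtains \<kappa> :: "'a measure" and f g :: "'a \<Rightarrow> real" where
    "prob_space \<kappa>" "sets \<kappa> = sets \<mu>" "f \<in> borel_measurable \<kappa>" "g \<in> borel_measurable \<kappa>"
    "\<And>x. 0 \<le> f x" "\<And>x. 0 \<le> g x" "density \<kappa> (\<lambda>x. ennreal (f x)) = \<mu>" "density \<kappa> (\<lambda>x. ennreal (g x)) = \<nu>"
proof -
  interpret \<mu>: prob_space \<mu> by fact
  interpret \<nu>: prob_space \<nu> by fact
  \<comment> \<open>The mixture of the two measures with equal weights dominates both.\<close>
  define B where "B = measure_pmf (bernoulli_pmf (1/2))"
  define \<kappa> where "\<kappa> = B \<bind> (\<lambda>b. if b then \<mu> else \<nu>)"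
  have N: "(\<lambda>b. if b then \<mu> else \<nu>) \<in> B \<rightarrow>\<^sub>M prob_algebra \<mu>"
    unfolding B_def using \<mu> \<nu> s by (auto simp: space_prob_algebra)
  have Bsp: "B \<in> space (prob_algebra B)"
    by (simp add: space_prob_algebra B_def prob_space_measure_pmf)
  have em: "emeasure \<kappa> A = emeasure \<mu> A * ennreal (1/2) + emeasure \<nu> A * ennreal (1/2)" if "A \<in> sets \<mu>" for A
    unfolding \<kappa>_def
    by (subst emeasure_bind_prob_algebra[OF Bsp N that])
      (simp add: B_def)
  have sp: "\<kappa> \<in> space (prob_algebra \<mu>)"
    unfolding \<kappa>_def using Bsp measurable_space[OF measurable_bind_prob_space[OF measurable_ident_sets[OF refl] N]]
    by (auto simp: B_def space_prob_algebra prob_space_measure_pmf)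
  then have s\<kappa>: "sets \<kappa> = sets \<mu>" and "prob_space \<kappa>" by (auto simp: space_prob_algebra)
  interpret \<kappa>: prob_space \<kappa> by fact
  have ac: "absolutely_continuous \<kappa> \<mu>" "absolutely_continuous \<kappa> \<nu>"
    using em by (auto simp: absolutely_continuous_def null_sets_def s\<kappa> s)
  have dens: "\<exists>f. f \<in> borel_measurable \<kappa> \<and> (\<forall>x. 0 \<le> f x) \<and> density \<kappa> (\<lambda>x. ennreal (f x)) = \<zeta>"
    if ac: "absolutely_continuous \<kappa> \<zeta>" and \<zeta>: "prob_space \<zeta>" "sets \<zeta> = sets \<kappa>" for \<zeta>
  proof -
    interpret \<zeta>: prob_space \<zeta> by fact
    obtain D where D: "D \<in> borel_measurable \<kappa>" "AE x in \<kappa>. RN_deriv \<kappa> \<zeta> x = ennreal (D x)" "\<And>x. 0 \<le> D x"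
      using \<kappa>.real_RN_deriv[OF \<zeta>.finite_measure_axioms ac \<zeta>(2)] by metis
    have "density \<kappa> (\<lambda>x. ennreal (D x)) = density \<kappa> (RN_deriv \<kappa> \<zeta>)"
      using D by (intro density_cong) auto
    with D \<kappa>.density_RN_deriv[OF ac \<zeta>(2)] show ?thesis by auto
  qed
  from dens[OF ac(1) \<mu>] dens[OF ac(2) \<nu>] s s\<kappa> \<open>prob_space \<kappa>\<close> that show thesis by metis
qed

lemma abs_measure_diff_le_tv_dist:
  assumes "prob_space \<mu>" "prob_space \<nu>" "C \<in> sets \<mu>"
  shows "\<bar>measure \<mu> C - measure \<nu> C\<bar> \<le> tv_dist \<mu> \<nu>"
  unfolding tv_dist_def
proof (rule cSUP_upper[OF assms(3) bdd_aboveI2])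
  show "\<bar>measure \<mu> C - measure \<nu> C\<bar> \<le> 1" for C
    using prob_space.prob_le_1[OF assms(1), of C] prob_space.prob_le_1[OF assms(2), of C]
      measure_nonneg[of \<mu> C] measure_nonneg[of \<nu> C] by linarith
qed

text \<open>In terms of densities \<open>f\<close> and \<open>g\<close>, the left-hand side is at most \<open>\<integral>\<bar>f - g\<bar>\<close>, which is the sum
  of the deviations on the events \<open>f > g\<close> and \<open>f \<le> g\<close>; this is where the factor 2 comes from.\<close>

lemma abs_integral_diff_le_tv_dist:
  fixes w :: "'a \<Rightarrow> real"
  assumes \<mu>: "prob_space \<mu>" and \<nu>: "prob_space \<nu>" and s: "sets \<nu> = sets \<mu>"
    and w: "w \<in> borel_measurable \<mu>" "\<And>x. x \<in> space \<mu> \<Longrightarrow> \<bar>w x\<bar> \<le> 1"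
  shows "\<bar>(\<integral>x. w x \<partial>\<mu>) - (\<integral>x. w x \<partial>\<nu>)\<bar> \<le> 2 * tv_dist \<mu> \<nu>"
proof -
  obtain \<kappa> f g where \<kappa>: "prob_space \<kappa>" and s\<kappa>: "sets \<kappa> = sets \<mu>"
    and f[measurable]: "f \<in> borel_measurable \<kappa>" and g[measurable]: "g \<in> borel_measurable \<kappa>"
    and f0: "\<And>x. 0 \<le> f x" and g0: "\<And>x. 0 \<le> g x" and df: "density \<kappa> (\<lambda>x. ennreal (f x)) = \<mu>" and dg: "density \<kappa> (\<lambda>x. ennreal (g x)) = \<nu>"
    by (rule common_density[OF \<mu> \<nu> s]) (rule that)
  interpret \<mu>: prob_space \<mu> by fact
  interpret \<nu>: prob_space \<nu> by fact
  have sp: "space \<kappa> = space \<mu>" using s\<kappa> by (rule sets_eq_imp_space_eq)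
  have spn: "space \<nu> = space \<mu>" using s by (rule sets_eq_imp_space_eq)
  have [measurable]: "w \<in> borel_measurable \<kappa>" using w(1) by (simp add: measurable_cong_sets[OF s\<kappa> refl])
  have I: "(\<integral>x. u x \<partial>\<mu>) = (\<integral>x. f x * u x \<partial>\<kappa>)" "(\<integral>x. u x \<partial>\<nu>) = (\<integral>x. g x * u x \<partial>\<kappa>)"
      "integrable \<kappa> (\<lambda>x. f x * u x)" "integrable \<kappa> (\<lambda>x. g x * u x)"
    if u[measurable]: "u \<in> borel_measurable \<kappa>" and b: "\<And>x. x \<in> space \<mu> \<Longrightarrow> \<bar>u x\<bar> \<le> 1" for u :: "'a \<Rightarrow> real"
  proof -
    have i: "integrable \<mu> u" "integrable \<nu> u"
      using b u by (auto intro!: \<mu>.integrable_bounded[where B=1] \<nu>.integrable_bounded[where B=1]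
          simp: measurable_cong_sets[OF s\<kappa> refl] measurable_cong_sets[OF s refl] spn)
    show "(\<integral>x. u x \<partial>\<mu>) = (\<integral>x. f x * u x \<partial>\<kappa>)"
      unfolding df[symmetric] using f0 by (subst integral_real_density) auto
    show "(\<integral>x. u x \<partial>\<nu>) = (\<integral>x. g x * u x \<partial>\<kappa>)"
      unfolding dg[symmetric] using g0 by (subst integral_real_density) auto
    show "integrable \<kappa> (\<lambda>x. f x * u x)"
      using i(1) unfolding df[symmetric] using f0 by (subst (asm) integrable_real_density) auto
    show "integrable \<kappa> (\<lambda>x. g x * u x)"
      using i(2) unfolding dg[symmetric] using g0 by (subst (asm) integrable_real_density) auto
  qed
  let ?P = "{x\<in>space \<kappa>. f x > g x}" and ?N = "{x\<in>space \<kappa>. \<not> f x > g x}"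
  have [measurable]: "?P \<in> sets \<kappa>" "?N \<in> sets \<kappa>" by measurable
  have PN: "?P \<in> sets \<mu>" "?N \<in> sets \<mu>" unfolding s\<kappa>[symmetric] by measurable
  have m: "measure \<mu> C = (\<integral>x. f x * indicator C x \<partial>\<kappa>)" "measure \<nu> C = (\<integral>x. g x * indicator C x \<partial>\<kappa>)"
    if "C \<in> sets \<kappa>" for C
    using I(1,2)[of "indicator C"] that by (simp_all add: s\<kappa> s spn sets.Int_space_eq2)
  have int1: "integrable \<kappa> (\<lambda>x. f x * indicator C x)" "integrable \<kappa> (\<lambda>x. g x * indicator C x)"
    if "C \<in> sets \<kappa>" for C
    using I(3,4)[of "indicator C"] that by (auto simp: indicator_def)
  have "(\<integral>x. w x \<partial>\<mu>) - (\<integral>x. w x \<partial>\<nu>) = (\<integral>x. f x * w x - g x * w x \<partial>\<kappa>)"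
    using I[of w] w(2) by simp
  also have "\<bar>\<dots>\<bar> \<le> (\<integral>x. \<bar>f x * w x - g x * w x\<bar> \<partial>\<kappa>)" by (rule integral_abs_bound)
  also have "\<dots> \<le> (\<integral>x. (f x * indicator ?P x - g x * indicator ?P x) +
      (g x * indicator ?N x - f x * indicator ?N x) \<partial>\<kappa>)"
  proof (rule integral_mono)
    show "integrable \<kappa> (\<lambda>x. \<bar>f x * w x - g x * w x\<bar>)"
      using I(3,4)[of w] w(2) by simp
    fix x assume x: "x \<in> space \<kappa>"
    have "\<bar>f x * w x - g x * w x\<bar> = \<bar>f x - g x\<bar> * \<bar>w x\<bar>"
      by (simp add: abs_mult[symmetric] left_diff_distrib)
    also have "\<dots> \<le> \<bar>f x - g x\<bar> * 1" using w(2) x sp by (intro mult_left_mono) auto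
    finally show "\<bar>f x * w x - g x * w x\<bar> \<le> (f x * indicator ?P x - g x * indicator ?P x) +
      (g x * indicator ?N x - f x * indicator ?N x)"
      using x by (auto simp: indicator_def split: if_splits)
  qed (intro Bochner_Integration.integrable_add Bochner_Integration.integrable_diff int1; measurable)
  also have "\<dots> = (measure \<mu> ?P - measure \<nu> ?P) + (measure \<nu> ?N - measure \<mu> ?N)"
    using int1 m by simp
  also have "\<dots> \<le> 2 * tv_dist \<mu> \<nu>"
    using abs_measure_diff_le_tv_dist[OF \<mu> \<nu> PN(1)] abs_measure_diff_le_tv_dist[OF \<mu> \<nu> PN(2)] by linarith
  finally show ?thesis .
qed

lemma tv_dist_nonneg: "prob_space \<mu> \<Longrightarrow> prob_space \<nu> \<Longrightarrow> 0 \<le> tv_dist \<mu> \<nu>"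
  using abs_measure_diff_le_tv_dist[of \<mu> \<nu> "{}"] by simp

section \<open>Continuity of the filter\<close>

text \<open>For a prior \<open>\<pi>\<close> of the hidden state and the observation channel \<open>r\<close>, the joint law of state and
  observation. The law of the next state and observation in the belief process depends on the belief
  and the action only through the one-step prediction \<open>\<pi>\<close> of the state.\<close>

definition signal_law :: "'x::topological_space set \<Rightarrow> 'y::topological_space set \<Rightarrow> ('x \<Rightarrow> 'y measure) \<Rightarrow>
    'x measure \<Rightarrow> ('x \<times> 'y) measure" where
  "signal_law X Y r \<pi> = \<pi> \<bind> (\<lambda>x. r x \<bind> (\<lambda>y. return (borel_on X \<Otimes>\<^sub>M borel_on Y) (x, y)))"

text \<open>A version \<open>G\<close> of the conditional law of the state given the observation, together with the law
  \<open>H\<close> of the observation, up to whose null sets \<open>G\<close> is determined.\<close>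

definition is_posterior :: "'x::topological_space set \<Rightarrow> 'y::topological_space set \<Rightarrow> ('x \<Rightarrow> 'y measure) \<Rightarrow>
    'x measure \<Rightarrow> 'y measure \<Rightarrow> ('y \<Rightarrow> 'x measure) \<Rightarrow> bool" where
  "is_posterior X Y r \<pi> H G \<longleftrightarrow> H \<in> prob_measures Y \<and> G \<in> borel_on Y \<rightarrow>\<^sub>M prob_algebra (borel_on X) \<and>
     (\<forall>B\<in>sets (borel_on X). \<forall>C\<in>sets (borel_on Y).
        emeasure (signal_law X Y r \<pi>) (B \<times> C) = (\<integral>\<^sup>+y\<in>C. emeasure (G y) B \<partial>H))"

lemma integral_bind_return_Pair:
  fixes k :: "'a \<times> 'b \<Rightarrow> real"
  assumes \<pi>: "\<pi> \<in> space (prob_algebra M)" and r: "r \<in> M \<rightarrow>\<^sub>M prob_algebra N"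
    and T: "T \<in> M \<Otimes>\<^sub>M N \<rightarrow>\<^sub>M L"
    and k: "k \<in> borel_measurable L" "\<And>z. z \<in> space L \<Longrightarrow> \<bar>k z\<bar> \<le> K"
  shows "(\<integral>z. k z \<partial>(\<pi> \<bind> (\<lambda>x. r x \<bind> (\<lambda>y. return L (T (x, y)))))) = (\<integral>x. (\<integral>y. k (T (x, y)) \<partial>r x) \<partial>\<pi>)"
proof -
  note [measurable] = r T k(1)
  have \<pi>': "sets \<pi> = sets M" "prob_space \<pi>" using \<pi> by (auto simp: space_prob_algebra)
  interpret \<pi>: prob_space \<pi> by fact
  have sp\<pi>: "space \<pi> = space M" using \<pi>'(1) by (rule sets_eq_imp_space_eq)
  have m\<pi>: "f \<in> \<pi> \<rightarrow>\<^sub>M R" if "f \<in> M \<rightarrow>\<^sub>M R" for f and R :: "'z measure"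
    using that by (simp add: measurable_cong_sets[OF \<pi>'(1) refl])
  have m: "(\<lambda>x. r x \<bind> (\<lambda>y. return L (T (x, y)))) \<in> M \<rightarrow>\<^sub>M prob_algebra L" by measurable
  have "(\<integral>z. k z \<partial>(\<pi> \<bind> (\<lambda>x. r x \<bind> (\<lambda>y. return L (T (x, y))))))
      = (\<integral>x. (\<integral>z. k z \<partial>(r x \<bind> (\<lambda>y. return L (T (x, y))))) \<partial>\<pi>)"
  proof (rule integral_bind[where K=L and B=K and B'=1])
    show "(\<lambda>x. r x \<bind> (\<lambda>y. return L (T (x, y)))) \<in> \<pi> \<rightarrow>\<^sub>M subprob_algebra L"
      by (intro m\<pi> measurable_prob_algebraD m)
    show "AE x in \<pi>. emeasure (r x \<bind> (\<lambda>y. return L (T (x, y)))) (space (r x \<bind> (\<lambda>y. return L (T (x, y))))) \<le> ennreal 1"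
      using measurable_space[OF m] sp\<pi>
      by (auto intro!: AE_I2 simp: space_prob_algebra prob_space.emeasure_space_1)
  qed (use k \<pi>.finite_measure_axioms in auto)
  also have "\<dots> = (\<integral>x. (\<integral>y. k (T (x, y)) \<partial>r x) \<partial>\<pi>)"
  proof (rule Bochner_Integration.integral_cong[OF refl])
    fix x assume "x \<in> space \<pi>"
    then have x: "x \<in> space M" by (simp add: sp\<pi>)
    have rx: "sets (r x) = sets N" "prob_space (r x)" using measurable_space[OF r x] by (auto simp: space_prob_algebra)
    interpret rx: prob_space "r x" by fact
    have Tx: "(\<lambda>y. T (x, y)) \<in> r x \<rightarrow>\<^sub>M L"
      using measurable_compose[OF measurable_Pair1'[OF x] T] by (simp add: measurable_cong_sets[OF rx(1) refl])
    have "r x \<bind> (\<lambda>y. return L (T (x, y))) = distr (r x) L (\<lambda>y. T (x, y))"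
      by (rule bind_return_distr'[OF rx.not_empty Tx])
    then show "(\<integral>z. k z \<partial>(r x \<bind> (\<lambda>y. return L (T (x, y))))) = (\<integral>y. k (T (x, y)) \<partial>r x)"
      by (simp add: integral_distr[OF Tx k(1)])
  qed
  finally show ?thesis .
qed

text \<open>Bayes' formula for integrands that depend on both state and observation; the definition only
  covers rectangles, which generate the product \<open>\<sigma>\<close>-algebra.\<close>

lemma is_posterior_integral:
  fixes k :: "'x::topological_space \<Rightarrow> 'y::topological_space \<Rightarrow> real"
  assumes r: "r \<in> borel_on X \<rightarrow>\<^sub>M prob_algebra (borel_on Y)" and \<pi>: "\<pi> \<in> prob_measures X"
    and post: "is_posterior X Y r \<pi> H G"
    and k: "(\<lambda>(x, y). k x y) \<in> borel_measurable (borel_on X \<Otimes>\<^sub>M borel_on Y)"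
      "\<And>x y. x \<in> X \<Longrightarrow> y \<in> Y \<Longrightarrow> \<bar>k x y\<bar> \<le> K"
  shows "(\<integral>y. (\<integral>x. k x y \<partial>G y) \<partial>H) = (\<integral>x. (\<integral>y. k x y \<partial>r x) \<partial>\<pi>)"
proof -
  let ?X = "borel_on X" and ?Y = "borel_on Y"
  have H: "H \<in> prob_measures Y" and G: "G \<in> ?Y \<rightarrow>\<^sub>M prob_algebra ?X"
    and eq: "\<And>B C. B \<in> sets ?X \<Longrightarrow> C \<in> sets ?Y \<Longrightarrow>
      emeasure (signal_law X Y r \<pi>) (B \<times> C) = (\<integral>\<^sup>+y\<in>C. emeasure (G y) B \<partial>H)"
    using post by (auto simp: is_posterior_def)
  have H': "H \<in> space (prob_algebra ?Y)" using H by (simp add: space_prob_algebra_borel_on)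
  have \<pi>': "\<pi> \<in> space (prob_algebra ?X)" using \<pi> by (simp add: space_prob_algebra_borel_on)
  define J where "J = H \<bind> (\<lambda>y. G y \<bind> (\<lambda>x. return (?X \<Otimes>\<^sub>M ?Y) (prod.swap (y, x))))"
  note [measurable] = r G
  have sw: "prod.swap \<in> ?Y \<Otimes>\<^sub>M ?X \<rightarrow>\<^sub>M ?X \<Otimes>\<^sub>M ?Y" by (auto simp: prod.swap_def[abs_def])
  have mJ: "(\<lambda>y. G y \<bind> (\<lambda>x. return (?X \<Otimes>\<^sub>M ?Y) (prod.swap (y, x)))) \<in> ?Y \<rightarrow>\<^sub>M prob_algebra (?X \<Otimes>\<^sub>M ?Y)"
    using sw by measurable
  have mS: "(\<lambda>x. r x \<bind> (\<lambda>y. return (?X \<Otimes>\<^sub>M ?Y) (x, y))) \<in> ?X \<rightarrow>\<^sub>M prob_algebra (?X \<Otimes>\<^sub>M ?Y)"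
    by measurable
  have J: "J \<in> space (prob_algebra (?X \<Otimes>\<^sub>M ?Y))" and S: "signal_law X Y r \<pi> \<in> space (prob_algebra (?X \<Otimes>\<^sub>M ?Y))"
    unfolding J_def signal_law_def
    by (rule measurable_space[OF measurable_bind_prob_space[OF measurable_ident_sets[OF refl] mJ] H']
        measurable_space[OF measurable_bind_prob_space[OF measurable_ident_sets[OF refl] mS] \<pi>'])+
  have "signal_law X Y r \<pi> = J"
  proof (rule measure_eqI_generator_eq[OF Int_stable_pair_measure_generator[of ?X ?Y], where \<Omega>="X \<times> Y" and A="\<lambda>_. X \<times> Y"])
    have spX: "space ?X = X" "space ?Y = Y" by (auto simp: space_restrict_space)
    show "{a \<times> b |a b. a \<in> sets ?X \<and> b \<in> sets ?Y} \<subseteq> Pow (X \<times> Y)"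
      using sets.sets_into_space[of _ ?X] sets.sets_into_space[of _ ?Y] spX by auto
    show "sets (signal_law X Y r \<pi>) = sigma_sets (X \<times> Y) {a \<times> b |a b. a \<in> sets ?X \<and> b \<in> sets ?Y}"
      "sets J = sigma_sets (X \<times> Y) {a \<times> b |a b. a \<in> sets ?X \<and> b \<in> sets ?Y}"
      using J S by (auto simp: space_prob_algebra sets_pair_measure spX)
    show "range (\<lambda>_::nat. X \<times> Y) \<subseteq> {a \<times> b |a b. a \<in> sets ?X \<and> b \<in> sets ?Y}"
      using sets.top[of ?X] sets.top[of ?Y] by (auto simp: spX)
    show "emeasure (signal_law X Y r \<pi>) (X \<times> Y) \<noteq> \<infinity>"
    proof -
      have "prob_space (signal_law X Y r \<pi>)" using S by (simp add: space_prob_algebra)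
      then interpret prob_space "signal_law X Y r \<pi>" .
      show ?thesis by simp
    qed
    show "(\<Union>i::nat. X \<times> Y) = X \<times> Y" by simp
    fix D assume "D \<in> {a \<times> b |a b. a \<in> sets ?X \<and> b \<in> sets ?Y}"
    then obtain B C where D: "D = B \<times> C" and B[measurable]: "B \<in> sets ?X" and C[measurable]: "C \<in> sets ?Y" by auto
    have BC: "B \<times> C \<in> sets (?X \<Otimes>\<^sub>M ?Y)" by measurable
    have "emeasure J (B \<times> C) = (\<integral>\<^sup>+y. emeasure (G y \<bind> (\<lambda>x. return (?X \<Otimes>\<^sub>M ?Y) (prod.swap (y, x)))) (B \<times> C) \<partial>H)"
      unfolding J_def by (rule emeasure_bind_prob_algebra[OF H' mJ BC])
    also have "\<dots> = (\<integral>\<^sup>+y\<in>C. emeasure (G y) B \<partial>H)"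
    proof (rule nn_integral_cong)
      fix y assume "y \<in> space H"
      then have y: "y \<in> space ?Y" using prob_measuresD(3)[OF H] by (simp add: spX)
      have Gy: "G y \<in> space (prob_algebra ?X)" using measurable_space[OF G y] .
      then have [measurable_cong]: "sets (G y) = sets ?X" by (simp add: space_prob_algebra)
      have "emeasure (G y \<bind> (\<lambda>x. return (?X \<Otimes>\<^sub>M ?Y) (prod.swap (y, x)))) (B \<times> C)
        = (\<integral>\<^sup>+x. emeasure (return (?X \<Otimes>\<^sub>M ?Y) (prod.swap (y, x))) (B \<times> C) \<partial>G y)"
        using y by (intro emeasure_bind_prob_algebra[OF Gy _ BC]) (simp, measurable)
      also have "\<dots> = (\<integral>\<^sup>+x. indicator C y * indicator B x \<partial>G y)"
        using BC by (intro nn_integral_cong) (auto split: split_indicator)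
      also have "\<dots> = emeasure (G y) B * indicator C y"
        by (subst nn_integral_cmult) (auto simp: mult.commute)
      finally show "emeasure (G y \<bind> (\<lambda>x. return (?X \<Otimes>\<^sub>M ?Y) (prod.swap (y, x)))) (B \<times> C) = emeasure (G y) B * indicator C y" .
    qed
    finally show "emeasure (signal_law X Y r \<pi>) D = emeasure J D" using eq[OF B C] D by simp
  qed
  then have "(\<integral>z. (\<lambda>(x, y). k x y) z \<partial>signal_law X Y r \<pi>) = (\<integral>z. (\<lambda>(x, y). k x y) z \<partial>J)" by simp
  moreover have "(\<integral>z. (\<lambda>(x, y). k x y) z \<partial>J) = (\<integral>y. (\<integral>x. (\<lambda>(x, y). k x y) (prod.swap (y, x)) \<partial>G y) \<partial>H)"
    unfolding J_def using k
    by (intro integral_bind_return_Pair[OF H' G sw, where K=K]) (auto simp: space_pair_measure space_restrict_space)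
  moreover have "(\<integral>z. (\<lambda>(x, y). k x y) z \<partial>signal_law X Y r \<pi>) = (\<integral>x. (\<integral>y. (\<lambda>(x, y). k x y) (x, y) \<partial>r x) \<partial>\<pi>)"
    unfolding signal_law_def using k
    by (intro integral_bind_return_Pair[where T="\<lambda>z. z", OF \<pi>' r measurable_ident_sets[OF refl], where K=K])
      (auto simp: space_pair_measure space_restrict_space)
  ultimately show ?thesis by simp
qed

text \<open>The modulus of \<open>x \<mapsto> \<integral> k x y r x (dy)\<close> when each \<open>k _ y\<close> is a test function for \<open>d\<close>: one moves
  \<open>x\<close> first in the integrand and then in the measure. This is the place where continuity of the
  channel in total variation is needed, since \<open>k\<close> is merely measurable in \<open>y\<close>.\<close>

definition filter_modulus :: "('x \<Rightarrow> 'x \<Rightarrow> real) \<Rightarrow> ('x \<Rightarrow> 'y measure) \<Rightarrow> 'x \<Rightarrow> 'x \<Rightarrow> real" where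
  "filter_modulus d r x x' = d x x' + 2 * tv_dist (r x) (r x')"

lemma kernelD:
  assumes "r \<in> borel_on X \<rightarrow>\<^sub>M prob_algebra (borel_on Y)" "x \<in> X"
  shows "r x \<in> prob_measures Y"
  using measurable_space[OF assms(1), of x] assms(2)
  by (simp add: space_prob_algebra_borel_on space_restrict_space)

lemma tv_dist_commute: "sets \<mu> = sets \<nu> \<Longrightarrow> tv_dist \<mu> \<nu> = tv_dist \<nu> \<mu>"
  unfolding tv_dist_def by (simp add: abs_minus_commute)

lemma modulus_on_filter_modulus:
  fixes X :: "'x::metric_space set"
  assumes d: "modulus_on X d" and r: "r \<in> borel_on X \<rightarrow>\<^sub>M prob_algebra (borel_on Y)"
    and tv: "tv_continuous_kernel X r"
  shows "modulus_on X (filter_modulus d r)"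
  unfolding modulus_on_def filter_modulus_def
proof (intro conjI ballI)
  note P = prob_measuresD(1)[OF kernelD[OF r]]
  show "0 \<le> d x y + 2 * tv_dist (r x) (r y)" if "x \<in> X" "y \<in> X" for x y
    using modulus_on_nonneg[OF d that] tv_dist_nonneg[OF P P, OF that] by simp
  fix x assume x: "x \<in> X"
  have "((\<lambda>y. tv_dist (r y) (r x)) \<longlongrightarrow> 0) (at x within X)"
    unfolding tendsto_at_iff_sequentially
    using tv x unfolding tv_continuous_kernel_def by (auto simp: comp_def)
  then have "((\<lambda>y. tv_dist (r x) (r y)) \<longlongrightarrow> 0) (at x within X)"
  proof (rule Lim_transform_eventually)
    show "\<forall>\<^sub>F y in at x within X. tv_dist (r y) (r x) = tv_dist (r x) (r y)"
      using prob_measuresD(2)[OF kernelD[OF r]] x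
      by (auto simp: eventually_at_filter intro!: tv_dist_commute always_eventually)
  qed
  then show "((\<lambda>y. d x y + 2 * tv_dist (r x) (r y)) \<longlongrightarrow> 0) (at x within X)"
    using d x by (auto simp: modulus_on_def intro!: tendsto_add_zero tendsto_mult_right_zero)
qed

lemma observed_test_function:
  assumes d: "modulus_on X d" and r: "r \<in> borel_on X \<rightarrow>\<^sub>M prob_algebra (borel_on Y)"
    and k: "(\<lambda>(x, y). k x y) \<in> borel_measurable (borel_on X \<Otimes>\<^sub>M borel_on Y)"
    and t: "\<And>y. y \<in> Y \<Longrightarrow> (\<lambda>x. k x y) \<in> test_functions X d"
  shows "(\<lambda>x. \<integral>y. k x y \<partial>r x) \<in> test_functions X (filter_modulus d r)"
  unfolding test_functions_def
proof (intro CollectI conjI ballI)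
  have spX: "space (borel_on X) = X" by (simp add: space_restrict_space)
  have kx: "k x \<in> borel_measurable (borel_on Y)" if "x \<in> X" for x
    using measurable_compose[OF measurable_Pair1' k, of x] that by (simp add: spX)
  fix x assume x: "x \<in> X"
  show "\<bar>\<integral>y. k x y \<partial>r x\<bar> \<le> 1"
    using test_functionsD(1)[OF t x] by (intro abs_integral_le_prob_measures[OF kernelD[OF r x]]) auto
  fix x' assume x': "x' \<in> X"
  note rx = kernelD[OF r x] and rx' = kernelD[OF r x']
  have int: "integrable (r x) (k x)" "integrable (r x) (k x')" "integrable (r x') (k x')"
    using kx[OF x] kx[OF x'] test_functionsD(1)[OF t x] test_functionsD(1)[OF t x']
    by (auto intro!: integrable_prob_measures[OF rx, where B=1] integrable_prob_measures[OF rx', where B=1])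
  have "\<bar>\<integral>y. k x y - k x' y \<partial>r x\<bar> \<le> d x x'"
    using test_functionsD(2)[OF t x x'] by (intro abs_integral_le_prob_measures[OF rx]) auto
  moreover have "\<bar>(\<integral>y. k x' y \<partial>r x) - (\<integral>y. k x' y \<partial>r x')\<bar> \<le> 2 * tv_dist (r x) (r x')"
    using rx rx' kx[OF x'] test_functionsD(1)[OF t x']
    by (intro abs_integral_diff_le_tv_dist) (auto simp: prob_measuresD measurable_prob_measures[OF rx])
  ultimately show "\<bar>(\<integral>y. k x y \<partial>r x) - (\<integral>y. k x' y \<partial>r x')\<bar> \<le> filter_modulus d r x x'"
    using int by (simp add: filter_modulus_def)
qed

lemma integral_kernel_measurable:
  fixes f :: "'a \<Rightarrow> real"
  assumes "G \<in> M \<rightarrow>\<^sub>M prob_algebra N" "f \<in> borel_measurable N"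
  shows "(\<lambda>y. \<integral>x. f x \<partial>G y) \<in> borel_measurable M"
  by (rule measurable_compose[OF measurable_prob_algebraD[OF assms(1)]
        integral_measurable_subprob_algebra[OF assms(2)]])

text \<open>Let \<open>h\<close>, \<open>h'\<close> be the densities of the two observation laws with respect to a common measure
  \<open>\<kappa>\<close>. For a fixed observation \<open>y\<close>, the difference \<open>h y * v (G y) - h' y * v (G' y)\<close> is bounded, up to
  a factor \<open>3 * K\<close>, by the supremum over test functions \<open>f\<close> of the difference of the
  \<^emph>\<open>unnormalised\<close> posterior expectations \<open>h y * \<integral> f dG y\<close> and \<open>h' y * \<integral> f dG' y\<close>; the constant
  test function 1 takes care of the difference of the normalisations. Integrated over \<open>y\<close>, this
  supremum is attained up to a limit by choosing a test function depending measurably on \<open>y\<close>. By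
  Bayes' formula, the integral for such a choice is the difference of the integrals of
  a single function under the two priors, and this function is a test function for the modulus
  enlarged by the variation of the channel.\<close>

theorem tame_filter:
  fixes X :: "'x::{metric_space, second_countable_topology} set" and Y :: "'y::topological_space set"
  assumes d: "modulus_on X d" and r: "r \<in> borel_on X \<rightarrow>\<^sub>M prob_algebra (borel_on Y)"
    and tv: "tv_continuous_kernel X r"
    and v: "tame_with X d K v"
    and \<pi>: "\<pi> \<in> prob_measures X" "is_posterior X Y r \<pi> H G" "(\<lambda>y. v (G y)) \<in> borel_measurable (borel_on Y)"
    and \<pi>': "\<pi>' \<in> prob_measures X" "is_posterior X Y r \<pi>' H' G'" "(\<lambda>y. v (G' y)) \<in> borel_measurable (borel_on Y)"
  shows "\<bar>(\<integral>y. v (G y) \<partial>H) - (\<integral>y. v (G' y) \<partial>H')\<bar> \<le> 3 * K * test_dist X (filter_modulus d r) \<pi> \<pi>'"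
proof -
  let ?d = "filter_modulus d r"
  have d': "modulus_on X ?d" by (rule modulus_on_filter_modulus[OF d r tv])
  have K: "0 \<le> K" using tame_with_nonneg[OF v \<pi>(1)] .
  have H: "H \<in> prob_measures Y" and G: "G \<in> borel_on Y \<rightarrow>\<^sub>M prob_algebra (borel_on X)"
   and H': "H' \<in> prob_measures Y" and G': "G' \<in> borel_on Y \<rightarrow>\<^sub>M prob_algebra (borel_on X)"
    using \<pi>(2) \<pi>'(2) by (auto simp: is_posterior_def)
  obtain g where g: "\<And>i. g i \<in> test_functions X d"
    "\<And>f. f \<in> test_functions X d \<Longrightarrow> \<exists>s::nat \<Rightarrow> nat. \<forall>x\<in>X. (\<lambda>k. g (s k) x) \<longlonglongrightarrow> f x"
    by (rule test_functions_dense_sequence[OF d]) (rule that)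
  have g_meas: "g i \<in> borel_measurable (borel_on X)" for i
    by (rule measurable_borel_on_continuous[OF test_functions_continuous[OF d g(1)]])
  obtain \<kappa> h h' where \<kappa>: "prob_space \<kappa>" and s\<kappa>: "sets \<kappa> = sets H"
    and h[measurable]: "h \<in> borel_measurable \<kappa>" and h'[measurable]: "h' \<in> borel_measurable \<kappa>"
    and h0: "\<And>x. 0 \<le> h x" and h'0: "\<And>x. 0 \<le> h' x"
    and dh: "density \<kappa> (\<lambda>x. ennreal (h x)) = H" and dh': "density \<kappa> (\<lambda>x. ennreal (h' x)) = H'"
    by (rule common_density[OF prob_measuresD(1)[OF H] prob_measuresD(1)[OF H']])
      (simp add: prob_measuresD(2)[OF H] prob_measuresD(2)[OF H'], rule that)
  interpret \<kappa>: prob_space \<kappa> by fact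
  have s\<kappa>Y: "sets \<kappa> = sets (borel_on Y)" using s\<kappa> prob_measuresD(2)[OF H] by simp
  have sp: "space \<kappa> = Y" using sets_eq_imp_space_eq[OF s\<kappa>Y] by (simp add: space_restrict_space)
  have spY: "space (borel_on Y) = Y" by (simp add: space_restrict_space)
  have m\<kappa>: "u \<in> borel_measurable \<kappa>" if "u \<in> borel_measurable (borel_on Y)" for u :: "'y \<Rightarrow> real"
    using that by (simp add: measurable_cong_sets[OF s\<kappa>Y refl])
  have I: "(\<integral>y. u y \<partial>H) = (\<integral>y. h y * u y \<partial>\<kappa>)" "(\<integral>y. u y \<partial>H') = (\<integral>y. h' y * u y \<partial>\<kappa>)"
      "integrable \<kappa> (\<lambda>y. h y * u y)" "integrable \<kappa> (\<lambda>y. h' y * u y)"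
    if u: "u \<in> borel_measurable (borel_on Y)" and b: "\<And>y. y \<in> Y \<Longrightarrow> \<bar>u y\<bar> \<le> B" for u :: "'y \<Rightarrow> real" and B
  proof -
    have i: "integrable H u" "integrable H' u"
      by (rule integrable_prob_measures[OF H u b] integrable_prob_measures[OF H' u b]; assumption)+
    note [measurable] = m\<kappa>[OF u]
    show "(\<integral>y. u y \<partial>H) = (\<integral>y. h y * u y \<partial>\<kappa>)"
      unfolding dh[symmetric] using h0 by (subst integral_real_density) auto
    show "(\<integral>y. u y \<partial>H') = (\<integral>y. h' y * u y \<partial>\<kappa>)"
      unfolding dh'[symmetric] using h'0 by (subst integral_real_density) auto
    show "integrable \<kappa> (\<lambda>y. h y * u y)"
      using i(1) unfolding dh[symmetric] using h0 by (subst (asm) integrable_real_density) auto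
    show "integrable \<kappa> (\<lambda>y. h' y * u y)"
      using i(2) unfolding dh'[symmetric] using h'0 by (subst (asm) integrable_real_density) auto
  qed
  have int_h: "integrable \<kappa> h" "integrable \<kappa> h'"
    using I(3,4)[of "\<lambda>_. 1" 1] by auto
  have Gy: "G y \<in> prob_measures X" "G' y \<in> prob_measures X" if "y \<in> Y" for y
    using kernelD[OF G that] kernelD[OF G' that] .
  \<comment> \<open>The difference of the unnormalised posterior expectations of the \<open>i\<close>-th test function.\<close>
  define s where "s i y = h y * (\<integral>x. g i x \<partial>G y) - h' y * (\<integral>x. g i x \<partial>G' y)" for i y
  have Ig[measurable]: "(\<lambda>y. \<integral>x. g i x \<partial>G y) \<in> borel_measurable (borel_on Y)"
     "(\<lambda>y. \<integral>x. g i x \<partial>G' y) \<in> borel_measurable (borel_on Y)" for i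
    by (rule integral_kernel_measurable[OF G g_meas] integral_kernel_measurable[OF G' g_meas])+
  have s_meas[measurable]: "s i \<in> borel_measurable \<kappa>" for i
    unfolding s_def using m\<kappa>[OF Ig(1)] m\<kappa>[OF Ig(2)] by measurable
  have s_meas'[measurable]: "s i \<in> borel_measurable (borel_on Y)" for i
    using s_meas by (simp add: measurable_cong_sets[OF s\<kappa>Y refl])
  have s_bound: "\<bar>s i y\<bar> \<le> h y + h' y" if "y \<in> Y" for i y
  proof -
    have "\<bar>\<integral>x. g i x \<partial>G y\<bar> \<le> 1" "\<bar>\<integral>x. g i x \<partial>G' y\<bar> \<le> 1"
      using test_functionsD(1)[OF g(1)] Gy[OF that] by (auto intro!: abs_integral_le_prob_measures)
    then have "\<bar>h y * (\<integral>x. g i x \<partial>G y)\<bar> \<le> h y" "\<bar>h' y * (\<integral>x. g i x \<partial>G' y)\<bar> \<le> h' y"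
      using h0[of y] h'0[of y] by (auto simp: abs_mult mult_left_le)
    then show ?thesis unfolding s_def by linarith
  qed
  define S where "S m y = Max ((\<lambda>i. \<bar>s i y\<bar>) ` {..m})" for m y
  have S_upper: "\<bar>s i y\<bar> \<le> S m y" if "i \<le> m" for i m y
    unfolding S_def using that by (intro Max_ge) auto
  have S_attained: "\<exists>i\<le>m. \<bar>s i y\<bar> = S m y" for m y
  proof -
    have "S m y \<in> (\<lambda>i. \<bar>s i y\<bar>) ` {..m}" unfolding S_def by (rule Max_in) auto
    then show ?thesis by auto
  qed
  have S_meas[measurable]: "S m \<in> borel_measurable (borel_on Y)" for m
    unfolding S_def by (intro borel_measurable_Max) auto
  \<comment> \<open>A maximising test function of least index is selected for each observation.\<close>
  have integral_S_le: "(\<integral>y. S m y \<partial>\<kappa>) \<le> test_dist X ?d \<pi> \<pi>'" for m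
  proof -
    define \<tau> where "\<tau> y = (LEAST i. \<bar>s i y\<bar> = S m y)" for y
    have \<tau>: "\<bar>s (\<tau> y) y\<bar> = S m y" for y
    proof -
      obtain i where "\<bar>s i y\<bar> = S m y" using S_attained[of m y] by auto
      then show ?thesis unfolding \<tau>_def by (rule LeastI)
    qed
    have \<tau>_meas[measurable]: "\<tau> \<in> borel_on Y \<rightarrow>\<^sub>M count_space UNIV"
      unfolding \<tau>_def by measurable
    have s\<tau>: "(\<lambda>y. s (\<tau> y) y) \<in> borel_measurable (borel_on Y)"
      by (rule measurable_compose_countable[OF s_meas' \<tau>_meas])
    define e :: "'y \<Rightarrow> real" where "e y = (if 0 \<le> s (\<tau> y) y then 1 else - 1)" for y
    have e_meas[measurable]: "e \<in> borel_measurable (borel_on Y)"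
      unfolding e_def using s\<tau> by measurable
    define k where "k x y = e y * g (\<tau> y) x" for x y
    have k_meas: "(\<lambda>(x, y). k x y) \<in> borel_measurable (borel_on X \<Otimes>\<^sub>M borel_on Y)"
    proof -
      have "(\<lambda>z. g (\<tau> (snd z)) (fst z)) \<in> borel_measurable (borel_on X \<Otimes>\<^sub>M borel_on Y)"
        by (rule measurable_compose_countable[where f="\<lambda>i z. g i (fst z)"])
          (auto intro: measurable_compose[OF measurable_fst g_meas] measurable_compose[OF measurable_snd \<tau>_meas])
      then show ?thesis
        unfolding k_def case_prod_unfold
        by (intro borel_measurable_times measurable_compose[OF measurable_snd e_meas])
    qed
    have k_test: "(\<lambda>x. k x y) \<in> test_functions X d" for y
      using g(1)[of "\<tau> y"] by (auto simp: k_def e_def test_functions_def abs_minus_commute)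
    have k_le: "\<bar>k x y\<bar> \<le> 1" if "x \<in> X" for x y using test_functionsD(1)[OF k_test that] .
    define f where "f x = (\<integral>y. k x y \<partial>r x)" for x
    have f: "f \<in> test_functions X ?d"
      unfolding f_def by (rule observed_test_function[OF d r k_meas k_test])
    have kG: "(\<integral>x. k x y \<partial>G y) = e y * (\<integral>x. g (\<tau> y) x \<partial>G y)" "(\<integral>x. k x y \<partial>G' y) = e y * (\<integral>x. g (\<tau> y) x \<partial>G' y)" for y
      by (auto simp: k_def)
    have kG_meas: "(\<lambda>y. \<integral>x. k x y \<partial>G y) \<in> borel_measurable (borel_on Y)"
       "(\<lambda>y. \<integral>x. k x y \<partial>G' y) \<in> borel_measurable (borel_on Y)"
      unfolding kG
      by (intro borel_measurable_times e_meas measurable_compose_countable[OF Ig(1) \<tau>_meas]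
          measurable_compose_countable[OF Ig(2) \<tau>_meas])+
    have kG_le: "\<bar>\<integral>x. k x y \<partial>G y\<bar> \<le> 1" "\<bar>\<integral>x. k x y \<partial>G' y\<bar> \<le> 1" if "y \<in> Y" for y
      using k_le Gy[OF that] by (auto intro!: abs_integral_le_prob_measures)
    have "(\<integral>y. S m y \<partial>\<kappa>) = (\<integral>y. h y * (\<integral>x. k x y \<partial>G y) - h' y * (\<integral>x. k x y \<partial>G' y) \<partial>\<kappa>)"
    proof (rule Bochner_Integration.integral_cong[OF refl])
      fix y
      have "S m y = e y * s (\<tau> y) y" using \<tau>[of y] by (auto simp: e_def)
      also have "\<dots> = h y * (\<integral>x. k x y \<partial>G y) - h' y * (\<integral>x. k x y \<partial>G' y)"
        unfolding kG s_def by (simp add: algebra_simps)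
      finally show "S m y = h y * (\<integral>x. k x y \<partial>G y) - h' y * (\<integral>x. k x y \<partial>G' y)" .
    qed
    also have "\<dots> = (\<integral>y. (\<integral>x. k x y \<partial>G y) \<partial>H) - (\<integral>y. (\<integral>x. k x y \<partial>G' y) \<partial>H')"
      using I[OF kG_meas(1) kG_le(1)] I[OF kG_meas(2) kG_le(2)] by simp
    also have "\<dots> = (\<integral>x. f x \<partial>\<pi>) - (\<integral>x. f x \<partial>\<pi>')"
      unfolding f_def using is_posterior_integral[OF r \<pi>(1,2) k_meas k_le] is_posterior_integral[OF r \<pi>'(1,2) k_meas k_le]
      by simp
    also have "\<dots> \<le> test_dist X ?d \<pi> \<pi>'" using test_dist_upper[OF f \<pi>(1) \<pi>'(1)] by linarith
    finally show ?thesis .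
  qed
  define S' where "S' y = (SUP i. \<bar>s i y\<bar>)" for y
  have S'_upper: "\<bar>s i y\<bar> \<le> S' y" if "y \<in> Y" for i y
    unfolding S'_def by (rule cSUP_upper[OF UNIV_I bdd_aboveI2[OF s_bound[OF that]]])
  have S_lim: "(\<lambda>m. S m y) \<longlonglongrightarrow> S' y" if y: "y \<in> Y" for y
  proof (rule increasing_tendsto)
    have "S m y \<le> S' y" for m
    proof -
      obtain i where "\<bar>s i y\<bar> = S m y" using S_attained[of m y] by auto
      with S'_upper[OF y, of i] show ?thesis by simp
    qed
    then show "\<forall>\<^sub>F m in sequentially. S m y \<le> S' y" by simp
    fix t assume "t < S' y"
    then obtain i where i: "t < \<bar>s i y\<bar>"
      unfolding S'_def by (subst (asm) less_cSUP_iff) (auto intro!: bdd_aboveI2 s_bound[OF y])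
    show "\<forall>\<^sub>F m in sequentially. t < S m y"
      using eventually_ge_at_top[of i] by eventually_elim (rule less_le_trans[OF i S_upper])
  qed
  have S_le: "norm (S m y) \<le> h y + h' y" if "y \<in> Y" for m y
  proof -
    obtain i where "\<bar>s i y\<bar> = S m y" using S_attained[of m y] by auto
    with s_bound[OF that, of i] show ?thesis by simp
  qed
  note dct = S_lim S_le sp int_h
  have S'_meas: "S' \<in> borel_measurable (borel_on Y)"
    by (rule borel_measurable_LIMSEQ_real[OF _ S_meas]) (use S_lim in \<open>auto simp: spY\<close>)
  have int_S': "integrable \<kappa> S'"
    by (rule integrable_dominated_convergence[where w="\<lambda>y. h y + h' y" and s=S])
      (use dct m\<kappa>[OF S'_meas] m\<kappa>[OF S_meas] in auto)
  have "(\<lambda>m. \<integral>y. S m y \<partial>\<kappa>) \<longlonglongrightarrow> (\<integral>y. S' y \<partial>\<kappa>)"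
    by (rule integral_dominated_convergence[where w="\<lambda>y. h y + h' y" and s=S])
      (use dct m\<kappa>[OF S'_meas] m\<kappa>[OF S_meas] in auto)
  then have S'_int: "(\<integral>y. S' y \<partial>\<kappa>) \<le> test_dist X ?d \<pi> \<pi>'"
    by (rule LIMSEQ_le_const2) (use integral_S_le in auto)
  \<comment> \<open>Back from the countable family to all test functions.\<close>
  have key: "\<bar>h y * (\<integral>x. f x \<partial>G y) - h' y * (\<integral>x. f x \<partial>G' y)\<bar> \<le> S' y"
    if y: "y \<in> Y" and f: "f \<in> test_functions X d" for f y
  proof -
    obtain \<sigma> where \<sigma>: "\<And>x. x \<in> X \<Longrightarrow> (\<lambda>k. g (\<sigma> k) x) \<longlonglongrightarrow> f x" using g(2)[OF f] by auto
    have conv: "(\<lambda>k. \<integral>x. g (\<sigma> k) x \<partial>\<mu>) \<longlonglongrightarrow> (\<integral>x. f x \<partial>\<mu>)" if \<mu>: "\<mu> \<in> prob_measures X" for \<mu>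
    proof (rule integral_dominated_convergence[where w="\<lambda>_. 1"])
      show "integrable \<mu> (\<lambda>_. 1::real)"
        using prob_space.finite_measure[OF prob_measuresD(1)[OF \<mu>]] by (simp add: finite_measure.integrable_const)
    qed (use \<sigma> g_meas measurable_borel_on_continuous[OF test_functions_continuous[OF d f]] test_functionsD(1)[OF g(1)] in
       \<open>auto simp: prob_measuresD(3)[OF \<mu>] measurable_prob_measures[OF \<mu>]\<close>)
    have "(\<lambda>k. \<bar>s (\<sigma> k) y\<bar>) \<longlonglongrightarrow> \<bar>h y * (\<integral>x. f x \<partial>G y) - h' y * (\<integral>x. f x \<partial>G' y)\<bar>"
      unfolding s_def by (intro tendsto_intros conv Gy[OF y])
    then show ?thesis by (rule LIMSEQ_le_const2) (use S'_upper[OF y] in auto)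
  qed
  have integrand_le: "\<bar>h y * v (G y) - h' y * v (G' y)\<bar> \<le> 3 * K * S' y" if y: "y \<in> Y" for y
  proof -
    note Gy' = Gy[OF y]
    have c: "(\<integral>x. 1 \<partial>G y) = (1::real)" "(\<integral>x. 1 \<partial>G' y) = (1::real)"
      using prob_space.prob_space[OF prob_measuresD(1)[OF Gy'(1)]] prob_space.prob_space[OF prob_measuresD(1)[OF Gy'(2)]]
      by auto
    have hh: "\<bar>h y - h' y\<bar> \<le> S' y"
      using key[OF y const_in_test_functions[OF d, of 1]] c by simp
    have S0: "0 \<le> S' y" using hh by linarith
    \<comment> \<open>Dividing by \<open>h y\<close> turns a bound for unnormalised posteriors into one for posteriors.\<close>
    have "h y * \<bar>v (G y) - v (G' y)\<bar> \<le> 2 * K * S' y"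
    proof (cases "h y = 0")
      case True
      then show ?thesis using K S0 by simp
    next
      case False
      then have hp: "0 < h y" using h0[of y] by simp
      have "test_dist X d (G y) (G' y) \<le> 2 * S' y / h y"
      proof (rule test_dist_least[OF d])
        fix f assume f: "f \<in> test_functions X d"
        have le1: "\<bar>\<integral>x. f x \<partial>G' y\<bar> \<le> 1"
          using test_functionsD(1)[OF f] Gy' by (auto intro!: abs_integral_le_prob_measures)
        have "h y * ((\<integral>x. f x \<partial>G y) - (\<integral>x. f x \<partial>G' y)) =
          (h y * (\<integral>x. f x \<partial>G y) - h' y * (\<integral>x. f x \<partial>G' y)) + (h' y - h y) * (\<integral>x. f x \<partial>G' y)"
          by (simp add: algebra_simps)
        also have "\<bar>\<dots>\<bar> \<le> S' y + \<bar>h' y - h y\<bar> * 1"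
          using key[OF y f] le1
          by (intro abs_triangle_ineq[THEN order_trans] add_mono) (auto simp: abs_mult mult_left_le)
        also have "\<dots> \<le> 2 * S' y" using hh by (simp add: abs_minus_commute)
        finally have "h y * \<bar>(\<integral>x. f x \<partial>G y) - (\<integral>x. f x \<partial>G' y)\<bar> \<le> 2 * S' y"
          using hp unfolding abs_mult by simp
        then show "\<bar>(\<integral>x. f x \<partial>G y) - (\<integral>x. f x \<partial>G' y)\<bar> \<le> 2 * S' y / h y"
          using hp by (simp add: pos_le_divide_eq mult.commute)
      qed
      then have "K * test_dist X d (G y) (G' y) \<le> K * (2 * S' y / h y)"
        using K by (rule mult_left_mono)
      then have "\<bar>v (G y) - v (G' y)\<bar> \<le> K * (2 * S' y / h y)"
        using tame_withD(2)[OF v Gy'] by linarith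
      then have "h y * \<bar>v (G y) - v (G' y)\<bar> \<le> h y * (K * (2 * S' y / h y))"
        using hp by (intro mult_left_mono) auto
      then show ?thesis using hp by (simp add: field_simps)
    qed
    moreover have "\<bar>(h y - h' y) * v (G' y)\<bar> \<le> S' y * K"
      unfolding abs_mult using hh tame_withD(1)[OF v Gy'(2)] S0 by (intro mult_mono) auto
    moreover have "h y * v (G y) - h' y * v (G' y) = h y * (v (G y) - v (G' y)) + (h y - h' y) * v (G' y)"
      by (simp add: algebra_simps)
    moreover have "\<bar>h y * (v (G y) - v (G' y))\<bar> = h y * \<bar>v (G y) - v (G' y)\<bar>"
      using h0[of y] by (simp add: abs_mult)
    ultimately have "\<bar>h y * v (G y) - h' y * v (G' y)\<bar> \<le> 2 * K * S' y + S' y * K" by linarith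
    then show ?thesis by (simp add: algebra_simps)
  qed
  have vI: "(\<integral>y. v (G y) \<partial>H) = (\<integral>y. h y * v (G y) \<partial>\<kappa>)" "(\<integral>y. v (G' y) \<partial>H') = (\<integral>y. h' y * v (G' y) \<partial>\<kappa>)"
    "integrable \<kappa> (\<lambda>y. h y * v (G y))" "integrable \<kappa> (\<lambda>y. h' y * v (G' y))"
    using I[OF \<pi>(3), of K] I[OF \<pi>'(3), of K] tame_withD(1)[OF v Gy(1)] tame_withD(1)[OF v Gy(2)] by auto
  have "(\<integral>y. v (G y) \<partial>H) - (\<integral>y. v (G' y) \<partial>H') = (\<integral>y. h y * v (G y) - h' y * v (G' y) \<partial>\<kappa>)"
    using vI by simp
  also have "\<bar>\<dots>\<bar> \<le> (\<integral>y. \<bar>h y * v (G y) - h' y * v (G' y)\<bar> \<partial>\<kappa>)" by (rule integral_abs_bound)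
  also have "\<dots> \<le> (\<integral>y. 3 * K * S' y \<partial>\<kappa>)"
    using vI(3,4) int_S' integrand_le sp by (intro integral_mono) auto
  also have "\<dots> = 3 * K * (\<integral>y. S' y \<partial>\<kappa>)" by simp
  also have "\<dots> \<le> 3 * K * test_dist X ?d \<pi> \<pi>'"
    using S'_int K by (intro mult_left_mono) auto
  finally show ?thesis .
qed

section \<open>Closure properties of tame functionals\<close>

definition tame :: "'a::metric_space set \<Rightarrow> ('a measure \<Rightarrow> real) \<Rightarrow> bool" where
  "tame X v \<longleftrightarrow> (\<exists>d K. modulus_on X d \<and> tame_with X d K v)"

lemma tame_measurable:
  fixes X :: "'a::{metric_space, second_countable_topology} set"
  shows "tame X v \<Longrightarrow> v \<in> borel_measurable (belief_space X)"
  unfolding tame_def using tame_with_measurable by blast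

lemma tame_bounded: "tame X v \<Longrightarrow> \<exists>K. \<forall>z\<in>prob_measures X. \<bar>v z\<bar> \<le> K"
  unfolding tame_def using tame_withD(1) by blast

lemma tame_with_add:
  assumes d: "modulus_on X d" "modulus_on X d'" and u: "tame_with X d K u" and v: "tame_with X d' K' v"
  shows "tame_with X (\<lambda>x y. d x y + d' x y) (K + K') (\<lambda>z. u z + v z)"
proof -
  let ?D = "\<lambda>x y. d x y + d' x y"
  show ?thesis
    unfolding tame_with_def
  proof (intro conjI ballI)
    fix z assume z: "z \<in> prob_measures X"
    show "\<bar>u z + v z\<bar> \<le> K + K'" using tame_withD(1)[OF u z] tame_withD(1)[OF v z] by linarith
    fix z' assume z': "z' \<in> prob_measures X"
    have "\<bar>u z - u z'\<bar> \<le> K * test_dist X ?D z z'"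
      using tame_withD(2)[OF u z z'] test_dist_mono[OF d(1) _ z z', of ?D] modulus_on_nonneg[OF d(2)]
        tame_with_nonneg[OF u z] by (fastforce intro: order_trans mult_left_mono)
    moreover have "\<bar>v z - v z'\<bar> \<le> K' * test_dist X ?D z z'"
      using tame_withD(2)[OF v z z'] test_dist_mono[OF d(2) _ z z', of ?D] modulus_on_nonneg[OF d(1)]
        tame_with_nonneg[OF v z] by (fastforce intro: order_trans mult_left_mono)
    ultimately show "\<bar>u z + v z - (u z' + v z')\<bar> \<le> (K + K') * test_dist X ?D z z'"
      unfolding distrib_right by linarith
  qed
qed

lemma tame_with_cmult:
  assumes d: "modulus_on X d" and v: "tame_with X d K v" and b: "0 \<le> b" "b \<le> 1"
  shows "tame_with X d K (\<lambda>z. b * v z)"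
proof -
  have *: "\<bar>b * t\<bar> \<le> s" if "\<bar>t\<bar> \<le> s" for s t :: real
    using mult_mono[OF b(2) that] b that by (simp add: abs_mult)
  show ?thesis
    unfolding tame_with_def right_diff_distrib[symmetric]
    using tame_withD[OF v] by (auto intro!: *)
qed

lemma measurable_integral_belief_space:
  fixes f :: "'a::topological_space \<Rightarrow> real"
  assumes "continuous_on X f" "bounded (f ` X)"
  shows "(\<lambda>z. \<integral>x. f x \<partial>z) \<in> borel_measurable (belief_space X)"
proof (rule borel_measurableI)
  fix U :: "real set" assume "open U"
  from openin_imp_sets_belief_space[OF openin_weak_topology_basic[OF assms this]]
  show "(\<lambda>z. \<integral>x. f x \<partial>z) -` U \<inter> space (belief_space X) \<in> sets (belief_space X)"
    by (simp add: vimage_def Int_def conj_commute)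
qed

text \<open>The indicator of a closed set is a decreasing limit of bounded continuous functions, so that
  evaluation at sets is measurable for the Borel \<open>\<sigma>\<close>-algebra of the weak topology.\<close>

lemma measurable_belief_space_prob_algebra:
  fixes X :: "'a::metric_space set"
  assumes X: "X \<in> sets borel"
  shows "(\<lambda>z. z) \<in> belief_space X \<rightarrow>\<^sub>M prob_algebra (borel_on X)"
proof (rule measurable_prob_algebra_generated[where \<Omega>=X and G="(\<inter>) X ` Collect closed"])
  show "sets (borel_on X) = sigma_sets X ((\<inter>) X ` Collect closed)"
    unfolding sets_restrict_space borel_eq_closed
    using sigma_sets_Int[of X UNIV "Collect closed"] X by (simp add: borel_eq_closed)
  show "Int_stable ((\<inter>) X ` Collect closed)"
    unfolding Int_stable_def
  proof safe
    fix C D :: "'a set" assume "closed C" "closed D"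
    then show "X \<inter> C \<inter> (X \<inter> D) \<in> (\<inter>) X ` Collect closed"
      by (intro image_eqI[of _ _ "C \<inter> D"]) auto
  qed
  show "prob_space z" "sets z = sets (borel_on X)" if "z \<in> space (belief_space X)" for z
    using that prob_measuresD(1,2)[of z X] by auto
  fix D assume "D \<in> (\<inter>) X ` Collect closed"
  then obtain C where C: "closed C" "D = X \<inter> C" by auto
  show "(\<lambda>z. emeasure z D) \<in> borel_measurable (belief_space X)"
  proof (cases "C = {}")
    case False
    define f where "f n x = max 0 (1 - real n * infdist x C)" for n x
    have cont: "continuous_on X (f n)" for n unfolding f_def by (intro continuous_intros)
    have f01: "0 \<le> f n x" "f n x \<le> 1" for n x by (auto simp: f_def infdist_nonneg)
    have "(\<lambda>z. measure z D) \<in> borel_measurable (belief_space X)"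
    proof (rule borel_measurable_LIMSEQ_real)
      show "(\<lambda>z. \<integral>x. f n x \<partial>z) \<in> borel_measurable (belief_space X)" for n
        using f01 by (intro measurable_integral_belief_space cont) (auto simp: bounded_iff intro!: exI[of _ 1])
      fix z assume "z \<in> space (belief_space X)"
      then have z: "z \<in> prob_measures X" by simp
      interpret prob_space z using prob_measuresD(1)[OF z] .
      have D: "D \<in> sets z" using C prob_measuresD(2)[OF z] by (auto simp: sets_restrict_space)
      have lim: "(\<lambda>n. f n x) \<longlonglongrightarrow> indicator D x" if x: "x \<in> X" for x
      proof (cases "x \<in> C")
        case True
        then show ?thesis using x C by (simp add: f_def)
      next
        case False
        then have pos: "0 < infdist x C"
          using C(1) \<open>C \<noteq> {}\<close> in_closed_iff_infdist_zero[of C x] infdist_nonneg[of x C] by linarith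
        have "\<forall>\<^sub>F n in sequentially. f n x = 0"
          using eventually_ge_at_top[of "nat \<lceil>1 / infdist x C\<rceil>"]
        proof eventually_elim
          case (elim n)
          then have "1 / infdist x C \<le> real n" by linarith
          then show ?case using pos by (simp add: f_def field_simps)
        qed
        then show ?thesis using False C by (auto intro: tendsto_eventually)
      qed
      have "(\<lambda>n. \<integral>x. f n x \<partial>z) \<longlonglongrightarrow> (\<integral>x. indicator D x \<partial>z)"
        by (rule integral_dominated_convergence[where w="\<lambda>_. 1"])
          (use D lim f01 measurable_prob_measures[OF z measurable_borel_on_continuous[OF cont]] in
            \<open>auto simp: prob_measuresD(3)[OF z]\<close>)
      then show "(\<lambda>n. \<integral>x. f n x \<partial>z) \<longlonglongrightarrow> measure z D"
        using D by (simp add: sets.Int_space_eq2)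
    qed
    then have "(\<lambda>z. ennreal (measure z D)) \<in> borel_measurable (belief_space X)" by measurable
    then show ?thesis
      by (rule measurable_cong[THEN iffD1, rotated])
        (metis prob_measuresD(1) space_belief_space finite_measure.emeasure_eq_measure prob_space.finite_measure)
  qed (simp add: C)
qed auto

text \<open>Compactness of \<open>A\<close> makes continuity in the state uniform in the action, so that one modulus
  serves all actions.\<close>

lemma modulus_on_SUP:
  fixes A :: "'b::metric_space set" and X :: "'a::metric_space set"
  assumes A: "compact A" "A \<noteq> {}"
    and b: "\<And>x y a. x \<in> X \<Longrightarrow> y \<in> X \<Longrightarrow> a \<in> A \<Longrightarrow> 0 \<le> \<phi> x y a \<and> \<phi> x y a \<le> B"
    and lim: "\<And>x y a' a. x \<in> X \<Longrightarrow> (\<And>n. y n \<in> X) \<Longrightarrow> y \<longlonglongrightarrow> x \<Longrightarrow> (\<And>n. a' n \<in> A) \<Longrightarrow> a \<in> A \<Longrightarrow>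
       a' \<longlonglongrightarrow> a \<Longrightarrow> (\<lambda>n::nat. \<phi> x (y n) (a' n)) \<longlonglongrightarrow> (0::real)"
  shows "modulus_on X (\<lambda>x y. SUP a\<in>A. \<phi> x y a)"
    and "\<And>x y a. x \<in> X \<Longrightarrow> y \<in> X \<Longrightarrow> a \<in> A \<Longrightarrow> \<phi> x y a \<le> (SUP a\<in>A. \<phi> x y a)"
proof -
  show upper: "\<phi> x y a \<le> (SUP a\<in>A. \<phi> x y a)" if "x \<in> X" "y \<in> X" "a \<in> A" for x y a
    using that b by (intro cSUP_upper bdd_aboveI2[where M=B]) auto
  obtain a0 where a0: "a0 \<in> A" using A(2) by auto
  have nonneg: "0 \<le> (SUP a\<in>A. \<phi> x y a)" if "x \<in> X" "y \<in> X" for x y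
    using upper[OF that a0] b[OF that a0] by linarith
  have "((\<lambda>y. SUP a\<in>A. \<phi> x y a) \<longlongrightarrow> 0) (at x within X)" if x: "x \<in> X" for x
  proof (rule ccontr)
    assume "\<not> ((\<lambda>y. SUP a\<in>A. \<phi> x y a) \<longlongrightarrow> 0) (at x within X)"
    then obtain y where y: "\<And>n. y n \<in> X" "y \<longlonglongrightarrow> x" "\<not> (\<lambda>n. SUP a\<in>A. \<phi> x (y n) a) \<longlonglongrightarrow> 0"
      unfolding tendsto_at_iff_sequentially by (auto simp: comp_def)
    have "\<exists>a\<in>A. (SUP a\<in>A. \<phi> x (y n) a) < \<phi> x (y n) a + 1 / real (Suc n)" for n
    proof -
      have "(SUP a\<in>A. \<phi> x (y n) a) - 1 / real (Suc n) < (SUP a\<in>A. \<phi> x (y n) a)" by simp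
      moreover have "bdd_above (\<phi> x (y n) ` A)" using b[OF x y(1)] by (intro bdd_aboveI2[where M=B]) auto
      ultimately obtain a where "a \<in> A" "(SUP a\<in>A. \<phi> x (y n) a) - 1 / real (Suc n) < \<phi> x (y n) a"
        using less_cSUP_iff[OF A(2)] by blast
      then show ?thesis by (intro bexI[of _ a]) auto
    qed
    then obtain a where a: "\<And>n. a n \<in> A" "\<And>n. (SUP a\<in>A. \<phi> x (y n) a) < \<phi> x (y n) (a n) + 1 / real (Suc n)"
      by metis
    have "(\<lambda>n. \<phi> x (y n) (a n)) \<longlonglongrightarrow> 0"
    proof (rule ccontr)
      assume "\<not> (\<lambda>n. \<phi> x (y n) (a n)) \<longlonglongrightarrow> 0"
      then obtain e where e: "e > 0" "\<exists>\<^sub>F n in sequentially. \<not> dist (\<phi> x (y n) (a n)) 0 < e"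
        unfolding tendsto_iff by (auto simp: not_eventually)
      then have "infinite {n. \<not> dist (\<phi> x (y n) (a n)) 0 < e}"
        by (simp add: frequently_cofinite cofinite_eq_sequentially[symmetric])
      then obtain \<sigma> :: "nat \<Rightarrow> nat" where \<sigma>: "strict_mono \<sigma>" "\<And>n. \<not> dist (\<phi> x (y (\<sigma> n)) (a (\<sigma> n))) 0 < e"
        using infinite_enumerate by (metis (no_types, lifting) mem_Collect_eq)
      obtain l \<rho> where l: "l \<in> A" "strict_mono (\<rho>::nat \<Rightarrow> nat)" "((a \<circ> \<sigma>) \<circ> \<rho>) \<longlonglongrightarrow> l"
        using A(1) a(1) unfolding compact_def by (metis comp_apply)
      have "(\<lambda>n. \<phi> x (y (\<sigma> (\<rho> n))) (a (\<sigma> (\<rho> n)))) \<longlonglongrightarrow> 0"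
        using l(3) LIMSEQ_subseq_LIMSEQ[OF LIMSEQ_subseq_LIMSEQ[OF y(2) \<sigma>(1)] l(2)]
        by (intro lim[OF x y(1) _ a(1) l(1)]) (auto simp: comp_def)
      then have "\<forall>\<^sub>F n in sequentially. dist (\<phi> x (y (\<sigma> (\<rho> n))) (a (\<sigma> (\<rho> n)))) 0 < e"
        using e(1) by (rule tendstoD)
      then show False using \<sigma>(2) by simp
    qed
    from tendsto_add[OF this LIMSEQ_inverse_real_of_nat]
    have "(\<lambda>n. \<phi> x (y n) (a n) + 1 / real (Suc n)) \<longlonglongrightarrow> 0" by (simp add: inverse_eq_divide)
    then have "(\<lambda>n. SUP a\<in>A. \<phi> x (y n) a) \<longlonglongrightarrow> 0"
      by (rule Lim_null_comparison[rotated])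
        (use a(2) nonneg[OF x y(1)] in \<open>auto intro!: always_eventually less_imp_le\<close>)
    with y(3) show False by simp
  qed
  with nonneg show "modulus_on X (\<lambda>x y. SUP a\<in>A. \<phi> x y a)"
    by (auto simp: modulus_on_def)
qed

lemma tame_INF_SUP:
  assumes "modulus_on X d" "I \<noteq> {}" "\<And>i. i \<in> I \<Longrightarrow> tame_with X d K (v i)"
  shows "tame X (\<lambda>z. INF i\<in>I. v i z)" "tame X (\<lambda>z. SUP i\<in>I. v i z)"
proof -
  show "tame X (\<lambda>z. INF i\<in>I. v i z)" "tame X (\<lambda>z. SUP i\<in>I. v i z)"
    unfolding tame_def using assms(1) tame_with_INF[OF assms(2), of X d K v] tame_with_SUP[OF assms(2), of X d K v] assms(3)
    by blast+
qed

section \<open>The belief transition kernel\<close>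

locale belief_mdp =
  fixes X :: "'x::polish_space set" and A :: "'a::polish_space set" and Y :: "'y::polish_space set"
    and p :: "'x \<Rightarrow> 'a \<Rightarrow> 'x measure" and r :: "'x \<Rightarrow> 'y measure"
    and c :: "'x \<Rightarrow> 'a \<Rightarrow> real" and \<beta> :: real
    and F :: "'x measure \<Rightarrow> 'a \<Rightarrow> 'y \<Rightarrow> 'x measure"
  assumes X_borel: "X \<in> sets borel"
    and \<beta>: "0 < \<beta>" "\<beta> < 1"
    and p_kernel: "(\<lambda>(x, a). p x a) \<in> borel_on X \<Otimes>\<^sub>M borel_on A \<rightarrow>\<^sub>M prob_algebra (borel_on X)"
    and r_kernel: "r \<in> borel_on X \<rightarrow>\<^sub>M prob_algebra (borel_on Y)"
    and c_cont: "continuous_on (X \<times> A) (\<lambda>(x, a). c x a)"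
    and c_bdd: "bounded ((\<lambda>(x, a). c x a) ` (X \<times> A))"
    and p_weak: "weakly_continuous_kernel X A p"
    and r_tv: "tv_continuous_kernel X r"
    and A_compact: "compact A" and A_nonempty: "A \<noteq> {}"
    and F: "is_belief_update X A Y p r F"
begin

abbreviation "Z \<equiv> belief_space X"
abbreviation "\<eta> \<equiv> belief_trans X Y p r F"
abbreviation "cost \<equiv> belief_cost c"

text \<open>The law of the next hidden state before the next observation is made.\<close>

definition predict :: "'x measure \<Rightarrow> 'a \<Rightarrow> 'x measure" where
  "predict z a = z \<bind> (\<lambda>x. p x a)"

lemma space_borel_on: "space (borel_on S) = S"
  by (simp add: space_restrict_space)

lemma p_measurable: "a \<in> A \<Longrightarrow> (\<lambda>x. p x a) \<in> borel_on X \<rightarrow>\<^sub>M prob_algebra (borel_on X)"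
  using measurable_compose[OF measurable_Pair2' p_kernel, of a] by (simp add: space_borel_on)

lemma p_prob: "x \<in> X \<Longrightarrow> a \<in> A \<Longrightarrow> p x a \<in> prob_measures X"
  using kernelD[OF p_measurable] .

lemma predict_prob:
  assumes "z \<in> prob_measures X" "a \<in> A"
  shows "predict z a \<in> prob_measures X"
  using measurable_space[OF measurable_bind_prob_space[OF measurable_ident_sets[OF refl] p_measurable[OF assms(2)]], of z] assms(1)
  by (simp add: predict_def space_prob_algebra_borel_on)

lemma integral_predict:
  fixes f :: "'x \<Rightarrow> real"
  assumes z: "z \<in> prob_measures X" and a: "a \<in> A"
    and f: "f \<in> borel_measurable (borel_on X)" "\<And>x. x \<in> X \<Longrightarrow> \<bar>f x\<bar> \<le> B"
  shows "(\<integral>x. f x \<partial>predict z a) = (\<integral>x. (\<integral>x'. f x' \<partial>p x a) \<partial>z)"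
  unfolding predict_def
proof (rule integral_bind[where K="borel_on X" and B=B and B'=1])
  show "(\<lambda>x. p x a) \<in> z \<rightarrow>\<^sub>M subprob_algebra (borel_on X)"
    by (intro measurable_prob_measures[OF z] measurable_prob_algebraD p_measurable a)
  show "finite_measure z" using prob_measuresD(1)[OF z] by (rule prob_space.finite_measure)
  show "AE x in z. emeasure (p x a) (space (p x a)) \<le> ennreal 1"
    using prob_measuresD(1)[OF p_prob[OF _ a]] prob_measuresD(3)[OF z]
    by (auto intro!: AE_I2 simp: prob_space.emeasure_space_1)
qed (use f in \<open>auto simp: space_borel_on\<close>)

lemma joint_law_eq_signal_law:
  assumes z: "z \<in> prob_measures X" and a: "a \<in> A"
  shows "joint_law X Y p r z a = signal_law X Y r (predict z a)"
proof -
  note [measurable] = r_kernel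
  have g: "(\<lambda>x. r x \<bind> (\<lambda>y. return (borel_on X \<Otimes>\<^sub>M borel_on Y) (x, y)))
     \<in> borel_on X \<rightarrow>\<^sub>M subprob_algebra (borel_on X \<Otimes>\<^sub>M borel_on Y)"
    by (rule measurable_prob_algebraD) measurable
  show ?thesis
    unfolding joint_law_def signal_law_def predict_def
    by (rule bind_assoc[OF _ g, symmetric])
      (intro measurable_prob_measures[OF z] measurable_prob_algebraD p_measurable a)
qed

lemma joint_law_measurable:
  "(\<lambda>w. joint_law X Y p r (fst w) (snd w)) \<in> Z \<Otimes>\<^sub>M borel_on A \<rightarrow>\<^sub>M prob_algebra (borel_on X \<Otimes>\<^sub>M borel_on Y)"
proof -
  note [measurable] = r_kernel
  have g: "(\<lambda>x. r x \<bind> (\<lambda>y. return (borel_on X \<Otimes>\<^sub>M borel_on Y) (x, y)))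
     \<in> borel_on X \<rightarrow>\<^sub>M prob_algebra (borel_on X \<Otimes>\<^sub>M borel_on Y)"
    by measurable
  have "(\<lambda>wx. (snd wx, snd (fst wx))) \<in> (Z \<Otimes>\<^sub>M borel_on A) \<Otimes>\<^sub>M borel_on X \<rightarrow>\<^sub>M borel_on X \<Otimes>\<^sub>M borel_on A"
    by measurable
  from measurable_compose[OF this p_kernel]
  have "(\<lambda>wx. p (snd wx) (snd (fst wx))) \<in> (Z \<Otimes>\<^sub>M borel_on A) \<Otimes>\<^sub>M borel_on X \<rightarrow>\<^sub>M prob_algebra (borel_on X)"
    by simp
  from measurable_bind_prob_space[OF this g]
  have f: "(\<lambda>(w, x). p x (snd w) \<bind> (\<lambda>x. r x \<bind> (\<lambda>y. return (borel_on X \<Otimes>\<^sub>M borel_on Y) (x, y))))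
     \<in> (Z \<Otimes>\<^sub>M borel_on A) \<Otimes>\<^sub>M borel_on X \<rightarrow>\<^sub>M prob_algebra (borel_on X \<Otimes>\<^sub>M borel_on Y)"
    by (simp add: case_prod_unfold)
  have "fst \<in> Z \<Otimes>\<^sub>M borel_on A \<rightarrow>\<^sub>M prob_algebra (borel_on X)"
    by (rule measurable_compose[OF measurable_fst measurable_belief_space_prob_algebra[OF X_borel]])
  from measurable_bind_prob_space2[OF this f] show ?thesis
    by (simp add: joint_law_def)
qed

lemma obs_law_measurable:
  "(\<lambda>w. obs_law X Y p r (fst w) (snd w)) \<in> Z \<Otimes>\<^sub>M borel_on A \<rightarrow>\<^sub>M prob_algebra (borel_on Y)"
  unfolding obs_law_def
  by (rule measurable_compose[OF joint_law_measurable measurable_distr_prob_space[OF measurable_snd]])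

lemma F_measurable: "(\<lambda>(z, a, y). F z a y) \<in> Z \<Otimes>\<^sub>M borel_on A \<Otimes>\<^sub>M borel_on Y \<rightarrow>\<^sub>M Z"
  using F by (simp add: is_belief_update_def)

lemma trans_measurable: "(\<lambda>(z, a). \<eta> z a) \<in> Z \<Otimes>\<^sub>M borel_on A \<rightarrow>\<^sub>M prob_algebra Z"
proof -
  have "(\<lambda>wy. (fst (fst wy), snd (fst wy), snd wy)) \<in> (Z \<Otimes>\<^sub>M borel_on A) \<Otimes>\<^sub>M borel_on Y \<rightarrow>\<^sub>M Z \<Otimes>\<^sub>M borel_on A \<Otimes>\<^sub>M borel_on Y"
    by measurable
  from measurable_compose[OF this F_measurable]
  have "(\<lambda>(w, y). F (fst w) (snd w) y) \<in> (Z \<Otimes>\<^sub>M borel_on A) \<Otimes>\<^sub>M borel_on Y \<rightarrow>\<^sub>M Z"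
    by (simp add: case_prod_unfold)
  from measurable_distr_prob_space2[OF obs_law_measurable this] show ?thesis
    by (simp add: belief_trans_def case_prod_unfold)
qed

lemma pair_in_space: "z \<in> prob_measures X \<Longrightarrow> a \<in> A \<Longrightarrow> (z, a) \<in> space (Z \<Otimes>\<^sub>M borel_on A)"
  by (simp add: space_pair_measure space_borel_on)

lemma obs_law_prob: "z \<in> prob_measures X \<Longrightarrow> a \<in> A \<Longrightarrow> obs_law X Y p r z a \<in> prob_measures Y"
  using measurable_space[OF obs_law_measurable pair_in_space] by (simp add: space_prob_algebra_borel_on)

lemma trans_prob: "z \<in> prob_measures X \<Longrightarrow> a \<in> A \<Longrightarrow> \<eta> z a \<in> space (prob_algebra Z)"
  using measurable_space[OF trans_measurable pair_in_space] by simp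

lemma F_measurable': "z \<in> prob_measures X \<Longrightarrow> a \<in> A \<Longrightarrow> F z a \<in> borel_on Y \<rightarrow>\<^sub>M Z"
proof -
  assume "z \<in> prob_measures X" "a \<in> A"
  then have "(\<lambda>y. (z, a, y)) \<in> borel_on Y \<rightarrow>\<^sub>M Z \<Otimes>\<^sub>M borel_on A \<Otimes>\<^sub>M borel_on Y"
    by (intro measurable_Pair measurable_const measurable_ident_sets[OF refl]) (auto simp: space_borel_on)
  from measurable_compose[OF this F_measurable] show ?thesis by simp
qed

lemma posterior:
  assumes z: "z \<in> prob_measures X" and a: "a \<in> A"
  shows "is_posterior X Y r (predict z a) (obs_law X Y p r z a) (F z a)"
  unfolding is_posterior_def joint_law_eq_signal_law[OF z a, symmetric]
proof (intro conjI ballI)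
  show "F z a \<in> borel_on Y \<rightarrow>\<^sub>M prob_algebra (borel_on X)"
    by (rule measurable_compose[OF F_measurable'[OF z a] measurable_belief_space_prob_algebra[OF X_borel]])
qed (use F z a obs_law_prob in \<open>auto simp: is_belief_update_def\<close>)

lemma integral_trans:
  fixes v :: "'x measure \<Rightarrow> real"
  assumes z: "z \<in> prob_measures X" and a: "a \<in> A" and v: "v \<in> borel_measurable Z"
  shows "(\<integral>z'. v z' \<partial>\<eta> z a) = (\<integral>y. v (F z a y) \<partial>obs_law X Y p r z a)"
  unfolding belief_trans_def
  by (rule integral_distr[OF measurable_prob_measures[OF obs_law_prob[OF z a] F_measurable'[OF z a]] v])

lemma integral_p_tendsto:
  fixes f :: "'x \<Rightarrow> real"
  assumes f: "continuous_on X f" "bounded (f ` X)"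
    and y: "\<And>n. y n \<in> X" "y \<longlonglongrightarrow> x" "x \<in> X" and a: "\<And>n. a' n \<in> A" "a' \<longlonglongrightarrow> a" "a \<in> A"
  shows "(\<lambda>n. \<integral>x. f x \<partial>p (y n) (a' n)) \<longlonglongrightarrow> (\<integral>x'. f x' \<partial>p x a)"
proof -
  have "continuous_on (X \<times> A) (\<lambda>(x, a). \<integral>x'. f x' \<partial>p x a)"
    unfolding continuous_openin_preimage_eq
  proof (intro allI impI)
    fix T :: "real set" assume "open T"
    from openin_weak_topology_basic[OF f this]
    have "openin (top_of_set (X \<times> A)) {w \<in> topspace (top_of_set (X \<times> A)).
        (\<lambda>(x, a). p x a) w \<in> {\<mu> \<in> prob_measures X. (\<integral>x. f x \<partial>\<mu>) \<in> T}}"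
      using p_weak unfolding weakly_continuous_kernel_def by (blast intro: openin_continuous_map_preimage)
    also have "{w \<in> topspace (top_of_set (X \<times> A)).
        (\<lambda>(x, a). p x a) w \<in> {\<mu> \<in> prob_measures X. (\<integral>x. f x \<partial>\<mu>) \<in> T}} = X \<times> A \<inter> (\<lambda>(x, a). \<integral>x'. f x' \<partial>p x a) -` T"
      using p_prob by auto
    finally show "openin (top_of_set (X \<times> A)) (X \<times> A \<inter> (\<lambda>(x, a). \<integral>x'. f x' \<partial>p x a) -` T)" .
  qed
  from continuous_on_tendsto_compose[OF this tendsto_Pair[OF y(2) a(2)]] y a show ?thesis by simp
qed

lemma test_dist_p_tendsto:
  assumes d: "modulus_on X d"
    and y: "\<And>n. y n \<in> X" "y \<longlonglongrightarrow> x" "x \<in> X" and a: "\<And>n. a' n \<in> A" "a' \<longlonglongrightarrow> a" "a \<in> A"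
  shows "(\<lambda>n. test_dist X d (p (y n) (a' n)) (p x a)) \<longlonglongrightarrow> 0"
  using y a by (intro test_dist_tendsto_0[OF d] p_prob always_eventually allI integral_p_tendsto)

text \<open>Test functions for \<open>d\<close>, integrated against \<open>p x a\<close>, have this modulus in \<open>x\<close>. That it is a modulus
  at all is the uniform form of weak convergence.\<close>

definition predict_modulus :: "('x \<Rightarrow> 'x \<Rightarrow> real) \<Rightarrow> 'x \<Rightarrow> 'x \<Rightarrow> real" where
  "predict_modulus d x x' = (SUP a\<in>A. test_dist X d (p x a) (p x' a))"

lemma predict_modulus:
  assumes d: "modulus_on X d"
  shows "modulus_on X (predict_modulus d)"
    and "\<And>x x' a. x \<in> X \<Longrightarrow> x' \<in> X \<Longrightarrow> a \<in> A \<Longrightarrow> test_dist X d (p x a) (p x' a) \<le> predict_modulus d x x'"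
proof -
  have b: "0 \<le> test_dist X d (p x a) (p y a) \<and> test_dist X d (p x a) (p y a) \<le> 2"
    if "x \<in> X" "y \<in> X" "a \<in> A" for x y a
    using that test_dist_nonneg[OF d] test_dist_le_2[OF d] p_prob by blast
  have lim: "(\<lambda>n. test_dist X d (p x (a' n)) (p (y n) (a' n))) \<longlonglongrightarrow> 0"
    if y: "x \<in> X" "\<And>n. y n \<in> X" "y \<longlonglongrightarrow> x" and a: "\<And>n. a' n \<in> A" "a \<in> A" "a' \<longlonglongrightarrow> a"
    for x y a a'
  proof (rule Lim_null_comparison)
    have "(\<lambda>n. test_dist X d (p x (a' n)) (p x a)) \<longlonglongrightarrow> 0"
      using y(1) a by (intro test_dist_p_tendsto[OF d]) auto
    from tendsto_add_zero[OF this test_dist_p_tendsto[OF d y(2,3,1) a(1,3,2)]]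
    show "(\<lambda>n. test_dist X d (p x (a' n)) (p x a) + test_dist X d (p (y n) (a' n)) (p x a)) \<longlonglongrightarrow> 0" .
    have "norm (test_dist X d (p x (a' n)) (p (y n) (a' n)))
      \<le> test_dist X d (p x (a' n)) (p x a) + test_dist X d (p (y n) (a' n)) (p x a)" for n
      using test_dist_triangle[OF d p_prob[OF y(1) a(1)[of n]] p_prob[OF y(1) a(2)] p_prob[OF y(2) a(1)[of n]], of n]
        b[OF y(1) y(2) a(1), of n n] by (simp add: test_dist_commute)
    then show "\<forall>\<^sub>F n in sequentially. norm (test_dist X d (p x (a' n)) (p (y n) (a' n)))
      \<le> test_dist X d (p x (a' n)) (p x a) + test_dist X d (p (y n) (a' n)) (p x a)"
      by simp
  qed
  show "modulus_on X (predict_modulus d)"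
    unfolding predict_modulus_def using modulus_on_SUP(1)[OF A_compact A_nonempty b lim] .
  show "test_dist X d (p x a) (p x' a) \<le> predict_modulus d x x'" if "x \<in> X" "x' \<in> X" "a \<in> A" for x x' a
    unfolding predict_modulus_def using that b by (intro cSUP_upper bdd_aboveI2[where M=2]) auto
qed

lemma test_dist_predict_le:
  assumes d: "modulus_on X d" and z: "z \<in> prob_measures X" "z' \<in> prob_measures X" and a: "a \<in> A"
  shows "test_dist X d (predict z a) (predict z' a) \<le> test_dist X (predict_modulus d) z z'"
proof (rule test_dist_least[OF d])
  fix f assume f: "f \<in> test_functions X d"
  have fm: "f \<in> borel_measurable (borel_on X)"
    by (rule measurable_borel_on_continuous[OF test_functions_continuous[OF d f]])
  have "(\<lambda>x. \<integral>x'. f x' \<partial>p x a) \<in> test_functions X (predict_modulus d)"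
    unfolding test_functions_def
  proof (intro CollectI conjI ballI)
    fix x assume x: "x \<in> X"
    show "\<bar>\<integral>x'. f x' \<partial>p x a\<bar> \<le> 1"
      by (rule abs_integral_le_prob_measures[OF p_prob[OF x a] test_functionsD(1)[OF f]])
    fix x' assume x': "x' \<in> X"
    show "\<bar>(\<integral>x'. f x' \<partial>p x a) - (\<integral>x. f x \<partial>p x' a)\<bar> \<le> predict_modulus d x x'"
      using test_dist_upper[OF f p_prob[OF x a] p_prob[OF x' a]] predict_modulus(2)[OF d x x' a] by linarith
  qed
  from test_dist_upper[OF this z]
  show "\<bar>(\<integral>x. f x \<partial>predict z a) - (\<integral>x. f x \<partial>predict z' a)\<bar> \<le> test_dist X (predict_modulus d) z z'"
    using integral_predict[OF _ a fm test_functionsD(1)[OF f]] z by simp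
qed

lemma tame_F_measurable:
  assumes "tame X v" "z \<in> prob_measures X" "a \<in> A"
  shows "(\<lambda>y. v (F z a y)) \<in> borel_measurable (borel_on Y)"
  by (rule measurable_compose[OF F_measurable'[OF assms(2,3)] tame_measurable[OF assms(1)]])

lemma trans_diff_le:
  assumes d: "modulus_on X d" and v: "tame_with X d K v"
    and z: "z \<in> prob_measures X" "a \<in> A" and z': "z' \<in> prob_measures X" "a' \<in> A"
  shows "\<bar>(\<integral>u. v u \<partial>\<eta> z a) - (\<integral>u. v u \<partial>\<eta> z' a')\<bar> \<le> 3 * K * test_dist X (filter_modulus d r) (predict z a) (predict z' a')"
proof -
  have t: "tame X v" using d v by (auto simp: tame_def)
  note m = tame_measurable[OF t]
  show ?thesis
    unfolding integral_trans[OF z m] integral_trans[OF z' m]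
    by (intro tame_filter[OF d r_kernel r_tv v] predict_prob posterior tame_F_measurable[OF t] z z')
qed

lemma abs_integral_trans_le:
  fixes v :: "'x measure \<Rightarrow> real"
  assumes z: "z \<in> prob_measures X" "a \<in> A" and b: "\<And>u. u \<in> prob_measures X \<Longrightarrow> \<bar>v u\<bar> \<le> K"
  shows "\<bar>\<integral>u. v u \<partial>\<eta> z a\<bar> \<le> K"
proof -
  have s: "sets (\<eta> z a) = sets Z" "prob_space (\<eta> z a)" using trans_prob[OF z] by (auto simp: space_prob_algebra)
  show ?thesis
    using b sets_eq_imp_space_eq[OF s(1)] by (intro prob_space.abs_integral_le_bound[OF s(2)]) auto
qed

lemma integrable_trans:
  fixes v :: "'x measure \<Rightarrow> real"
  assumes z: "z \<in> prob_measures X" "a \<in> A" and m: "v \<in> borel_measurable Z" and b: "\<And>u. u \<in> prob_measures X \<Longrightarrow> \<bar>v u\<bar> \<le> K"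
  shows "integrable (\<eta> z a) v"
proof -
  have s: "sets (\<eta> z a) = sets Z" "prob_space (\<eta> z a)" using trans_prob[OF z] by (auto simp: space_prob_algebra)
  interpret prob_space "\<eta> z a" by fact
  show ?thesis
    using b sets_eq_imp_space_eq[OF s(1)] m
    by (intro integrable_bounded[where B=K]) (auto simp: measurable_cong_sets[OF s(1) refl])
qed

text \<open>The counterpart of the weak Feller property: the belief transition kernel maps tame functionals
  to tame functionals, uniformly in the action. The two steps are prediction and filtering.\<close>

lemma tame_with_trans:
  assumes d: "modulus_on X d" and v: "tame_with X d K v" and a: "a \<in> A"
  shows "tame_with X (predict_modulus (filter_modulus d r)) (3 * K) (\<lambda>z. \<integral>u. v u \<partial>\<eta> z a)"
proof -
  let ?d = "filter_modulus d r"
  have d': "modulus_on X ?d" by (rule modulus_on_filter_modulus[OF d r_kernel r_tv])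
  show ?thesis
    unfolding tame_with_def
  proof (intro conjI ballI)
    fix z assume z: "z \<in> prob_measures X"
    have K: "0 \<le> K" by (rule tame_with_nonneg[OF v z])
    have "\<bar>\<integral>u. v u \<partial>\<eta> z a\<bar> \<le> K"
      by (rule abs_integral_trans_le[OF z a]) (rule tame_withD(1)[OF v])
    then show "\<bar>\<integral>u. v u \<partial>\<eta> z a\<bar> \<le> 3 * K" using K by linarith
    fix z' assume z': "z' \<in> prob_measures X"
    have "\<bar>(\<integral>u. v u \<partial>\<eta> z a) - (\<integral>u. v u \<partial>\<eta> z' a)\<bar> \<le> 3 * K * test_dist X ?d (predict z a) (predict z' a)"
      by (rule trans_diff_le[OF d v z a z' a])
    also have "\<dots> \<le> 3 * K * test_dist X (predict_modulus ?d) z z'"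
      using K by (intro mult_left_mono test_dist_predict_le[OF d' z z' a]) auto
    finally show "\<bar>(\<integral>u. v u \<partial>\<eta> z a) - (\<integral>u. v u \<partial>\<eta> z' a)\<bar> \<le> 3 * K * test_dist X (predict_modulus ?d) z z'" .
  qed
qed

text \<open>For a fixed belief, the prediction depends weakly continuously on the action by dominated
  convergence; filtering is continuous in the prediction.\<close>

lemma trans_continuous:
  assumes v: "tame X v" and z: "z \<in> prob_measures X"
  shows "continuous_on A (\<lambda>a. \<integral>u. v u \<partial>\<eta> z a)"
proof (rule continuous_on_sequentiallyI)
  fix u a assume u: "\<forall>n. u n \<in> A" and a: "a \<in> A" and ua: "u \<longlonglongrightarrow> a"
  obtain d K where d: "modulus_on X d" and v: "tame_with X d K v" using v by (auto simp: tame_def)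
  let ?d = "filter_modulus d r"
  have d': "modulus_on X ?d" by (rule modulus_on_filter_modulus[OF d r_kernel r_tv])
  have "(\<lambda>n. test_dist X ?d (predict z (u n)) (predict z a)) \<longlonglongrightarrow> 0"
  proof (rule test_dist_tendsto_0[OF d' predict_prob[OF z a]])
    show "\<forall>\<^sub>F n in sequentially. predict z (u n) \<in> prob_measures X" using u predict_prob[OF z] by simp
    fix g :: "'x \<Rightarrow> real" assume g: "continuous_on X g" "bounded (g ` X)"
    have gm: "g \<in> borel_measurable (borel_on X)" using g(1) by (rule measurable_borel_on_continuous)
    obtain B where B: "\<And>x. x \<in> X \<Longrightarrow> \<bar>g x\<bar> \<le> B" using g(2) by (auto simp: bounded_iff)
    have m: "(\<lambda>x. \<integral>x'. g x' \<partial>p x b) \<in> borel_measurable z" if "b \<in> A" for b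
      by (rule measurable_prob_measures[OF z integral_kernel_measurable[OF p_measurable[OF that] gm]])
    have "(\<lambda>n. \<integral>x. (\<integral>x'. g x' \<partial>p x (u n)) \<partial>z) \<longlonglongrightarrow> (\<integral>x. (\<integral>x'. g x' \<partial>p x a) \<partial>z)"
    proof (rule integral_dominated_convergence[where w="\<lambda>_. B"])
      show "integrable z (\<lambda>_. B)"
        using prob_space.finite_measure[OF prob_measuresD(1)[OF z]] by (simp add: finite_measure.integrable_const)
      show "AE x in z. (\<lambda>n. \<integral>x'. g x' \<partial>p x (u n)) \<longlonglongrightarrow> (\<integral>x'. g x' \<partial>p x a)"
        using u ua a prob_measuresD(3)[OF z] by (intro AE_I2 integral_p_tendsto g) auto
      show "AE x in z. norm (\<integral>x'. g x' \<partial>p x (u n)) \<le> B" for n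
        using abs_integral_le_prob_measures[OF p_prob B] u prob_measuresD(3)[OF z] by (intro AE_I2) auto
    qed (use m u a in auto)
    then show "(\<lambda>n. \<integral>x. g x \<partial>predict z (u n)) \<longlonglongrightarrow> (\<integral>x. g x \<partial>predict z a)"
      using u a by (simp add: integral_predict[OF z _ gm B])
  qed
  then have "(\<lambda>n. 3 * K * test_dist X ?d (predict z (u n)) (predict z a)) \<longlonglongrightarrow> 0"
    by (rule tendsto_mult_right_zero)
  then have "(\<lambda>n. (\<integral>t. v t \<partial>\<eta> z (u n)) - (\<integral>t. v t \<partial>\<eta> z a)) \<longlonglongrightarrow> 0"
    by (rule Lim_null_comparison[rotated]) (use trans_diff_le[OF d v z _ z a] u in auto)
  then show "(\<lambda>n. \<integral>t. v t \<partial>\<eta> z (u n)) \<longlonglongrightarrow> (\<integral>t. v t \<partial>\<eta> z a)"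
    by (simp add: LIM_zero_iff)
qed

text \<open>Being at least 1, the bound is also a Lipschitz constant of the cost with respect to the modulus
  of the cost itself, and so can serve as the constant of a tame functional.\<close>

definition cost_bound :: real where
  "cost_bound = (SOME M. 1 \<le> M \<and> (\<forall>x\<in>X. \<forall>a\<in>A. \<bar>c x a\<bar> \<le> M))"

lemma cost_bound: "1 \<le> cost_bound" "x \<in> X \<Longrightarrow> a \<in> A \<Longrightarrow> \<bar>c x a\<bar> \<le> cost_bound"
proof -
  obtain M where "\<And>x a. x \<in> X \<Longrightarrow> a \<in> A \<Longrightarrow> \<bar>c x a\<bar> \<le> M"
    using c_bdd by (auto simp: bounded_iff)
  then have "\<exists>M. 1 \<le> M \<and> (\<forall>x\<in>X. \<forall>a\<in>A. \<bar>c x a\<bar> \<le> M)"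
    by (intro exI[of _ "max 1 M"]) (auto simp: le_max_iff_disj)
  from someI_ex[OF this]
  show "1 \<le> cost_bound" "x \<in> X \<Longrightarrow> a \<in> A \<Longrightarrow> \<bar>c x a\<bar> \<le> cost_bound"
    unfolding cost_bound_def by auto
qed

lemma c_tendsto:
  assumes "\<And>n. y n \<in> X" "y \<longlonglongrightarrow> x" "x \<in> X" "\<And>n. a' n \<in> A" "a' \<longlonglongrightarrow> a" "a \<in> A"
  shows "(\<lambda>n. c (y n) (a' n)) \<longlonglongrightarrow> c x a"
  using continuous_on_tendsto_compose[OF c_cont tendsto_Pair[OF assms(2,5)]] assms by simp

definition cost_modulus :: "'x \<Rightarrow> 'x \<Rightarrow> real" where
  "cost_modulus x x' = (SUP a\<in>A. \<bar>c x a - c x' a\<bar>)"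

lemma cost_modulus:
  "modulus_on X cost_modulus"
  "\<And>x x' a. x \<in> X \<Longrightarrow> x' \<in> X \<Longrightarrow> a \<in> A \<Longrightarrow> \<bar>c x a - c x' a\<bar> \<le> cost_modulus x x'"
proof -
  have b: "0 \<le> \<bar>c x a - c y a\<bar> \<and> \<bar>c x a - c y a\<bar> \<le> 2 * cost_bound" if "x \<in> X" "y \<in> X" "a \<in> A" for x y a
    using cost_bound(2)[of x a] cost_bound(2)[of y a] that by simp
  have lim: "(\<lambda>n. \<bar>c x (a' n) - c (y n) (a' n)\<bar>) \<longlonglongrightarrow> 0"
    if y: "x \<in> X" "\<And>n. y n \<in> X" "y \<longlonglongrightarrow> x" and a: "\<And>n. a' n \<in> A" "a \<in> A" "a' \<longlonglongrightarrow> a" for x y a a'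
  proof -
    have "(\<lambda>n. c x (a' n) - c (y n) (a' n)) \<longlonglongrightarrow> c x a - c x a"
      using y a by (intro tendsto_diff c_tendsto) auto
    then show ?thesis using tendsto_rabs_zero by simp
  qed
  show "modulus_on X cost_modulus"
    unfolding cost_modulus_def using modulus_on_SUP(1)[OF A_compact A_nonempty b lim] .
  show "\<bar>c x a - c x' a\<bar> \<le> cost_modulus x x'" if "x \<in> X" "x' \<in> X" "a \<in> A" for x x' a
    unfolding cost_modulus_def using that b by (intro cSUP_upper bdd_aboveI2[where M="2 * cost_bound"]) auto
qed

lemma c_measurable: "(\<lambda>(x, a). c x a) \<in> borel_measurable (borel_on X \<Otimes>\<^sub>M borel_on A)"
proof -
  have "(\<lambda>z. z) \<in> borel_on X \<Otimes>\<^sub>M borel_on A \<rightarrow>\<^sub>M restrict_space borel (X \<times> A)"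
  proof (rule measurable_restrict_space2)
    show "(\<lambda>z. z) \<in> space (borel_on X \<Otimes>\<^sub>M borel_on A) \<rightarrow> X \<times> A"
      by (auto simp: space_pair_measure space_borel_on)
    have X: "(\<lambda>x. x) \<in> borel_on X \<rightarrow>\<^sub>M borel" and A: "(\<lambda>a. a) \<in> borel_on A \<rightarrow>\<^sub>M borel"
      by (simp_all add: measurable_restrict_space1)
    have "(\<lambda>z. (fst z, snd z)) \<in> borel_on X \<Otimes>\<^sub>M borel_on A \<rightarrow>\<^sub>M borel \<Otimes>\<^sub>M borel"
      by (rule measurable_Pair[OF measurable_compose[OF measurable_fst X] measurable_compose[OF measurable_snd A]])
    then show "(\<lambda>z. z) \<in> borel_on X \<Otimes>\<^sub>M borel_on A \<rightarrow>\<^sub>M borel" by (simp add: borel_prod)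
  qed
  from measurable_compose[OF this measurable_borel_on_continuous[OF c_cont]] show ?thesis by simp
qed

lemma c_measurable1: "a \<in> A \<Longrightarrow> (\<lambda>x. c x a) \<in> borel_measurable (borel_on X)"
  using measurable_compose[OF measurable_Pair2' c_measurable, of a] by (simp add: space_borel_on)

lemma cost_measurable: "(\<lambda>(z, a). cost z a) \<in> borel_measurable (Z \<Otimes>\<^sub>M borel_on A)"
proof -
  let ?Q = "borel_on X \<Otimes>\<^sub>M borel_on A"
  have fst: "fst \<in> Z \<Otimes>\<^sub>M borel_on A \<rightarrow>\<^sub>M prob_algebra (borel_on X)"
    by (rule measurable_compose[OF measurable_fst measurable_belief_space_prob_algebra[OF X_borel]])
  have "(\<lambda>w. distr (fst w) ?Q (\<lambda>x. (x, snd w))) \<in> Z \<Otimes>\<^sub>M borel_on A \<rightarrow>\<^sub>M prob_algebra ?Q"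
    by (rule measurable_distr_prob_space2[OF fst]) measurable
  from integral_kernel_measurable[OF this c_measurable]
  have "(\<lambda>w. \<integral>q. (\<lambda>(x, a). c x a) q \<partial>distr (fst w) ?Q (\<lambda>x. (x, snd w))) \<in> borel_measurable (Z \<Otimes>\<^sub>M borel_on A)" .
  then show ?thesis
  proof (rule measurable_cong[THEN iffD1, rotated])
    fix w assume "w \<in> space (Z \<Otimes>\<^sub>M borel_on A)"
    then have w: "fst w \<in> prob_measures X" "snd w \<in> A" by (auto simp: space_pair_measure space_borel_on)
    have "(\<lambda>x. (x, snd w)) \<in> fst w \<rightarrow>\<^sub>M ?Q"
      using w by (intro measurable_prob_measures[OF w(1)] measurable_Pair2') (simp add: space_borel_on)
    from integral_distr[OF this c_measurable]
    show "(\<integral>q. (\<lambda>(x, a). c x a) q \<partial>distr (fst w) ?Q (\<lambda>x. (x, snd w))) = (\<lambda>(z, a). cost z a) w"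
      by (simp add: belief_cost_def case_prod_unfold)
  qed
qed

lemma tame_with_cost:
  assumes a: "a \<in> A"
  shows "tame_with X cost_modulus cost_bound (\<lambda>z. cost z a)"
  unfolding tame_with_def belief_cost_def
proof (intro conjI ballI)
  fix z assume z: "z \<in> prob_measures X"
  show "\<bar>\<integral>x. c x a \<partial>z\<bar> \<le> cost_bound"
    by (rule abs_integral_le_prob_measures[OF z cost_bound(2)[OF _ a]])
  fix z' assume z': "z' \<in> prob_measures X"
  show "\<bar>(\<integral>x. c x a \<partial>z) - (\<integral>x. c x a \<partial>z')\<bar> \<le> cost_bound * test_dist X cost_modulus z z'"
  proof (rule test_dist_scaled_upper[OF cost_modulus(1) _ cost_bound(2)[OF _ a] _ z z'])
    show "0 < cost_bound" using cost_bound(1) by simp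
    fix x y assume x: "x \<in> X" "y \<in> X"
    have "\<bar>c x a - c y a\<bar> \<le> 1 * cost_modulus x y" using cost_modulus(2)[OF x a] by simp
    also have "\<dots> \<le> cost_bound * cost_modulus x y"
      using cost_bound(1) modulus_on_nonneg[OF cost_modulus(1) x] by (intro mult_right_mono)
    finally show "\<bar>c x a - c y a\<bar> \<le> cost_bound * cost_modulus x y" .
  qed
qed

lemma cost_continuous:
  assumes z: "z \<in> prob_measures X"
  shows "continuous_on A (cost z)"
proof (rule continuous_on_sequentiallyI)
  fix u a assume u: "\<forall>n. u n \<in> A" and a: "a \<in> A" and ua: "u \<longlonglongrightarrow> a"
  show "(\<lambda>n. cost z (u n)) \<longlonglongrightarrow> cost z a"
    unfolding belief_cost_def
  proof (rule integral_dominated_convergence[where w="\<lambda>_. cost_bound"])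
    show "integrable z (\<lambda>_. cost_bound)"
      using prob_space.finite_measure[OF prob_measuresD(1)[OF z]] by (simp add: finite_measure.integrable_const)
    show "AE x in z. (\<lambda>n. c x (u n)) \<longlonglongrightarrow> c x a"
      using u ua a prob_measuresD(3)[OF z] by (intro AE_I2 c_tendsto) auto
    show "AE x in z. norm (c x (u n)) \<le> cost_bound" for n
      using cost_bound(2) u prob_measuresD(3)[OF z] by (intro AE_I2) auto
  qed (use u a in \<open>auto intro!: measurable_prob_measures[OF z c_measurable1]\<close>)
qed

text \<open>The value of playing \<open>a\<close> once and receiving the terminal cost \<open>v\<close> afterwards.\<close>

definition Q :: "('x measure \<Rightarrow> real) \<Rightarrow> 'x measure \<Rightarrow> 'a \<Rightarrow> real" where
  "Q v z a = cost z a + \<beta> * (\<integral>z'. v z' \<partial>\<eta> z a)"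

lemma tame_with_Q:
  assumes "tame X v"
  obtains d K where "modulus_on X d" "\<And>a. a \<in> A \<Longrightarrow> tame_with X d K (\<lambda>z. Q v z a)"
proof -
  obtain d K where d: "modulus_on X d" and v: "tame_with X d K v" using assms by (auto simp: tame_def)
  let ?d = "predict_modulus (filter_modulus d r)"
  have d': "modulus_on X ?d"
    by (intro predict_modulus modulus_on_filter_modulus[OF d r_kernel r_tv])
  have "tame_with X (\<lambda>x y. cost_modulus x y + ?d x y) (cost_bound + 3 * K) (\<lambda>z. Q v z a)" if "a \<in> A" for a
    unfolding Q_def using \<beta>
    by (intro tame_with_add cost_modulus d' tame_with_cost tame_with_cmult tame_with_trans d v that) auto
  with modulus_on_add[OF cost_modulus(1) d'] that show thesis by blast
qed

lemma Q_continuous: "tame X v \<Longrightarrow> z \<in> prob_measures X \<Longrightarrow> continuous_on A (Q v z)"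
  unfolding Q_def by (intro continuous_intros cost_continuous trans_continuous)

end

section \<open>Discounted Markov decision processes\<close>

lemma discounted_telescope:
  fixes x \<gamma> :: "nat \<Rightarrow> real"
  assumes \<beta>: "0 < \<beta>" "\<beta> < 1" and x: "\<And>t. \<bar>x t\<bar> \<le> K" and \<gamma>: "\<And>t. \<bar>\<gamma> t\<bar> \<le> M"
    and step: "\<And>t. x t - \<beta> * x (Suc t) \<le> \<gamma> t"
  shows "x 0 \<le> (\<Sum>t. \<beta> ^ t * \<gamma> t)"
proof -
  have "(\<lambda>t. \<beta> ^ t * x t) \<longlonglongrightarrow> 0"
  proof (rule Lim_null_comparison)
    show "\<forall>\<^sub>F t in sequentially. norm (\<beta> ^ t * x t) \<le> \<beta> ^ t * K"
      using \<beta> x by (simp add: abs_mult)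
    show "(\<lambda>t. \<beta> ^ t * K) \<longlonglongrightarrow> 0"
      using \<beta> by (intro tendsto_mult_left_zero LIMSEQ_power_zero) auto
  qed
  from telescope_sums'[OF this] have s: "(\<lambda>t. \<beta> ^ t * x t - \<beta> ^ Suc t * x (Suc t)) sums x 0" by simp
  have "summable (\<lambda>t. \<beta> ^ t * \<gamma> t)"
  proof (rule summable_comparison_test')
    show "summable (\<lambda>t. \<beta> ^ t * M)" using \<beta> by (intro summable_mult2 summable_geometric) auto
    show "norm (\<beta> ^ t * \<gamma> t) \<le> \<beta> ^ t * M" if "0 \<le> t" for t using \<beta> \<gamma> by (simp add: abs_mult)
  qed
  moreover have "\<beta> ^ t * x t - \<beta> ^ Suc t * x (Suc t) \<le> \<beta> ^ t * \<gamma> t" for t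
    using mult_left_mono[OF step[of t], of "\<beta> ^ t"] \<beta> by (simp add: algebra_simps)
  ultimately show ?thesis
    using suminf_le[of "\<lambda>t. \<beta> ^ t * x t - \<beta> ^ Suc t * x (Suc t)"] s by (auto simp: sums_iff)
qed

lemma summable_discounted:
  fixes x :: "nat \<Rightarrow> real"
  assumes \<beta>: "0 < \<beta>" "\<beta> < 1" and x: "\<And>t. \<bar>x t\<bar> \<le> K"
  shows "summable (\<lambda>t. \<beta> ^ t * x t)"
proof (rule summable_comparison_test')
  show "summable (\<lambda>t. \<beta> ^ t * K)" using \<beta> by (intro summable_mult2 summable_geometric) auto
  show "norm (\<beta> ^ t * x t) \<le> \<beta> ^ t * K" if "0 \<le> t" for t using \<beta> x by (simp add: abs_mult)
qed

locale discounted_mdp =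
  fixes Z :: "'s measure" and B :: "'b measure" and \<eta> :: "'s \<Rightarrow> 'b \<Rightarrow> 's measure"
    and c :: "'s \<Rightarrow> 'b \<Rightarrow> real" and \<beta> M :: real
  assumes \<beta>: "0 < \<beta>" "\<beta> < 1"
    and trans: "(\<lambda>(z, a). \<eta> z a) \<in> Z \<Otimes>\<^sub>M B \<rightarrow>\<^sub>M prob_algebra Z"
    and cost: "(\<lambda>(z, a). c z a) \<in> borel_measurable (Z \<Otimes>\<^sub>M B)"
    and cost_le: "\<And>z a. z \<in> space Z \<Longrightarrow> a \<in> space B \<Longrightarrow> \<bar>c z a\<bar> \<le> M"
    and actions: "space B \<noteq> {}"
begin

lemma suminf_discounted_const: "(\<Sum>t. \<beta> ^ t * \<epsilon>) = \<epsilon> / (1 - \<beta>)" for \<epsilon> :: real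
  using \<beta> by (subst suminf_mult2[symmetric]) (auto simp: suminf_geometric summable_geometric)

abbreviation policy_value :: "('s, 'b) policy \<Rightarrow> 's \<Rightarrow> real" where
  "policy_value \<phi> z \<equiv> \<integral>\<omega>. (\<Sum>t. \<beta> ^ t * c (fst (\<omega> t)) (snd (\<omega> t))) \<partial>mdp_law Z B \<eta> \<phi> z"

context
  fixes \<phi> z
  assumes \<phi>: "\<phi> \<in> policies Z B" and z: "z \<in> space Z"
begin

interpretation IT: Ionescu_Tulcea "mdp_step Z B \<eta> \<phi> z" "\<lambda>_. Z \<Otimes>\<^sub>M B"
  by (rule Ionescu_Tulcea_mdp_step[OF \<phi> z trans])

abbreviation "law \<equiv> mdp_law Z B \<eta> \<phi> z"

lemma law_eq: "law = IT.PF.lim"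
  by (simp add: mdp_law_def)

lemma sets_law: "sets law = sets (\<Pi>\<^sub>M i\<in>UNIV. Z \<Otimes>\<^sub>M B)"
  by (simp add: law_eq)

lemma law_prefix: "distr law (\<Pi>\<^sub>M i\<in>{0..<t}. Z \<Otimes>\<^sub>M B) (\<lambda>\<omega>. restrict \<omega> {0..<t}) = IT.C 0 t (\<lambda>_. undefined)"
proof -
  have "IT.up_to {0..<t} = t"
  proof (rule antisym)
    show "IT.up_to {0..<t} \<le> t" by (simp add: IT.up_to_iff_Ico)
    show "t \<le> IT.up_to {0..<t}" using IT.up_to_less[of "{0..<t}" "t - 1"] by (cases t) auto
  qed
  then have "IT.CI {0..<t} = IT.C 0 t (\<lambda>_. undefined)"
    unfolding IT.CI_def using IT.distr_C[of t t "\<lambda>_. undefined" 0] by simp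
  then show ?thesis unfolding law_eq by (simp add: IT.distr_lim)
qed

lemma prob_space_law: "prob_space law"
proof (rule prob_space_distrD)
  show "(\<lambda>\<omega>. restrict \<omega> {0..<0}) \<in> law \<rightarrow>\<^sub>M (\<Pi>\<^sub>M i\<in>{0..<0}. Z \<Otimes>\<^sub>M B)"
    unfolding measurable_cong_sets[OF sets_law refl] by (rule measurable_restrict_subset) auto
  show "prob_space (distr law (\<Pi>\<^sub>M i\<in>{0..<0}. Z \<Otimes>\<^sub>M B) (\<lambda>\<omega>. restrict \<omega> {0..<0}))"
    unfolding law_prefix by (rule IT.prob_space_C) simp
qed

lemma coordinate_measurable: "(\<lambda>\<omega>. \<omega> t) \<in> law \<rightarrow>\<^sub>M Z \<Otimes>\<^sub>M B"
  unfolding measurable_cong_sets[OF sets_law refl] by (rule measurable_component_singleton) simp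

lemma space_law: "\<omega> \<in> space law \<Longrightarrow> \<omega> t \<in> space (Z \<Otimes>\<^sub>M B)"
  using measurable_space[OF coordinate_measurable] .

lemma prefix_measurable: "(\<lambda>\<omega>. restrict \<omega> {0..<t}) \<in> law \<rightarrow>\<^sub>M (\<Pi>\<^sub>M i\<in>{0..<t}. Z \<Otimes>\<^sub>M B)"
  unfolding measurable_cong_sets[OF sets_law refl] by (rule measurable_restrict_subset) auto

lemma expectation_step:
  fixes f :: "'s \<times> 'b \<Rightarrow> real"
  assumes f: "f \<in> borel_measurable (Z \<Otimes>\<^sub>M B)" and K: "\<And>w. w \<in> space (Z \<Otimes>\<^sub>M B) \<Longrightarrow> \<bar>f w\<bar> \<le> K"
  shows "(\<integral>\<omega>. f (\<omega> t) \<partial>law) = (\<integral>\<omega>. (\<integral>w. f w \<partial>mdp_step Z B \<eta> \<phi> z t (restrict \<omega> {0..<t})) \<partial>law)"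
proof -
  let ?P = "mdp_step Z B \<eta> \<phi> z t" and ?M = "\<lambda>t. \<Pi>\<^sub>M i\<in>{0..<t}. Z \<Otimes>\<^sub>M B"
  have comp: "(\<lambda>\<omega>. f (\<omega> t)) \<in> borel_measurable (?M (Suc t))"
  proof -
    have "(\<lambda>\<omega>. \<omega> t) \<in> ?M (Suc t) \<rightarrow>\<^sub>M Z \<Otimes>\<^sub>M B" by (rule measurable_component_singleton) simp
    from measurable_compose[OF this f] show ?thesis .
  qed
  have P: "(\<lambda>\<omega>. \<integral>w. f w \<partial>?P \<omega>) \<in> borel_measurable (?M t)"
    by (rule measurable_compose[OF IT.P integral_measurable_subprob_algebra[OF f]])
  interpret C: prob_space "IT.C 0 t (\<lambda>_. undefined)" by (rule IT.prob_space_C) simp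
  have sC: "sets (IT.C 0 t (\<lambda>_. undefined)) = sets (?M t)" using IT.sets_C[of "\<lambda>_. undefined" 0 t] by simp
  have spC: "space (IT.C 0 t (\<lambda>_. undefined)) = space (?M t)" using sC by (rule sets_eq_imp_space_eq)
  have "(\<integral>\<omega>. f (\<omega> t) \<partial>law) = (\<integral>\<omega>. f (restrict \<omega> {0..<Suc t} t) \<partial>law)" by simp
  also have "\<dots> = (\<integral>\<omega>. f (\<omega> t) \<partial>IT.C 0 (Suc t) (\<lambda>_. undefined))"
    unfolding law_prefix[symmetric] using integral_distr[OF prefix_measurable[of "Suc t"] comp] by simp
  also have "\<dots> = (\<integral>\<omega>. (\<integral>\<omega>'. f (\<omega>' t) \<partial>IT.eP t \<omega>) \<partial>IT.C 0 t (\<lambda>_. undefined))"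
    unfolding IT.C.simps(2) add_0
  proof (rule integral_bind[where K="?M (Suc t)" and B=K and B'=1])
    show "IT.eP t \<in> IT.C 0 t (\<lambda>_. undefined) \<rightarrow>\<^sub>M subprob_algebra (?M (Suc t))"
      using IT.measurable_eP by (simp add: measurable_cong_sets[OF sC refl])
    show "AE x in IT.C 0 t (\<lambda>_. undefined). emeasure (IT.eP t x) (space (IT.eP t x)) \<le> ennreal 1"
      by (intro AE_I2) (simp add: spC prob_space.emeasure_space_1[OF IT.prob_space_eP])
    show "\<bar>f (\<omega> t)\<bar> \<le> K" if "\<omega> \<in> space (?M (Suc t))" for \<omega>
      using that by (intro K) (auto simp: space_PiM)
  qed (use comp C.finite_measure_axioms in auto)
  also have "\<dots> = (\<integral>\<omega>. (\<integral>w. f w \<partial>?P \<omega>) \<partial>IT.C 0 t (\<lambda>_. undefined))"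
  proof (rule Bochner_Integration.integral_cong[OF refl])
    fix \<omega> assume "\<omega> \<in> space (IT.C 0 t (\<lambda>_. undefined))"
    then have \<omega>: "\<omega> \<in> space (?M t)" by (simp add: spC)
    have "fun_upd \<omega> t \<in> ?P \<omega> \<rightarrow>\<^sub>M ?M (Suc t)"
      unfolding measurable_cong_sets[OF IT.sets_P[OF \<omega>] refl]
      using \<omega> by (intro measurable_fun_upd[where J="{0..<t}"]) auto
    from integral_distr[OF this comp] show "(\<integral>\<omega>'. f (\<omega>' t) \<partial>IT.eP t \<omega>) = (\<integral>w. f w \<partial>?P \<omega>)"
      by (simp add: IT.eP_def)
  qed
  also have "\<dots> = (\<integral>\<omega>. (\<integral>w. f w \<partial>?P (restrict \<omega> {0..<t})) \<partial>law)"
    unfolding law_prefix[symmetric] by (rule integral_distr[OF prefix_measurable P])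
  finally show ?thesis .
qed

lemma step_kernel:
  assumes \<omega>: "\<omega> \<in> space (\<Pi>\<^sub>M i\<in>{0..<t}. Z \<Otimes>\<^sub>M B)"
  shows "(case t of 0 \<Rightarrow> return Z z | Suc s \<Rightarrow> \<eta> (fst (\<omega> s)) (snd (\<omega> s))) \<in> space (prob_algebra Z)" (is "?\<kappa> \<in> _")
    and "space (case t of 0 \<Rightarrow> return Z z | Suc s \<Rightarrow> \<eta> (fst (\<omega> s)) (snd (\<omega> s))) = space Z"
proof -
  show *: "?\<kappa> \<in> space (prob_algebra Z)"
  proof (cases t)
    case 0
    then show ?thesis using z by (simp add: space_prob_algebra prob_space_return)
  next
    case (Suc s)
    then have "\<omega> s \<in> space (Z \<Otimes>\<^sub>M B)" using \<omega> by (auto simp: space_PiM)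
    from measurable_space[OF trans this] Suc show ?thesis by (simp add: case_prod_unfold)
  qed
  then have "sets ?\<kappa> = sets Z" by (simp add: space_prob_algebra)
  then show "space ?\<kappa> = space Z" by (rule sets_eq_imp_space_eq)
qed

lemma integral_mdp_step:
  fixes f :: "'s \<times> 'b \<Rightarrow> real"
  assumes f: "f \<in> borel_measurable (Z \<Otimes>\<^sub>M B)" and K: "\<And>w. w \<in> space (Z \<Otimes>\<^sub>M B) \<Longrightarrow> \<bar>f w\<bar> \<le> K"
    and \<omega>: "\<omega> \<in> space (\<Pi>\<^sub>M i\<in>{0..<t}. Z \<Otimes>\<^sub>M B)"
  shows "(\<integral>w. f w \<partial>mdp_step Z B \<eta> \<phi> z t \<omega>) =
    (\<integral>z'. (\<integral>a. f (z', a) \<partial>\<phi> t (\<omega>, z')) \<partial>(case t of 0 \<Rightarrow> return Z z | Suc s \<Rightarrow> \<eta> (fst (\<omega> s)) (snd (\<omega> s))))"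
  unfolding mdp_step_def
proof (rule integral_bind_return_Pair[where T="\<lambda>w. w", OF _ _ measurable_ident_sets[OF refl] f K])
  show "(case t of 0 \<Rightarrow> return Z z | Suc s \<Rightarrow> \<eta> (fst (\<omega> s)) (snd (\<omega> s))) \<in> space (prob_algebra Z)"
    by (rule step_kernel(1)[OF \<omega>])
  have "\<phi> t \<in> (\<Pi>\<^sub>M i\<in>{0..<t}. Z \<Otimes>\<^sub>M B) \<Otimes>\<^sub>M Z \<rightarrow>\<^sub>M prob_algebra B"
    using \<phi> by (auto simp: policies_def)
  from measurable_compose[OF measurable_Pair1'[OF \<omega>] this]
  show "(\<lambda>z'. \<phi> t (\<omega>, z')) \<in> Z \<rightarrow>\<^sub>M prob_algebra B" .
qed

lemma prefix_space: "\<omega> \<in> space law \<Longrightarrow> restrict \<omega> {0..<t} \<in> space (\<Pi>\<^sub>M i\<in>{0..<t}. Z \<Otimes>\<^sub>M B)"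
  using measurable_space[OF prefix_measurable] .

lemma integral_state_step:
  fixes u :: "'s \<Rightarrow> real"
  assumes u: "u \<in> borel_measurable Z" "\<And>z. z \<in> space Z \<Longrightarrow> \<bar>u z\<bar> \<le> K"
    and \<omega>: "\<omega> \<in> space (\<Pi>\<^sub>M i\<in>{0..<t}. Z \<Otimes>\<^sub>M B)"
  shows "(\<integral>w. u (fst w) \<partial>mdp_step Z B \<eta> \<phi> z t \<omega>) =
    (\<integral>z'. u z' \<partial>(case t of 0 \<Rightarrow> return Z z | Suc s \<Rightarrow> \<eta> (fst (\<omega> s)) (snd (\<omega> s))))" (is "_ = (\<integral>z'. _ \<partial>?\<kappa>)")
proof -
  have "(\<integral>w. u (fst w) \<partial>mdp_step Z B \<eta> \<phi> z t \<omega>) = (\<integral>z'. (\<integral>a. u (fst (z', a)) \<partial>\<phi> t (\<omega>, z')) \<partial>?\<kappa>)"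
    using u(2) by (intro integral_mdp_step[OF measurable_compose[OF measurable_fst u(1)] _ \<omega>, where K=K])
      (auto simp: space_pair_measure)
  also have "\<dots> = (\<integral>z'. u z' \<partial>?\<kappa>)"
  proof (rule Bochner_Integration.integral_cong[OF refl])
    fix z' assume z': "z' \<in> space ?\<kappa>"
    with \<omega> step_kernel(2)[OF \<omega>] have "(\<omega>, z') \<in> space ((\<Pi>\<^sub>M i\<in>{0..<t}. Z \<Otimes>\<^sub>M B) \<Otimes>\<^sub>M Z)" by (simp add: space_pair_measure)
    note \<omega>z = this
    have "\<phi> t \<in> (\<Pi>\<^sub>M i\<in>{0..<t}. Z \<Otimes>\<^sub>M B) \<Otimes>\<^sub>M Z \<rightarrow>\<^sub>M prob_algebra B"
      using \<phi> by (auto simp: policies_def)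
    from measurable_space[OF this \<omega>z] have "prob_space (\<phi> t (\<omega>, z'))"
      by (simp add: space_prob_algebra)
    then show "(\<integral>a. u (fst (z', a)) \<partial>\<phi> t (\<omega>, z')) = u z'"
      by (simp add: prob_space.prob_space)
  qed
  finally show ?thesis .
qed

lemma state_function:
  fixes u :: "'s \<Rightarrow> real"
  assumes u: "u \<in> borel_measurable Z" "\<And>z. z \<in> space Z \<Longrightarrow> \<bar>u z\<bar> \<le> K"
  shows "(\<lambda>w. u (fst w)) \<in> borel_measurable (Z \<Otimes>\<^sub>M B)" "\<And>w. w \<in> space (Z \<Otimes>\<^sub>M B) \<Longrightarrow> \<bar>u (fst w)\<bar> \<le> K"
  using measurable_compose[OF measurable_fst u(1)] u(2) by (auto simp: space_pair_measure)

lemma expectation_initial: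
  fixes u :: "'s \<Rightarrow> real"
  assumes u: "u \<in> borel_measurable Z" "\<And>z. z \<in> space Z \<Longrightarrow> \<bar>u z\<bar> \<le> K"
  shows "(\<integral>\<omega>. u (fst (\<omega> 0)) \<partial>law) = u z"
proof -
  have "(\<integral>\<omega>. u (fst (\<omega> 0)) \<partial>law) = (\<integral>\<omega>. (\<integral>w. u (fst w) \<partial>mdp_step Z B \<eta> \<phi> z 0 (restrict \<omega> {0..<0})) \<partial>law)"
    by (rule expectation_step[OF state_function[OF u]])
  also have "\<dots> = (\<integral>\<omega>. u z \<partial>law)"
    by (intro Bochner_Integration.integral_cong refl)
      (simp only: integral_state_step[OF u prefix_space] nat.case integral_return[OF z u(1)])
  finally show ?thesis using prob_space.prob_space[OF prob_space_law] by simp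
qed

lemma expectation_Suc:
  fixes u :: "'s \<Rightarrow> real"
  assumes u: "u \<in> borel_measurable Z" "\<And>z. z \<in> space Z \<Longrightarrow> \<bar>u z\<bar> \<le> K"
  shows "(\<integral>\<omega>. u (fst (\<omega> (Suc t))) \<partial>law) = (\<integral>\<omega>. (\<integral>z'. u z' \<partial>\<eta> (fst (\<omega> t)) (snd (\<omega> t))) \<partial>law)"
proof -
  have "(\<integral>\<omega>. u (fst (\<omega> (Suc t))) \<partial>law)
      = (\<integral>\<omega>. (\<integral>w. u (fst w) \<partial>mdp_step Z B \<eta> \<phi> z (Suc t) (restrict \<omega> {0..<Suc t})) \<partial>law)"
    by (rule expectation_step[OF state_function[OF u]])
  also have "\<dots> = (\<integral>\<omega>. (\<integral>z'. u z' \<partial>\<eta> (fst (\<omega> t)) (snd (\<omega> t))) \<partial>law)"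
    by (intro Bochner_Integration.integral_cong refl)
      (simp only: integral_state_step[OF u prefix_space] nat.case, simp)
  finally show ?thesis .
qed

lemma expectation_stationary:
  fixes g :: "'s \<times> 'b \<Rightarrow> real"
  assumes g: "g \<in> borel_measurable (Z \<Otimes>\<^sub>M B)" "\<And>w. w \<in> space (Z \<Otimes>\<^sub>M B) \<Longrightarrow> \<bar>g w\<bar> \<le> K"
    and f: "f \<in> Z \<rightarrow>\<^sub>M B" and \<phi>_eq: "\<And>t \<omega> z. \<phi> t (\<omega>, z) = return B (f z)"
  shows "(\<integral>\<omega>. g (\<omega> t) \<partial>law) = (\<integral>\<omega>. g (fst (\<omega> t), f (fst (\<omega> t))) \<partial>law)"
proof -
  let ?g = "\<lambda>w. g (fst w, f (fst w))"
  have fw: "(fst w, f (fst w)) \<in> space (Z \<Otimes>\<^sub>M B)" if "w \<in> space (Z \<Otimes>\<^sub>M B)" for w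
    using that measurable_space[OF f] by (auto simp: space_pair_measure)
  have m: "(\<lambda>w. (fst w, f (fst w))) \<in> Z \<Otimes>\<^sub>M B \<rightarrow>\<^sub>M Z \<Otimes>\<^sub>M B"
    using f by measurable
  have g': "?g \<in> borel_measurable (Z \<Otimes>\<^sub>M B)" "\<And>w. w \<in> space (Z \<Otimes>\<^sub>M B) \<Longrightarrow> \<bar>?g w\<bar> \<le> K"
    using measurable_compose[OF m g(1)] g(2)[OF fw] by auto
  have eq: "(\<integral>w. g w \<partial>mdp_step Z B \<eta> \<phi> z t \<omega>) = (\<integral>w. ?g w \<partial>mdp_step Z B \<eta> \<phi> z t \<omega>)"
    if \<omega>: "\<omega> \<in> space (\<Pi>\<^sub>M i\<in>{0..<t}. Z \<Otimes>\<^sub>M B)" for \<omega>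
  proof -
    let ?\<kappa> = "case t of 0 \<Rightarrow> return Z z | Suc s \<Rightarrow> \<eta> (fst (\<omega> s)) (snd (\<omega> s))"
    have "(\<integral>a. g (z', a) \<partial>\<phi> t (\<omega>, z')) = (\<integral>a. ?g (z', a) \<partial>\<phi> t (\<omega>, z'))" if z': "z' \<in> space ?\<kappa>" for z'
    proof -
      have "z' \<in> space Z" using z' by (simp only: step_kernel(2)[OF \<omega>])
      then show ?thesis
        using measurable_space[OF f] measurable_compose[OF measurable_Pair1' g(1)]
          prob_space.prob_space[OF prob_space_return, of "f z'" B]
        by (simp add: integral_return \<phi>_eq)
    qed
    then have "(\<integral>z'. (\<integral>a. g (z', a) \<partial>\<phi> t (\<omega>, z')) \<partial>?\<kappa>) = (\<integral>z'. (\<integral>a. ?g (z', a) \<partial>\<phi> t (\<omega>, z')) \<partial>?\<kappa>)"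
      by (rule Bochner_Integration.integral_cong[OF refl])
    with integral_mdp_step[OF g \<omega>] integral_mdp_step[OF g' \<omega>] show ?thesis by simp
  qed
  then have "(\<integral>\<omega>. (\<integral>w. g w \<partial>mdp_step Z B \<eta> \<phi> z t (restrict \<omega> {0..<t})) \<partial>law)
      = (\<integral>\<omega>. (\<integral>w. ?g w \<partial>mdp_step Z B \<eta> \<phi> z t (restrict \<omega> {0..<t})) \<partial>law)"
    by (intro Bochner_Integration.integral_cong[OF refl] eq prefix_space)
  with expectation_step[OF g, of t] expectation_step[OF g', of t] show ?thesis by simp
qed

lemma integrable_law:
  fixes f :: "'s \<times> 'b \<Rightarrow> real"
  assumes f: "f \<in> borel_measurable (Z \<Otimes>\<^sub>M B)" and K: "\<And>w. w \<in> space (Z \<Otimes>\<^sub>M B) \<Longrightarrow> \<bar>f w\<bar> \<le> K"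
  shows "integrable law (\<lambda>\<omega>. f (\<omega> t))"
proof -
  interpret prob_space law by (rule prob_space_law)
  show ?thesis
    by (rule integrable_bounded[where B=K])
      (use measurable_compose[OF coordinate_measurable f] K space_law in auto)
qed

lemma abs_expectation_le:
  fixes f :: "'s \<times> 'b \<Rightarrow> real"
  assumes K: "\<And>w. w \<in> space (Z \<Otimes>\<^sub>M B) \<Longrightarrow> \<bar>f w\<bar> \<le> K"
  shows "\<bar>\<integral>\<omega>. f (\<omega> t) \<partial>law\<bar> \<le> K"
  by (rule prob_space.abs_integral_le_bound[OF prob_space_law]) (use K space_law in auto)

lemma cost_function:
  "(\<lambda>w. c (fst w) (snd w)) \<in> borel_measurable (Z \<Otimes>\<^sub>M B)"
  "\<And>w. w \<in> space (Z \<Otimes>\<^sub>M B) \<Longrightarrow> \<bar>c (fst w) (snd w)\<bar> \<le> M"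
  using cost cost_le by (auto simp: case_prod_unfold space_pair_measure)

lemma value_eq_suminf: "policy_value \<phi> z = (\<Sum>t. \<beta> ^ t * (\<integral>\<omega>. c (fst (\<omega> t)) (snd (\<omega> t)) \<partial>law))"
proof -
  note c = cost_function(2)
  note i = integrable_law[OF cost_function]
  have "(\<lambda>t. \<integral>\<omega>. \<beta> ^ t * c (fst (\<omega> t)) (snd (\<omega> t)) \<partial>law) sums policy_value \<phi> z"
  proof (rule sums_integral)
    show "integrable law (\<lambda>\<omega>. \<beta> ^ t * c (fst (\<omega> t)) (snd (\<omega> t)))" for t
      by (intro integrable_mult_right i)
    show "AE \<omega> in law. summable (\<lambda>t. norm (\<beta> ^ t * c (fst (\<omega> t)) (snd (\<omega> t))))"
    proof (rule AE_I2)
      fix \<omega> assume "\<omega> \<in> space law"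
      then have "\<bar>\<bar>c (fst (\<omega> t)) (snd (\<omega> t))\<bar>\<bar> \<le> M" for t using c[OF space_law] by simp
      from summable_discounted[OF \<beta> this] \<beta>
      show "summable (\<lambda>t. norm (\<beta> ^ t * c (fst (\<omega> t)) (snd (\<omega> t))))" by (simp add: abs_mult)
    qed
    have "\<bar>\<integral>\<omega>. \<bar>c (fst (\<omega> t)) (snd (\<omega> t))\<bar> \<partial>law\<bar> \<le> M" for t
      using c by (intro abs_expectation_le[where f="\<lambda>w. \<bar>c (fst w) (snd w)\<bar>"]) simp
    from summable_discounted[OF \<beta> this] \<beta>
    show "summable (\<lambda>t. \<integral>\<omega>. norm (\<beta> ^ t * c (fst (\<omega> t)) (snd (\<omega> t))) \<partial>law)" by (simp add: abs_mult)
  qed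
  then show ?thesis by (simp add: sums_iff)
qed

lemma trans_integral_measurable:
  fixes u :: "'s \<Rightarrow> real"
  assumes u: "u \<in> borel_measurable Z"
  shows "(\<lambda>w. \<integral>z'. u z' \<partial>\<eta> (fst w) (snd w)) \<in> borel_measurable (Z \<Otimes>\<^sub>M B)"
  using measurable_compose[OF measurable_prob_algebraD[OF trans] integral_measurable_subprob_algebra[OF u]]
  by (simp add: case_prod_unfold)

lemma trans_integral_le:
  fixes u :: "'s \<Rightarrow> real"
  assumes u: "\<And>z. z \<in> space Z \<Longrightarrow> \<bar>u z\<bar> \<le> K" and w: "w \<in> space (Z \<Otimes>\<^sub>M B)"
  shows "\<bar>\<integral>z'. u z' \<partial>\<eta> (fst w) (snd w)\<bar> \<le> K"
proof -
  have "prob_space (\<eta> (fst w) (snd w))" "space (\<eta> (fst w) (snd w)) = space Z"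
    using measurable_space[OF trans w]
    by (auto simp: case_prod_unfold space_prob_algebra dest: sets_eq_imp_space_eq)
  then show ?thesis using u by (intro prob_space.abs_integral_le_bound) auto
qed

text \<open>The terms \<open>\<beta> ^ t * (E u (z_t) - \<beta> * E u (z_(t+1)))\<close> sum to \<open>u z\<close>, so that a bound for them by
  the expected cost at each time bounds the total cost. The sign \<open>s\<close> covers lower and upper bounds at
  once.\<close>

lemma value_telescope:
  fixes u :: "'s \<Rightarrow> real" and \<delta> :: "nat \<Rightarrow> real" and s :: real
  assumes u: "u \<in> borel_measurable Z" "\<And>z. z \<in> space Z \<Longrightarrow> \<bar>u z\<bar> \<le> K" and s: "\<bar>s\<bar> = 1" and \<delta>: "\<And>t. \<bar>\<delta> t\<bar> \<le> D"
    and step: "\<And>t. s * ((\<integral>\<omega>. u (fst (\<omega> t)) \<partial>law) - \<beta> * (\<integral>\<omega>. u (fst (\<omega> (Suc t))) \<partial>law)) \<le>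
      s * (\<integral>\<omega>. c (fst (\<omega> t)) (snd (\<omega> t)) \<partial>law) + \<delta> t"
  shows "s * u z \<le> s * policy_value \<phi> z + (\<Sum>t. \<beta> ^ t * \<delta> t) "
proof -
  define x where "x t = (\<integral>\<omega>. u (fst (\<omega> t)) \<partial>law)" for t
  define \<gamma> where "\<gamma> t = (\<integral>\<omega>. c (fst (\<omega> t)) (snd (\<omega> t)) \<partial>law)" for t
  have \<gamma>_le: "\<bar>\<gamma> t\<bar> \<le> M" for t
    unfolding \<gamma>_def using cost_function(2) by (rule abs_expectation_le[where f="\<lambda>w. c (fst w) (snd w)"])
  have x_le: "\<bar>s * x t\<bar> \<le> K" for t
    unfolding x_def abs_mult s using state_function(2)[OF u]
    by (simp add: abs_expectation_le[where f="\<lambda>w. u (fst w)"])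
  have "s * x 0 \<le> (\<Sum>t. \<beta> ^ t * (s * \<gamma> t + \<delta> t))"
  proof (rule discounted_telescope[where x="\<lambda>t. s * x t", OF \<beta> x_le])
    show "\<bar>s * \<gamma> t + \<delta> t\<bar> \<le> M + D" for t
      using abs_triangle_ineq[of "s * \<gamma> t" "\<delta> t"] \<gamma>_le[of t] \<delta>[of t] s by (simp add: abs_mult)
    show "s * x t - \<beta> * (s * x (Suc t)) \<le> s * \<gamma> t + \<delta> t" for t
      using step[of t] by (simp add: x_def \<gamma>_def algebra_simps)
  qed
  also have "\<dots> = s * (\<Sum>t. \<beta> ^ t * \<gamma> t) + (\<Sum>t. \<beta> ^ t * \<delta> t)"
  proof -
    have "(\<lambda>t. s * (\<beta> ^ t * \<gamma> t) + \<beta> ^ t * \<delta> t) sums (s * (\<Sum>t. \<beta> ^ t * \<gamma> t) + (\<Sum>t. \<beta> ^ t * \<delta> t))"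
      by (intro sums_add sums_mult summable_sums summable_discounted[OF \<beta> \<gamma>_le] summable_discounted[OF \<beta> \<delta>])
    then show ?thesis by (simp add: sums_iff algebra_simps)
  qed
  also have "x 0 = u z" unfolding x_def by (rule expectation_initial[OF u])
  also have "(\<Sum>t. \<beta> ^ t * \<gamma> t) = policy_value \<phi> z" unfolding \<gamma>_def by (rule value_eq_suminf[symmetric])
  finally show ?thesis .
qed

lemma value_ge:
  fixes u :: "'s \<Rightarrow> real"
  assumes u: "u \<in> borel_measurable Z" "\<And>z. z \<in> space Z \<Longrightarrow> \<bar>u z\<bar> \<le> K"
    and le: "\<And>z a. z \<in> space Z \<Longrightarrow> a \<in> space B \<Longrightarrow> u z \<le> c z a + \<beta> * (\<integral>z'. u z' \<partial>\<eta> z a) + \<epsilon>"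
  shows "u z - \<epsilon> / (1 - \<beta>) \<le> policy_value \<phi> z"
proof -
  note i = integrable_law[OF cost_function] integrable_law[OF state_function[OF u]]
    integrable_law[OF trans_integral_measurable[OF u(1)] trans_integral_le[OF u(2)]]
  interpret L: prob_space law by (rule prob_space_law)
  have "1 * u z \<le> 1 * policy_value \<phi> z + (\<Sum>t. \<beta> ^ t * \<epsilon>)"
  proof (rule value_telescope[OF u])
    fix t
    have "(\<integral>\<omega>. u (fst (\<omega> t)) \<partial>law) \<le>
        (\<integral>\<omega>. c (fst (\<omega> t)) (snd (\<omega> t)) + \<beta> * (\<integral>z'. u z' \<partial>\<eta> (fst (\<omega> t)) (snd (\<omega> t))) + \<epsilon> \<partial>law)"
      using i le space_law by (intro integral_mono) (auto simp: space_pair_measure mem_Times_iff)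
    then show "1 * ((\<integral>\<omega>. u (fst (\<omega> t)) \<partial>law) - \<beta> * (\<integral>\<omega>. u (fst (\<omega> (Suc t))) \<partial>law)) \<le>
        1 * (\<integral>\<omega>. c (fst (\<omega> t)) (snd (\<omega> t)) \<partial>law) + \<epsilon>"
      using i by (simp add: expectation_Suc[OF u] L.prob_space)
  qed auto
  then show ?thesis by (simp add: suminf_discounted_const)
qed

text \<open>Here the selector \<open>f\<close> violates the Bellman inequality at \<open>z\<close> by at most \<open>W 0 z + \<epsilon>\<close>, and \<open>W t z\<close>
  dominates the expectation of \<open>W 0\<close> after \<open>t\<close> steps from \<open>z\<close> under any choice of actions.\<close>

lemma value_stationary_le:
  fixes u :: "'s \<Rightarrow> real" and W :: "nat \<Rightarrow> 's \<Rightarrow> real"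
  assumes f: "f \<in> Z \<rightarrow>\<^sub>M B" and \<phi>_eq: "\<And>t \<omega> z. \<phi> t (\<omega>, z) = return B (f z)"
    and u: "u \<in> borel_measurable Z" "\<And>z. z \<in> space Z \<Longrightarrow> \<bar>u z\<bar> \<le> K"
    and W: "\<And>k. W k \<in> borel_measurable Z" "\<And>k z. z \<in> space Z \<Longrightarrow> \<bar>W k z\<bar> \<le> K'"
    and W_step: "\<And>k z a. z \<in> space Z \<Longrightarrow> a \<in> space B \<Longrightarrow> (\<integral>z'. W k z' \<partial>\<eta> z a) \<le> W (Suc k) z"
    and le: "\<And>z. z \<in> space Z \<Longrightarrow> c z (f z) + \<beta> * (\<integral>z'. u z' \<partial>\<eta> z (f z)) \<le> u z + W 0 z + \<epsilon>"
  shows "policy_value \<phi> z \<le> u z + \<epsilon> / (1 - \<beta>) + (\<Sum>t. \<beta> ^ t * W t z)"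
proof -
  note c = cost_function(2) and cm = cost_function(1)
  define \<psi> where "\<psi> w = c (fst w) (snd w) + \<beta> * (\<integral>z'. u z' \<partial>\<eta> (fst w) (snd w))" for w
  have \<psi>: "\<psi> \<in> borel_measurable (Z \<Otimes>\<^sub>M B)" "\<And>w. w \<in> space (Z \<Otimes>\<^sub>M B) \<Longrightarrow> \<bar>\<psi> w\<bar> \<le> M + K"
  proof -
    show "\<psi> \<in> borel_measurable (Z \<Otimes>\<^sub>M B)"
      unfolding \<psi>_def using cm trans_integral_measurable[OF u(1)] by measurable
    fix w assume w: "w \<in> space (Z \<Otimes>\<^sub>M B)"
    have "\<bar>\<beta> * (\<integral>z'. u z' \<partial>\<eta> (fst w) (snd w))\<bar> \<le> 1 * K"
      unfolding abs_mult using \<beta> trans_integral_le[OF u(2) w] by (intro mult_mono) auto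
    with c[OF w] show "\<bar>\<psi> w\<bar> \<le> M + K" unfolding \<psi>_def by linarith
  qed
  have m: "(\<lambda>w. (fst w, f (fst w))) \<in> Z \<Otimes>\<^sub>M B \<rightarrow>\<^sub>M Z \<Otimes>\<^sub>M B"
    using f by measurable
  note \<psi>' = measurable_compose[OF m \<psi>(1)] \<psi>(2)[OF measurable_space[OF m]]
  note i = integrable_law[OF cm c] integrable_law[OF state_function[OF u]] integrable_law[OF state_function[OF W]]
    integrable_law[OF trans_integral_measurable[OF u(1)] trans_integral_le[OF u(2)]]
    integrable_law[OF trans_integral_measurable[OF W(1)] trans_integral_le[OF W(2)]]
    integrable_law[OF \<psi>'] integrable_law[OF \<psi>]
  interpret L: prob_space law by (rule prob_space_law)
  have EW: "(\<integral>\<omega>. W k (fst (\<omega> t)) \<partial>law) \<le> W (k + t) z" for k t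
  proof (induction t arbitrary: k)
    case 0
    then show ?case by (simp add: expectation_initial[OF W])
  next
    case (Suc t)
    have "(\<integral>\<omega>. W k (fst (\<omega> (Suc t))) \<partial>law) = (\<integral>\<omega>. (\<integral>z'. W k z' \<partial>\<eta> (fst (\<omega> t)) (snd (\<omega> t))) \<partial>law)"
      by (rule expectation_Suc[OF W])
    also have "\<dots> \<le> (\<integral>\<omega>. W (Suc k) (fst (\<omega> t)) \<partial>law)"
      using i W_step space_law by (intro integral_mono) (auto simp: space_pair_measure mem_Times_iff)
    also have "\<dots> \<le> W (Suc k + t) z" by (rule Suc.IH)
    finally show ?case by simp
  qed
  have W_le: "\<bar>W t z\<bar> \<le> K'" for t using W(2)[OF z] .
  have "- 1 * u z \<le> - 1 * policy_value \<phi> z + (\<Sum>t. \<beta> ^ t * (W t z + \<epsilon>))"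
  proof (rule value_telescope[OF u, where D="K' + \<bar>\<epsilon>\<bar>"])
    show "\<bar>W t z + \<epsilon>\<bar> \<le> K' + \<bar>\<epsilon>\<bar>" for t using W_le[of t] by linarith
    fix t
    have "(\<integral>\<omega>. c (fst (\<omega> t)) (snd (\<omega> t)) \<partial>law) + \<beta> * (\<integral>\<omega>. u (fst (\<omega> (Suc t))) \<partial>law) = (\<integral>\<omega>. \<psi> (\<omega> t) \<partial>law)"
      using i by (simp add: \<psi>_def expectation_Suc[OF u])
    also have "\<dots> = (\<integral>\<omega>. \<psi> (fst (\<omega> t), f (fst (\<omega> t))) \<partial>law)"
      by (rule expectation_stationary[OF \<psi> f \<phi>_eq])
    also have "\<dots> \<le> (\<integral>\<omega>. u (fst (\<omega> t)) + W 0 (fst (\<omega> t)) + \<epsilon> \<partial>law)"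
      using i le space_law by (intro integral_mono) (auto simp: \<psi>_def space_pair_measure mem_Times_iff)
    also have "\<dots> = (\<integral>\<omega>. u (fst (\<omega> t)) \<partial>law) + (\<integral>\<omega>. W 0 (fst (\<omega> t)) \<partial>law) + \<epsilon>"
      using i by (simp add: L.prob_space)
    also have "\<dots> \<le> (\<integral>\<omega>. u (fst (\<omega> t)) \<partial>law) + W t z + \<epsilon>" using EW[of 0 t] by simp
    finally show "- 1 * ((\<integral>\<omega>. u (fst (\<omega> t)) \<partial>law) - \<beta> * (\<integral>\<omega>. u (fst (\<omega> (Suc t))) \<partial>law)) \<le>
        - 1 * (\<integral>\<omega>. c (fst (\<omega> t)) (snd (\<omega> t)) \<partial>law) + (W t z + \<epsilon>)" by simp
  qed auto
  also have "(\<Sum>t. \<beta> ^ t * (W t z + \<epsilon>)) = (\<Sum>t. \<beta> ^ t * W t z) + \<epsilon> / (1 - \<beta>)"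
    unfolding distrib_left suminf_discounted_const[symmetric]
    by (rule suminf_add[OF summable_discounted[OF \<beta> W_le] summable_discounted[OF \<beta> order_refl], symmetric])
  finally show ?thesis by simp
qed

end

lemma stationary_policy:
  assumes f: "f \<in> Z \<rightarrow>\<^sub>M B"
  shows "(\<lambda>t (\<omega>, z). return B (f z)) \<in> policies Z B"
proof -
  have "(\<lambda>w. return B (f (snd w))) \<in> (\<Pi>\<^sub>M i\<in>{0..<t}. Z \<Otimes>\<^sub>M B) \<Otimes>\<^sub>M Z \<rightarrow>\<^sub>M prob_algebra B" for t :: nat
    by (rule measurable_compose[OF measurable_compose[OF measurable_snd f] measurable_return_prob_space])
  then show ?thesis by (simp add: policies_def case_prod_unfold)
qed

lemma bdd_below_value:
  assumes z: "z \<in> space Z"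
  shows "bdd_below ((\<lambda>\<phi>. policy_value \<phi> z) ` policies Z B)"
proof (rule bdd_belowI2)
  fix \<phi> assume \<phi>: "\<phi> \<in> policies Z B"
  define u where "u = - M / (1 - \<beta>)"
  have "(\<lambda>_. u) z - 0 / (1 - \<beta>) \<le> policy_value \<phi> z"
  proof (rule value_ge[OF \<phi> z])
    fix z a assume za: "z \<in> space Z" "a \<in> space B"
    have "prob_space (\<eta> z a)"
      using measurable_space[OF trans, of "(z, a)"] za by (simp add: space_pair_measure space_prob_algebra)
    then have eq: "(\<integral>z'. u \<partial>\<eta> z a) = u" by (simp add: prob_space.prob_space)
    have "u = - M + \<beta> * u" using \<beta> by (simp add: u_def field_simps)
    moreover have "- M \<le> c z a" using cost_le[OF za] by linarith
    ultimately show "u \<le> c z a + \<beta> * (\<integral>z'. u \<partial>\<eta> z a) + 0" unfolding eq by linarith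
  qed auto
  then show "u \<le> policy_value \<phi> z" by simp
qed

lemma discounted_value_ge:
  fixes u :: "'s \<Rightarrow> real"
  assumes z: "z \<in> space Z" and u: "u \<in> borel_measurable Z" "\<And>z. z \<in> space Z \<Longrightarrow> \<bar>u z\<bar> \<le> K"
    and le: "\<And>z a. z \<in> space Z \<Longrightarrow> a \<in> space B \<Longrightarrow> u z \<le> c z a + \<beta> * (\<integral>z'. u z' \<partial>\<eta> z a) + \<epsilon>"
  shows "u z - \<epsilon> / (1 - \<beta>) \<le> discounted_value Z B \<eta> c \<beta> z"
  unfolding discounted_value_def
proof (rule cINF_greatest)
  obtain a where "a \<in> space B" using actions by auto
  then have "(\<lambda>_. a) \<in> Z \<rightarrow>\<^sub>M B" by simp
  from stationary_policy[OF this] show "policies Z B \<noteq> {}" by auto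
qed (rule value_ge[OF _ z u le])

lemma discounted_value_le:
  fixes u :: "'s \<Rightarrow> real" and W :: "nat \<Rightarrow> 's \<Rightarrow> real"
  assumes z: "z \<in> space Z" and f: "f \<in> Z \<rightarrow>\<^sub>M B"
    and u: "u \<in> borel_measurable Z" "\<And>z. z \<in> space Z \<Longrightarrow> \<bar>u z\<bar> \<le> K"
    and W: "\<And>k. W k \<in> borel_measurable Z" "\<And>k z. z \<in> space Z \<Longrightarrow> \<bar>W k z\<bar> \<le> K'"
    and W_step: "\<And>k z a. z \<in> space Z \<Longrightarrow> a \<in> space B \<Longrightarrow> (\<integral>z'. W k z' \<partial>\<eta> z a) \<le> W (Suc k) z"
    and le: "\<And>z. z \<in> space Z \<Longrightarrow> c z (f z) + \<beta> * (\<integral>z'. u z' \<partial>\<eta> z (f z)) \<le> u z + W 0 z + \<epsilon>"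
  shows "discounted_value Z B \<eta> c \<beta> z \<le> u z + \<epsilon> / (1 - \<beta>) + (\<Sum>t. \<beta> ^ t * W t z)"
proof -
  note \<phi> = stationary_policy[OF f]
  have "discounted_value Z B \<eta> c \<beta> z \<le> policy_value (\<lambda>t (\<omega>, z). return B (f z)) z"
    unfolding discounted_value_def by (rule cINF_lower[OF bdd_below_value[OF z] \<phi>])
  also have "\<dots> \<le> u z + \<epsilon> / (1 - \<beta>) + (\<Sum>t. \<beta> ^ t * W t z)"
    by (rule value_stationary_le[OF \<phi> z f _ u W W_step le]) auto
  finally show ?thesis .
qed

end

section \<open>Approximation by finitely many actions\<close>

lemma Dini_SUP_tendsto_0:
  fixes f :: "nat \<Rightarrow> 'a::metric_space \<Rightarrow> real"
  assumes A: "compact A" "A \<noteq> {}" and cont: "\<And>n. continuous_on A (f n)"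
    and nonneg: "\<And>n a. a \<in> A \<Longrightarrow> 0 \<le> f n a"
    and dec: "\<And>m n a. a \<in> A \<Longrightarrow> m \<le> n \<Longrightarrow> f n a \<le> f m a"
    and lim: "\<And>a. a \<in> A \<Longrightarrow> (\<lambda>n. f n a) \<longlonglongrightarrow> 0"
  shows "(\<lambda>n. SUP a\<in>A. f n a) \<longlonglongrightarrow> 0"
proof -
  have bdd: "bdd_above (f n ` A)" for n
    by (intro bounded_imp_bdd_above compact_imp_bounded compact_continuous_image cont A)
  obtain a0 where a0: "a0 \<in> A" using A(2) by auto
  have SUP0: "0 \<le> (SUP a\<in>A. f n a)" for n
    using cSUP_upper[OF a0 bdd] nonneg[OF a0] by (rule order_trans[rotated])
  show ?thesis
  proof (rule LIMSEQ_I)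
    fix e :: real assume e: "0 < e"
    show "\<exists>N. \<forall>n\<ge>N. norm ((SUP a\<in>A. f n a) - 0) < e"
    proof (rule ccontr)
      assume no: "\<nexists>N. \<forall>n\<ge>N. norm ((SUP a\<in>A. f n a) - 0) < e"
      have "\<exists>a\<in>A. e / 2 < f m a" for m
      proof -
        obtain n where n: "m \<le> n" "e \<le> (SUP a\<in>A. f n a)" using no SUP0 by (auto simp: not_less)
        then have "e / 2 < (SUP a\<in>A. f n a)" using e by simp
        then obtain a where "a \<in> A" "e / 2 < f n a" using less_cSUP_iff[OF A(2) bdd] by blast
        with dec[of a m n] n(1) show ?thesis by (intro bexI[of _ a]) auto
      qed
      then obtain a where a: "\<And>m. a m \<in> A" "\<And>m. e / 2 < f m (a m)" by metis
      obtain l \<sigma> where l: "l \<in> A" "strict_mono (\<sigma>::nat \<Rightarrow> nat)" "(a \<circ> \<sigma>) \<longlonglongrightarrow> l"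
        using A(1) a(1) unfolding compact_def by metis
      have "e / 2 \<le> f m l" for m
      proof (rule LIMSEQ_le_const)
        show "(\<lambda>n. f m ((a \<circ> \<sigma>) n)) \<longlonglongrightarrow> f m l"
          using l a(1) by (intro continuous_on_tendsto_compose[OF cont]) (auto simp: comp_def)
        have "e / 2 \<le> f m ((a \<circ> \<sigma>) n)" if "m \<le> n" for n
          using a(2)[of "\<sigma> n"] dec[OF a(1)[of "\<sigma> n"], of m "\<sigma> n"] seq_suble[OF l(2), of n] that by auto
        then show "\<exists>N. \<forall>n\<ge>N. e / 2 \<le> f m ((a \<circ> \<sigma>) n)" by blast
      qed
      then have "e / 2 \<le> 0" by (intro LIMSEQ_le_const[OF lim[OF l(1)]]) auto
      with e show False by simp
    qed
  qed
qed

lemma measurable_argmin_finite: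
  fixes g :: "'b \<Rightarrow> 'z \<Rightarrow> real"
  assumes "finite S" "S \<noteq> {}" "S \<subseteq> space N" "\<And>b. b \<in> S \<Longrightarrow> g b \<in> borel_measurable M"
  obtains f where "f \<in> M \<rightarrow>\<^sub>M N" "\<And>z. f z \<in> S" "\<And>z b. b \<in> S \<Longrightarrow> g (f z) z \<le> g b z"
proof -
  have "\<exists>f. f \<in> M \<rightarrow>\<^sub>M N \<and> (\<forall>z. f z \<in> S) \<and> (\<forall>z. \<forall>b\<in>S. g (f z) z \<le> g b z)"
    using assms
  proof (induction S rule: finite_ne_induct)
    case (singleton b)
    then show ?case by (intro exI[of _ "\<lambda>_. b"]) simp
  next
    case (insert b S)
    have "\<exists>f. f \<in> M \<rightarrow>\<^sub>M N \<and> (\<forall>z. f z \<in> S) \<and> (\<forall>z. \<forall>b\<in>S. g (f z) z \<le> g b z)"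
      by (rule insert.IH) (use insert.prems in simp_all)
    then obtain f where f: "f \<in> M \<rightarrow>\<^sub>M N" "\<forall>z. f z \<in> S" "\<forall>z. \<forall>b\<in>S. g (f z) z \<le> g b z"
      by blast
    let ?f = "\<lambda>z. if \<forall>b'\<in>S. g b z \<le> g b' z then b else f z"
    have "{z \<in> space M. \<forall>b'\<in>S. g b z \<le> g b' z} \<in> sets M"
      using insert.hyps insert.prems by (intro sets.sets_Collect_finite_All' borel_measurable_le) simp_all
    then have "?f \<in> M \<rightarrow>\<^sub>M N"
      using f(1) insert.prems(1) by (intro measurable_If) simp_all
    moreover have "?f z \<in> insert b S" for z using f(2) by simp
    moreover have "g (?f z) z \<le> g b' z" if "b' \<in> insert b S" for b' z
    proof (cases "\<forall>b'\<in>S. g b z \<le> g b' z")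
      case True
      with that show ?thesis by auto
    next
      case False
      then obtain b'' where "b'' \<in> S" "g b'' z < g b z" by (auto simp: not_le)
      then have "g (f z) z \<le> g b z" using f(3) by (meson less_le_not_le order_trans)
      with False that f(3) show ?thesis by auto
    qed
    ultimately show ?case by blast
  qed
  with that show thesis by blast
qed

lemma abs_INF_diff_le:
  fixes f g :: "'i \<Rightarrow> real"
  assumes "I \<noteq> {}" "\<And>i. i \<in> I \<Longrightarrow> \<bar>f i\<bar> \<le> K" "\<And>i. i \<in> I \<Longrightarrow> \<bar>g i\<bar> \<le> K"
    and "\<And>i. i \<in> I \<Longrightarrow> \<bar>f i - g i\<bar> \<le> e"
  shows "\<bar>(INF i\<in>I. f i) - (INF i\<in>I. g i)\<bar> \<le> e"
  using abs_SUP_diff_le[of I "\<lambda>i. - f i" K "\<lambda>i. - g i" e] assms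
  by (simp add: Inf_real_def image_image abs_minus_commute)

lemma discounted_suminf_tendsto_0:
  fixes W :: "nat \<Rightarrow> nat \<Rightarrow> real"
  assumes \<beta>: "0 < \<beta>" "\<beta> < 1" and W: "\<And>n t. \<bar>W n t\<bar> \<le> B" and lim: "\<And>t. (\<lambda>n. W n t) \<longlonglongrightarrow> 0"
  shows "(\<lambda>n. \<Sum>t. \<beta> ^ t * W n t) \<longlonglongrightarrow> 0"
proof -
  have int: "integrable (count_space UNIV) (\<lambda>t. \<beta> ^ t * W n t)" for n
  proof -
    have "\<bar>\<bar>W n t\<bar>\<bar> \<le> B" for t using W by simp
    from summable_discounted[OF \<beta> this] \<beta> show ?thesis by (simp add: integrable_count_space_nat_iff abs_mult)
  qed
  have Wb: "\<bar>W n t\<bar> \<le> \<bar>B\<bar>" for n t by (rule order_trans[OF W abs_ge_self])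
  have "(\<lambda>n. \<integral>t. \<beta> ^ t * W n t \<partial>count_space UNIV) \<longlonglongrightarrow> (\<integral>t. 0 \<partial>count_space (UNIV :: nat set))"
  proof (rule integral_dominated_convergence[where w="\<lambda>t. \<beta> ^ t * \<bar>B\<bar>"])
    show "integrable (count_space UNIV) (\<lambda>t. \<beta> ^ t * \<bar>B\<bar>)"
      using \<beta> summable_discounted[OF \<beta>, of "\<lambda>_. \<bar>B\<bar>" "\<bar>B\<bar>"] by (simp add: integrable_count_space_nat_iff abs_mult)
    show "AE t in count_space UNIV. (\<lambda>n. \<beta> ^ t * W n t) \<longlonglongrightarrow> 0"
      by (intro AE_I2 tendsto_mult_right_zero lim)
    show "AE t in count_space UNIV. norm (\<beta> ^ t * W n t) \<le> \<beta> ^ t * \<bar>B\<bar>" for n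
      using \<beta> Wb by (intro AE_I2) (auto simp: abs_mult)
  qed auto
  then show ?thesis by (simp add: integral_count_space_nat[OF int])
qed

context belief_mdp
begin

lemma tame_const: "tame X (\<lambda>_. k)"
proof -
  have "modulus_on X (\<lambda>_ _. 0)" by (simp add: modulus_on_def)
  moreover have "tame_with X (\<lambda>_ _. 0) \<bar>k\<bar> (\<lambda>_. k)"
    using test_dist_nonneg[OF calculation] by (auto simp: tame_with_def intro!: mult_nonneg_nonneg)
  ultimately show ?thesis by (auto simp: tame_def)
qed

lemma Q_bounded:
  assumes "tame X v"
  shows "\<exists>K. \<forall>z\<in>prob_measures X. \<forall>a\<in>A. \<bar>Q v z a\<bar> \<le> K"
  using tame_with_Q[OF assms] tame_withD(1) by metis

text \<open>Value iteration. It is used in place of the optimal value function: tameness is inherited by each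
  iterate, and the iterates satisfy the optimality equation up to a geometrically small error.\<close>

primrec value_iter :: "nat \<Rightarrow> 'x measure \<Rightarrow> real" where
  "value_iter 0 = (\<lambda>_. 0)"
| "value_iter (Suc k) = (\<lambda>z. INF a\<in>A. Q (value_iter k) z a)"

lemma tame_value_iter: "tame X (value_iter k)"
proof (induction k)
  case (Suc k)
  obtain d K where "modulus_on X d" "\<And>a. a \<in> A \<Longrightarrow> tame_with X d K (\<lambda>z. Q (value_iter k) z a)"
    using tame_with_Q[OF Suc] by metis
  from tame_INF_SUP(1)[OF this(1) A_nonempty this(2)] show ?case by simp
qed (simp add: tame_const)

lemma value_iter_diff:
  assumes "z \<in> prob_measures X"
  shows "\<bar>value_iter (Suc k) z - value_iter k z\<bar> \<le> \<beta> ^ k * cost_bound"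
  using assms
proof (induction k arbitrary: z)
  case 0
  have "\<bar>Q (\<lambda>_. 0) z a\<bar> \<le> cost_bound" if "a \<in> A" for a
    using tame_withD(1)[OF tame_with_cost[OF that] 0] by (simp add: Q_def)
  then show ?case using abs_SUP_le[of A "\<lambda>a. - Q (\<lambda>_. 0) z a" cost_bound] A_nonempty
    by (simp add: Inf_real_def image_image)
next
  case (Suc k)
  obtain K1 where K1: "\<And>a. a \<in> A \<Longrightarrow> \<bar>Q (value_iter (Suc k)) z a\<bar> \<le> K1" using Q_bounded[OF tame_value_iter] Suc.prems by blast
  obtain K2 where K2: "\<And>a. a \<in> A \<Longrightarrow> \<bar>Q (value_iter k) z a\<bar> \<le> K2" using Q_bounded[OF tame_value_iter] Suc.prems by blast
  have "\<bar>Q (value_iter (Suc k)) z a - Q (value_iter k) z a\<bar> \<le> \<beta> ^ Suc k * cost_bound" if a: "a \<in> A" for a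
  proof -
    obtain B1 where B1: "\<And>u. u \<in> prob_measures X \<Longrightarrow> \<bar>value_iter (Suc k) u\<bar> \<le> B1" using tame_bounded[OF tame_value_iter] by blast
    obtain B2 where B2: "\<And>u. u \<in> prob_measures X \<Longrightarrow> \<bar>value_iter k u\<bar> \<le> B2" using tame_bounded[OF tame_value_iter] by blast
    have "Q (value_iter (Suc k)) z a - Q (value_iter k) z a = \<beta> * (\<integral>u. value_iter (Suc k) u - value_iter k u \<partial>\<eta> z a)"
      unfolding Q_def
      using integrable_trans[OF Suc.prems a tame_measurable[OF tame_value_iter] B1]
        integrable_trans[OF Suc.prems a tame_measurable[OF tame_value_iter] B2]
      by (simp add: right_diff_distrib del: value_iter.simps)
    also have "\<bar>\<dots>\<bar> \<le> \<beta> * (\<beta> ^ k * cost_bound)"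
      unfolding abs_mult using \<beta> abs_integral_trans_le[OF Suc.prems a Suc.IH] by (intro mult_mono) auto
    finally show ?thesis by simp
  qed
  then have "\<bar>(INF a\<in>A. Q (value_iter (Suc k)) z a) - (INF a\<in>A. Q (value_iter k) z a)\<bar> \<le> \<beta> ^ Suc k * cost_bound"
    using K1 K2 by (intro abs_INF_diff_le[where K="max K1 K2"] A_nonempty) (auto simp: le_max_iff_disj)
  then show ?case by (simp only: value_iter.simps(2))
qed

lemma value_iter_Suc_le:
  assumes z: "z \<in> prob_measures X" "a \<in> A"
  shows "value_iter (Suc k) z \<le> Q (value_iter k) z a"
proof -
  obtain K where K: "\<And>a. a \<in> A \<Longrightarrow> \<bar>Q (value_iter k) z a\<bar> \<le> K" using Q_bounded[OF tame_value_iter] z(1) by blast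
  have "bdd_below (Q (value_iter k) z ` A)" using K by (intro bdd_belowI2[where m="- K"]) (force simp: abs_le_iff)
  then show ?thesis using z(2) by (auto intro: cINF_lower)
qed

definition close_pairs :: "nat \<Rightarrow> ('a \<times> 'a) set" where
  "close_pairs n = {(a, b). a \<in> A \<and> b \<in> A \<and> dist a b < 1 / real (Suc n)}"

text \<open>The largest loss, in one step, from replacing an action by one within distance \<open>1 / (n + 1)\<close>. The
  shift by one avoids the degenerate case \<open>n = 0\<close>.\<close>

definition oscillation :: "('x measure \<Rightarrow> real) \<Rightarrow> nat \<Rightarrow> 'x measure \<Rightarrow> real" where
  "oscillation v n z = (SUP w\<in>close_pairs n. \<bar>Q v z (fst w) - Q v z (snd w)\<bar>)"

text \<open>The worst case, over all choices of actions, of the expected oscillation after \<open>k\<close> steps.\<close>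

primrec regret :: "('x measure \<Rightarrow> real) \<Rightarrow> nat \<Rightarrow> nat \<Rightarrow> 'x measure \<Rightarrow> real" where
  "regret v n 0 = oscillation v n"
| "regret v n (Suc k) = (\<lambda>z. SUP a\<in>A. \<integral>z'. regret v n k z' \<partial>\<eta> z a)"

lemma close_pairs_nonempty: "close_pairs n \<noteq> {}"
proof -
  obtain a where "a \<in> A" using A_nonempty by auto
  then have "(a, a) \<in> close_pairs n" by (simp add: close_pairs_def)
  then show ?thesis by auto
qed

lemma close_pairs_antimono: "m \<le> n \<Longrightarrow> close_pairs n \<subseteq> close_pairs m"
proof -
  assume "m \<le> n"
  then have "1 / real (Suc n) \<le> 1 / real (Suc m)" by (intro divide_left_mono) auto
  then show ?thesis unfolding close_pairs_def by (auto intro: less_le_trans)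
qed

lemma tame_regret:
  assumes v: "tame X v"
  shows "tame X (regret v n k)"
proof (induction k)
  case 0
  obtain d K where d: "modulus_on X d" and K: "\<And>a. a \<in> A \<Longrightarrow> tame_with X d K (\<lambda>z. Q v z a)"
    using tame_with_Q[OF v] by metis
  have "tame X (\<lambda>z. SUP w\<in>close_pairs n. \<bar>Q v z (fst w) - Q v z (snd w)\<bar>)"
    by (rule tame_INF_SUP(2)[OF d close_pairs_nonempty, where K="2 * K"])
      (auto simp: close_pairs_def intro!: tame_with_abs_diff[OF d] K)
  then show ?case by (simp add: oscillation_def[abs_def])
next
  case (Suc k)
  then obtain d K where d: "modulus_on X d" and K: "tame_with X d K (regret v n k)" by (auto simp: tame_def)
  have "tame X (\<lambda>z. SUP a\<in>A. \<integral>z'. regret v n k z' \<partial>\<eta> z a)"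
    by (rule tame_INF_SUP(2)[OF predict_modulus(1)[OF modulus_on_filter_modulus[OF d r_kernel r_tv]] A_nonempty
      tame_with_trans[OF d K]])
  then show ?case by simp
qed

lemma oscillation_upper:
  assumes v: "tame X v" and z: "z \<in> prob_measures X" and a: "a \<in> A" "b \<in> A" "dist a b < 1 / real (Suc n)"
  shows "\<bar>Q v z a - Q v z b\<bar> \<le> oscillation v n z"
proof -
  obtain K where K: "\<And>a. a \<in> A \<Longrightarrow> \<bar>Q v z a\<bar> \<le> K" using Q_bounded[OF v] z by blast
  have "bdd_above ((\<lambda>w. \<bar>Q v z (fst w) - Q v z (snd w)\<bar>) ` close_pairs n)"
  proof (rule bdd_aboveI2)
    fix w assume "w \<in> close_pairs n"
    then have "\<bar>Q v z (fst w)\<bar> \<le> K" "\<bar>Q v z (snd w)\<bar> \<le> K" using K by (auto simp: close_pairs_def)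
    then show "\<bar>Q v z (fst w) - Q v z (snd w)\<bar> \<le> 2 * K" by linarith
  qed
  from cSUP_upper[OF _ this, of "(a, b)"] a show ?thesis by (auto simp: oscillation_def close_pairs_def)
qed

lemma regret_bounds:
  assumes v: "tame X v"
  obtains B where "\<And>n k z. z \<in> prob_measures X \<Longrightarrow> 0 \<le> regret v n k z"
    "\<And>n k z. z \<in> prob_measures X \<Longrightarrow> regret v n k z \<le> B"
proof -
  obtain K where K: "\<And>z a. z \<in> prob_measures X \<Longrightarrow> a \<in> A \<Longrightarrow> \<bar>Q v z a\<bar> \<le> K" using Q_bounded[OF v] by blast
  obtain a0 where a0: "a0 \<in> A" using A_nonempty by auto
  have "0 \<le> regret v n k z \<and> regret v n k z \<le> 2 * K" if "z \<in> prob_measures X" for n k z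
    using that
  proof (induction k arbitrary: z)
    case 0
    have "oscillation v n z \<le> 2 * K"
      unfolding oscillation_def
    proof (rule cSUP_least[OF close_pairs_nonempty])
      fix w assume "w \<in> close_pairs n"
      then have "\<bar>Q v z (fst w)\<bar> \<le> K" "\<bar>Q v z (snd w)\<bar> \<le> K" using K[OF 0] by (auto simp: close_pairs_def)
      then show "\<bar>Q v z (fst w) - Q v z (snd w)\<bar> \<le> 2 * K" by linarith
    qed
    moreover have "0 \<le> oscillation v n z"
      using oscillation_upper[OF v 0 a0 a0, of n] by simp
    ultimately show ?case by simp
  next
    case (Suc k)
    have b: "\<bar>\<integral>z'. regret v n k z' \<partial>\<eta> z a\<bar> \<le> 2 * K" if "a \<in> A" for a
      using Suc.IH by (intro abs_integral_trans_le[OF Suc.prems that]) auto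
    have nn: "0 \<le> (\<integral>z'. regret v n k z' \<partial>\<eta> z a)" if "a \<in> A" for a
    proof (rule Bochner_Integration.integral_nonneg)
      fix u assume "u \<in> space (\<eta> z a)"
      moreover have "space (\<eta> z a) = prob_measures X"
        using trans_prob[OF Suc.prems that] by (auto simp: space_prob_algebra dest: sets_eq_imp_space_eq)
      ultimately show "0 \<le> regret v n k u" using Suc.IH by blast
    qed
    have "(SUP a\<in>A. \<integral>z'. regret v n k z' \<partial>\<eta> z a) \<le> 2 * K"
      using b by (intro cSUP_least[OF A_nonempty]) (auto simp: abs_le_iff)
    moreover have "(\<integral>z'. regret v n k z' \<partial>\<eta> z a0) \<le> (SUP a\<in>A. \<integral>z'. regret v n k z' \<partial>\<eta> z a)"
      using b by (intro cSUP_upper[OF a0] bdd_aboveI2[where M="2 * K"]) (auto simp: abs_le_iff)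
    ultimately show ?case using nn[OF a0] by simp
  qed
  with that show thesis by blast
qed

lemma regret_Suc_upper:
  assumes v: "tame X v" and z: "z \<in> prob_measures X" "a \<in> A"
  shows "(\<integral>z'. regret v n k z' \<partial>\<eta> z a) \<le> regret v n (Suc k) z"
proof -
  obtain B where B: "\<And>n k z. z \<in> prob_measures X \<Longrightarrow> 0 \<le> regret v n k z"
    "\<And>n k z. z \<in> prob_measures X \<Longrightarrow> regret v n k z \<le> B" using regret_bounds[OF v] by metis
  have "\<bar>\<integral>z'. regret v n k z' \<partial>\<eta> z a\<bar> \<le> B" if "a \<in> A" for a
    using B by (intro abs_integral_trans_le[OF z(1) that]) auto
  then have "bdd_above ((\<lambda>a. \<integral>z'. regret v n k z' \<partial>\<eta> z a) ` A)"
    by (intro bdd_aboveI2[where M=B]) (auto simp: abs_le_iff)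
  from cSUP_upper[OF z(2) this] show ?thesis by simp
qed

lemma regret_antimono:
  assumes v: "tame X v" and mn: "m \<le> n" and z: "z \<in> prob_measures X"
  shows "regret v n k z \<le> regret v m k z"
  using z
proof (induction k arbitrary: z)
  case 0
  show ?case
    unfolding regret.simps oscillation_def[of v n]
  proof (rule cSUP_least[OF close_pairs_nonempty])
    fix w assume "w \<in> close_pairs n"
    then have "w \<in> close_pairs m" using close_pairs_antimono[OF mn] by blast
    then show "\<bar>Q v z (fst w) - Q v z (snd w)\<bar> \<le> oscillation v m z"
      using oscillation_upper[OF v 0] by (auto simp: close_pairs_def)
  qed
next
  case (Suc k)
  obtain B where B: "\<And>n k z. z \<in> prob_measures X \<Longrightarrow> 0 \<le> regret v n k z"
    "\<And>n k z. z \<in> prob_measures X \<Longrightarrow> regret v n k z \<le> B" using regret_bounds[OF v] by metis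
  have "(SUP a\<in>A. \<integral>z'. regret v n k z' \<partial>\<eta> z a) \<le> regret v m (Suc k) z"
  proof (rule cSUP_least[OF A_nonempty])
    fix a assume a: "a \<in> A"
    have int: "integrable (\<eta> z a) (regret v i k)" for i
      using B by (intro integrable_trans[OF Suc.prems a tame_measurable[OF tame_regret[OF v]], where K=B]) auto
    have sp: "space (\<eta> z a) = prob_measures X"
      using trans_prob[OF Suc.prems a] by (auto simp: space_prob_algebra dest: sets_eq_imp_space_eq)
    have "(\<integral>z'. regret v n k z' \<partial>\<eta> z a) \<le> (\<integral>z'. regret v m k z' \<partial>\<eta> z a)"
      using Suc.IH by (intro integral_mono int) (simp add: sp)
    also have "\<dots> \<le> regret v m (Suc k) z" by (rule regret_Suc_upper[OF v Suc.prems a])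
    finally show "(\<integral>z'. regret v n k z' \<partial>\<eta> z a) \<le> regret v m (Suc k) z" .
  qed
  then show ?case by simp
qed

text \<open>Mere pointwise convergence of \<open>regret v n k\<close> would not carry over to the supremum over all
  actions that defines \<open>regret v n (Suc k)\<close>. As the convergence is monotone in \<open>n\<close> and the integrals
  depend continuously on the action, Dini's theorem applies.\<close>

lemma regret_tendsto_0:
  assumes v: "tame X v" and z: "z \<in> prob_measures X"
  shows "(\<lambda>n. regret v n k z) \<longlonglongrightarrow> 0"
  using z
proof (induction k arbitrary: z)
  case 0
  obtain B where B: "\<And>n k z. z \<in> prob_measures X \<Longrightarrow> 0 \<le> regret v n k z"
    using regret_bounds[OF v] by metis
  show ?case
  proof (rule LIMSEQ_I)
    fix e :: real assume e: "0 < e"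
    have "uniformly_continuous_on A (Q v z)"
      by (rule compact_uniformly_continuous[OF Q_continuous[OF v 0] A_compact])
    then obtain \<delta> where \<delta>: "\<delta> > 0" "\<And>a b. a \<in> A \<Longrightarrow> b \<in> A \<Longrightarrow> dist b a < \<delta> \<Longrightarrow> dist (Q v z b) (Q v z a) < e / 2"
      unfolding uniformly_continuous_on_def using e by (metis half_gt_zero)
    obtain N where N: "1 / real (Suc N) < \<delta>" using \<delta>(1) nat_approx_posE by blast
    show "\<exists>N. \<forall>n\<ge>N. norm (regret v n 0 z - 0) < e"
    proof (intro exI[of _ N] allI impI)
      fix n assume n: "N \<le> n"
      have "oscillation v n z \<le> e / 2"
        unfolding oscillation_def
      proof (rule cSUP_least[OF close_pairs_nonempty])
        fix w assume "w \<in> close_pairs n"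
        then have "w \<in> close_pairs N" using close_pairs_antimono[OF n] by blast
        then have "fst w \<in> A" "snd w \<in> A" "dist (fst w) (snd w) < \<delta>" using N by (auto simp: close_pairs_def)
        from \<delta>(2)[OF this(2,1,3)] show "\<bar>Q v z (fst w) - Q v z (snd w)\<bar> \<le> e / 2"
          by (simp add: dist_real_def)
      qed
      with B[OF 0, of n 0] e show "norm (regret v n 0 z - 0) < e" by simp
    qed
  qed
next
  case (Suc k)
  obtain B where B: "\<And>n k z. z \<in> prob_measures X \<Longrightarrow> 0 \<le> regret v n k z"
    "\<And>n k z. z \<in> prob_measures X \<Longrightarrow> regret v n k z \<le> B" using regret_bounds[OF v] by metis
  have "(\<lambda>n. SUP a\<in>A. \<integral>z'. regret v n k z' \<partial>\<eta> z a) \<longlonglongrightarrow> 0"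
  proof (rule Dini_SUP_tendsto_0[OF A_compact A_nonempty])
    show "continuous_on A (\<lambda>a. \<integral>z'. regret v n k z' \<partial>\<eta> z a)" for n
      by (rule trans_continuous[OF tame_regret[OF v] Suc.prems])
    fix a assume a: "a \<in> A"
    have s: "sets (\<eta> z a) = sets Z" and "prob_space (\<eta> z a)"
      using trans_prob[OF Suc.prems a] by (auto simp: space_prob_algebra)
    interpret prob_space "\<eta> z a" by fact
    have sp: "space (\<eta> z a) = prob_measures X" using sets_eq_imp_space_eq[OF s] by simp
    have int: "integrable (\<eta> z a) (regret v i k)" for i
      using B by (intro integrable_trans[OF Suc.prems a tame_measurable[OF tame_regret[OF v]], where K=B]) auto
    show "0 \<le> (\<integral>z'. regret v n k z' \<partial>\<eta> z a)" for n
      using B(1) sp by (intro Bochner_Integration.integral_nonneg) auto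
    show "(\<integral>z'. regret v n k z' \<partial>\<eta> z a) \<le> (\<integral>z'. regret v m k z' \<partial>\<eta> z a)" if "m \<le> n" for m n
      using regret_antimono[OF v that] sp by (intro integral_mono int) auto
    have "(\<lambda>n. \<integral>z'. regret v n k z' \<partial>\<eta> z a) \<longlonglongrightarrow> (\<integral>z'. 0 \<partial>\<eta> z a)"
      using Suc.IH B sp int
      by (intro integral_dominated_convergence[where w="\<lambda>_. B"]) auto
    then show "(\<lambda>n. \<integral>z'. regret v n k z' \<partial>\<eta> z a) \<longlonglongrightarrow> 0" by simp
  qed
  then show ?case by simp
qed

lemma borel_on_mono: "B \<subseteq> A \<Longrightarrow> (\<lambda>w. w) \<in> Z \<Otimes>\<^sub>M borel_on B \<rightarrow>\<^sub>M Z \<Otimes>\<^sub>M borel_on A"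
proof -
  assume B: "B \<subseteq> A"
  have "(\<lambda>a. a) \<in> borel_on B \<rightarrow>\<^sub>M borel_on A"
    using B by (intro measurable_restrict_space2 measurable_restrict_space1) (auto simp: space_borel_on)
  from measurable_Pair[OF measurable_fst measurable_compose[OF measurable_snd this]]
  show ?thesis by simp
qed

lemma belief_mdp_discounted:
  assumes B: "B \<subseteq> A" "B \<noteq> {}"
  shows "discounted_mdp Z (borel_on B) \<eta> cost \<beta> cost_bound"
proof
  show "(\<lambda>(z, a). \<eta> z a) \<in> Z \<Otimes>\<^sub>M borel_on B \<rightarrow>\<^sub>M prob_algebra Z"
    by (rule measurable_compose[OF borel_on_mono[OF B(1)] trans_measurable])
  show "(\<lambda>(z, a). cost z a) \<in> borel_measurable (Z \<Otimes>\<^sub>M borel_on B)"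
    by (rule measurable_compose[OF borel_on_mono[OF B(1)] cost_measurable])
  show "\<bar>cost z a\<bar> \<le> cost_bound" if "z \<in> space Z" "a \<in> space (borel_on B)" for z a
    using tame_withD(1)[OF tame_with_cost, of a z] that B(1) by (auto simp: space_borel_on)
qed (use \<beta> B in \<open>auto simp: space_borel_on\<close>)

lemma belief_value_ge_value_iter:
  assumes B: "B \<subseteq> A" "B \<noteq> {}" and z: "z \<in> prob_measures X"
  shows "value_iter k z - \<beta> ^ k * cost_bound / (1 - \<beta>) \<le> belief_value X Y p r F c \<beta> B z"
proof -
  interpret M: discounted_mdp Z "borel_on B" \<eta> cost \<beta> cost_bound by (rule belief_mdp_discounted[OF B])
  obtain K where K: "\<And>z. z \<in> prob_measures X \<Longrightarrow> \<bar>value_iter k z\<bar> \<le> K" using tame_bounded[OF tame_value_iter] by blast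
  show ?thesis
    unfolding belief_value_def
  proof (rule M.discounted_value_ge[OF _ tame_measurable[OF tame_value_iter], where K=K])
    fix z a assume za: "z \<in> space Z" "a \<in> space (borel_on B)"
    then have z: "z \<in> prob_measures X" and a: "a \<in> A" using B(1) by (auto simp: space_borel_on)
    from value_iter_Suc_le[OF z a, of k] value_iter_diff[OF z, of k]
    show "value_iter k z \<le> cost z a + \<beta> * (\<integral>z'. value_iter k z' \<partial>\<eta> z a) + \<beta> ^ k * cost_bound"
      unfolding Q_def by linarith
  qed (use K z in auto)
qed

text \<open>In each belief, play the action in the net \<open>L\<close> that is best for the iterate. This stationary
  policy is a policy for every action set \<open>B\<close> between \<open>L\<close> and \<open>A\<close>, so that the same bound serves the
  value function of the net and that of \<open>A\<close>.\<close>

lemma belief_value_le_value_iter: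
  assumes L: "finite L" "L \<subseteq> A" "\<And>a. a \<in> A \<Longrightarrow> \<exists>b\<in>L. dist a b < 1 / real (Suc n)"
    and B: "L \<subseteq> B" "B \<subseteq> A" and z: "z \<in> prob_measures X"
  shows "belief_value X Y p r F c \<beta> B z \<le>
    value_iter k z + \<beta> ^ k * cost_bound / (1 - \<beta>) + (\<Sum>t. \<beta> ^ t * regret (value_iter k) n t z)"
proof -
  let ?v = "value_iter k"
  have "L \<noteq> {}" using L(3) A_nonempty by blast
  with B have "B \<noteq> {}" by auto
  interpret M: discounted_mdp Z "borel_on B" \<eta> cost \<beta> cost_bound by (rule belief_mdp_discounted[OF B(2) \<open>B \<noteq> {}\<close>])
  have Qm: "(\<lambda>z. Q ?v z b) \<in> borel_measurable Z" if "b \<in> A" for b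
  proof -
    obtain d K where "modulus_on X d" "\<And>a. a \<in> A \<Longrightarrow> tame_with X d K (\<lambda>z. Q ?v z a)"
      by (rule tame_with_Q[OF tame_value_iter[of k]]) (rule that)
    from tame_with_measurable[OF this(1) this(2)[OF that]] show ?thesis .
  qed
  obtain f where f: "f \<in> Z \<rightarrow>\<^sub>M borel_on B" "\<And>z. f z \<in> L" "\<And>z b. b \<in> L \<Longrightarrow> Q ?v z (f z) \<le> Q ?v z b"
  proof (rule measurable_argmin_finite[OF L(1) \<open>L \<noteq> {}\<close>, of "borel_on B" "\<lambda>b z. Q ?v z b" Z])
    show "L \<subseteq> space (borel_on B)" using B(1) by (simp add: space_borel_on)
    show "(\<lambda>z. Q ?v z b) \<in> borel_measurable Z" if "b \<in> L" for b using Qm L(2) that by blast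
  qed (rule that)
  obtain K where K: "\<And>z. z \<in> prob_measures X \<Longrightarrow> \<bar>?v z\<bar> \<le> K" using tame_bounded[OF tame_value_iter] by blast
  obtain C where C: "\<And>n k' z. z \<in> prob_measures X \<Longrightarrow> 0 \<le> regret ?v n k' z"
    "\<And>n k' z. z \<in> prob_measures X \<Longrightarrow> regret ?v n k' z \<le> C" using regret_bounds[OF tame_value_iter[of k]] by metis
  show ?thesis
    unfolding belief_value_def
  proof (rule M.discounted_value_le[OF _ f(1) tame_measurable[OF tame_value_iter] _ tame_measurable[OF tame_regret[OF tame_value_iter]],
        where K=K and K'=C])
    show "(\<integral>z'. regret ?v n t z' \<partial>\<eta> z a) \<le> regret ?v n (Suc t) z"
      if "z \<in> space Z" "a \<in> space (borel_on B)" for t z a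
      using that B(2) by (intro regret_Suc_upper tame_value_iter) (auto simp: space_borel_on)
    fix z assume "z \<in> space Z"
    then have z: "z \<in> prob_measures X" by simp
    have "Q ?v z (f z) - oscillation ?v n z \<le> (INF a\<in>A. Q ?v z a)"
    proof (rule cINF_greatest[OF A_nonempty])
      fix a assume a: "a \<in> A"
      obtain b where b: "b \<in> L" "dist a b < 1 / real (Suc n)" using L(3)[OF a] by auto
      have "\<bar>Q ?v z a - Q ?v z b\<bar> \<le> oscillation ?v n z"
        using b L(2) by (intro oscillation_upper tame_value_iter z a) auto
      with f(3)[OF b(1), of z] show "Q ?v z (f z) - oscillation ?v n z \<le> Q ?v z a" by linarith
    qed
    then have "Q ?v z (f z) \<le> value_iter (Suc k) z + regret ?v n 0 z" by simp
    also have "value_iter (Suc k) z \<le> ?v z + \<beta> ^ k * cost_bound" using value_iter_diff[OF z, of k] by linarith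
    finally show "cost z (f z) + \<beta> * (\<integral>z'. ?v z' \<partial>\<eta> z (f z)) \<le> ?v z + regret ?v n 0 z + \<beta> ^ k * cost_bound"
      unfolding Q_def by linarith
  qed (use K C z in auto)
qed

text \<open>Both value functions lie between the same lower and upper bounds, whose gap is made small by
  first choosing the iterate and then refining the net.\<close>

theorem belief_value_nets_tendsto:
  assumes nets: "\<And>n. 1 \<le> n \<Longrightarrow> finite (\<Lambda> n) \<and> \<Lambda> n \<subseteq> A \<and> (\<forall>a\<in>A. \<exists>b\<in>\<Lambda> n. dist a b < 1 / real n)"
    and z: "z \<in> prob_measures X"
  shows "(\<lambda>n. \<bar>belief_value X Y p r F c \<beta> (\<Lambda> n) z - belief_value X Y p r F c \<beta> A z\<bar>) \<longlonglongrightarrow> 0"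
proof (rule LIMSEQ_imp_Suc, rule LIMSEQ_I)
  fix e :: real assume e: "0 < e"
  have "(\<lambda>k. 2 * (\<beta> ^ k * cost_bound / (1 - \<beta>))) \<longlonglongrightarrow> 2 * (0 * cost_bound / (1 - \<beta>))"
    using \<beta> by (intro tendsto_intros LIMSEQ_power_zero) auto
  then have "\<forall>\<^sub>F k in sequentially. 2 * (\<beta> ^ k * cost_bound / (1 - \<beta>)) < e / 2"
    using e by (intro order_tendstoD(2)) auto
  then obtain k where k: "2 * (\<beta> ^ k * cost_bound / (1 - \<beta>)) < e / 2"
    using eventually_happens trivial_limit_sequentially by blast
  obtain C where C: "\<And>n t z. z \<in> prob_measures X \<Longrightarrow> 0 \<le> regret (value_iter k) n t z"
    "\<And>n t z. z \<in> prob_measures X \<Longrightarrow> regret (value_iter k) n t z \<le> C" using regret_bounds[OF tame_value_iter[of k]] by metis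
  have "(\<lambda>n. \<Sum>t. \<beta> ^ t * regret (value_iter k) n t z) \<longlonglongrightarrow> 0"
    using C z by (intro discounted_suminf_tendsto_0[OF \<beta>, where B=C] regret_tendsto_0 tame_value_iter) auto
  then have "\<forall>\<^sub>F n in sequentially. (\<Sum>t. \<beta> ^ t * regret (value_iter k) n t z) < e / 2"
    using e by (intro order_tendstoD(2)) auto
  then obtain N where N: "\<And>n. N \<le> n \<Longrightarrow> (\<Sum>t. \<beta> ^ t * regret (value_iter k) n t z) < e / 2"
    by (auto simp: eventually_sequentially)
  show "\<exists>N. \<forall>n\<ge>N. norm (\<bar>belief_value X Y p r F c \<beta> (\<Lambda> (Suc n)) z - belief_value X Y p r F c \<beta> A z\<bar> - 0) < e"
  proof (intro exI[of _ N] allI impI)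
    fix n assume n: "N \<le> n"
    have net: "finite (\<Lambda> (Suc n))" "\<Lambda> (Suc n) \<subseteq> A" "\<And>a. a \<in> A \<Longrightarrow> \<exists>b\<in>\<Lambda> (Suc n). dist a b < 1 / real (Suc n)"
      using nets[of "Suc n"] by auto
    then have "\<Lambda> (Suc n) \<noteq> {}" using A_nonempty by blast
    note upper = belief_value_le_value_iter[OF net _ _ z, of _ k]
    note lower = belief_value_ge_value_iter[OF _ _ z, of _ k]
    show "norm (\<bar>belief_value X Y p r F c \<beta> (\<Lambda> (Suc n)) z - belief_value X Y p r F c \<beta> A z\<bar> - 0) < e"
      using upper[of "\<Lambda> (Suc n)"] upper[of A] lower[of "\<Lambda> (Suc n)"] lower[of A]
        net(2) \<open>\<Lambda> (Suc n) \<noteq> {}\<close> A_nonempty N[OF n] k by simp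
  qed
qed

end

theorem theorem5p2:
  fixes X :: "'x::polish_space set" and A :: "'a::polish_space set" and Y :: "'y::polish_space set"
    and p :: "'x \<Rightarrow> 'a \<Rightarrow> 'x measure" and r :: "'x \<Rightarrow> 'y measure"
    and c :: "'x \<Rightarrow> 'a \<Rightarrow> real" and \<beta> :: real
    and F :: "'x measure \<Rightarrow> 'a \<Rightarrow> 'y \<Rightarrow> 'x measure"
    and \<Lambda> :: "nat \<Rightarrow> 'a set"
  assumes borel: "X \<in> sets borel" "A \<in> sets borel" "Y \<in> sets borel"
    and \<beta>: "0 < \<beta>" "\<beta> < 1"
    and p_kernel: "(\<lambda>(x, a). p x a) \<in> borel_on X \<Otimes>\<^sub>M borel_on A \<rightarrow>\<^sub>M prob_algebra (borel_on X)"
    and r_kernel: "r \<in> borel_on X \<rightarrow>\<^sub>M prob_algebra (borel_on Y)"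
    and c_nonneg: "\<And>x a. x \<in> X \<Longrightarrow> a \<in> A \<Longrightarrow> 0 \<le> c x a"
    and c_cont: "continuous_on (X \<times> A) (\<lambda>(x, a). c x a)"
    and c_bdd: "bounded ((\<lambda>(x, a). c x a) ` (X \<times> A))"
    and p_weak: "weakly_continuous_kernel X A p"
    and r_tv: "tv_continuous_kernel X r"
    and A_compact: "compact A"
    and F: "is_belief_update X A Y p r F"
    and nets: "\<And>n. 1 \<le> n \<Longrightarrow> finite (\<Lambda> n) \<and> \<Lambda> n \<subseteq> A \<and>
                 (\<forall>a\<in>A. \<exists>b\<in>\<Lambda> n. dist a b < 1 / real n)"
  shows "\<forall>z \<in> prob_measures X.
    (\<lambda>n. \<bar>belief_value X Y p r F c \<beta> (\<Lambda> n) z - belief_value X Y p r F c \<beta> A z\<bar>) \<longlonglongrightarrow> 0"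
proof (cases "A = {}")
  case True
  have eq: "\<Lambda> n = A" if "1 \<le> n" for n using nets[OF that] True by auto
  have "\<forall>\<^sub>F n in sequentially. \<bar>belief_value X Y p r F c \<beta> (\<Lambda> n) z - belief_value X Y p r F c \<beta> A z\<bar> = 0" for z
    by (rule eventually_mono[OF eventually_ge_at_top[of 1]]) (simp only: eq diff_self abs_zero)
  then show ?thesis by (intro ballI tendsto_eventually)
next
  case False
  interpret belief_mdp X A Y p r c \<beta> F
    by unfold_locales (fact borel \<beta> p_kernel r_kernel c_cont c_bdd p_weak r_tv A_compact False F)+
  show ?thesis by (intro ballI belief_value_nets_tendsto nets)
qed

end
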